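(* Let $(X,Y)=(X_k,Y_k)_{k\in\mathbb{Z}}$ be a stationary ergodic hidden Markov model in a Polish space $E\times F$ whose observation kernel has a density, and let $\Pi_k=\mathbf{P}[X_k\in\cdot\,|Y_0,\ldots,Y_k]$ be the nonlinear filter. Suppose that the filtering process $\Pi=(\Pi_k)_{k\ge0}$ is uniquely ergodic, that is, the filter transition kernel $\mathscr{P}$ possesses a unique invariant probability measure. Then the filter is both mean-square optimal and pathwise optimal: for every bounded measurable function $f:E\to\mathbb{R}$ and every sequence of measurable functions $\hat f_k:F^{k+1}\to\mathbb{R}$, $k\ge0$, $$\mathbf{E}\big[\{f(X_k)-\Pi_k(f)\}^2\big]\le\mathbf{E}\big[\{f(X_k)-\hat f_k(Y_0,\ldots,Y_k)\}^2\big]\quad\text{for every }k\ge 0,$$ and $$\liminf_{N\to\infty}\Bigg[\frac1N\sum_{k=1}^N\{f(X_k)-\hat f_k(Y_0,\ldots,Y_k)\}^2-\frac1N\sum_{k=1}^N\{f(X_k)-\Pi_k(f)\}^2\Bigg]\ge0\quad\text{a.s.}$$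
   Context: Hidden Markov model: $(X,Y)$ is a Markov chain on $E\times F$ whose transition kernel factors as $\tilde P(x,y,dx',dy')=P(x,dx')\,\Phi(x',dy')$, where $P$ is a transition kernel on $E$ and $\Phi$ a kernel from $E$ to $F$. It is assumed that $\Phi(x,dy)=g(x,y)\,\varphi(dy)$ for some measurable function $g\ge0$ and a reference measure $\varphi$ on $F$. Notation: $\Pi_k(f)=\int f\,d\Pi_k$. The filter transition kernel: the measure-valued process $\Pi$ is a Markov chain on the space $\mathcal{P}(E)$ of probability measures on $E$, with transition kernel $\mathscr{P}$ given as follows: for $\mu\in\mathcal{P}(E)$, $\mathscr{P}(\mu,\cdot\,)$ is the law of the random measure $A\mapsto\frac{\int_A g(x',y)\,\mu P(dx')}{\int g(x',y)\,\mu P(dx')}$ when $y$ is distributed according to $\big(\int g(x',y)\,\mu P(dx')\big)\varphi(dy)$, where $\mu P(dx')=\int\mu(dx)P(x,dx')$. *)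

theory Defs
  imports "HOL-Probability.Probability"
begin

definition process_sigma :: "'w measure \<Rightarrow> 'i set \<Rightarrow> ('i \<Rightarrow> 'w \<Rightarrow> 's::topological_space) \<Rightarrow> 'w measure"
  where "process_sigma M I Z =
    vimage_algebra (space M) (\<lambda>\<omega>. \<lambda>i\<in>I. Z i \<omega>) (PiM I (\<lambda>_. borel))"

(* K is a version of the regular conditional distribution P[V \<in> . | G]. *)
definition regular_cond_distr ::
    "'w measure \<Rightarrow> 'w measure \<Rightarrow> ('w \<Rightarrow> 's::topological_space) \<Rightarrow> ('w \<Rightarrow> 's measure) \<Rightarrow> bool"
  where "regular_cond_distr M G V K \<longleftrightarrow>
    K \<in> G \<rightarrow>\<^sub>M prob_algebra borel \<and>
    (\<forall>A\<in>sets borel. AE \<omega> in M. real_cond_exp M G (\<lambda>\<omega>. indicator A (V \<omega>)) \<omega> = measure (K \<omega>) A)"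

definition path_law :: "'w measure \<Rightarrow> (int \<Rightarrow> 'w \<Rightarrow> 's::topological_space) \<Rightarrow> (int \<Rightarrow> 's) measure"
  where "path_law M Z = distr M (PiM UNIV (\<lambda>_. borel)) (\<lambda>\<omega> k. Z k \<omega>)"

definition shift :: "(int \<Rightarrow> 's) \<Rightarrow> int \<Rightarrow> 's"
  where "shift z = (\<lambda>k. z (k + 1))"

definition stationary :: "'w measure \<Rightarrow> (int \<Rightarrow> 'w \<Rightarrow> 's::topological_space) \<Rightarrow> bool"
  where "stationary M Z \<longleftrightarrow> path_law M (\<lambda>k. Z (k + 1)) = path_law M Z"

definition ergodic :: "'w measure \<Rightarrow> (int \<Rightarrow> 'w \<Rightarrow> 's::topological_space) \<Rightarrow> bool"
  where "ergodic M Z \<longleftrightarrow>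
    (\<forall>A\<in>sets (PiM UNIV (\<lambda>_. borel)). shift -` A = A \<longrightarrow> measure (path_law M Z) A \<in> {0, 1})"

(* P(x, dx') \<Phi>(x', dy') *)
definition hmm_kernel ::
    "('e \<Rightarrow> 'e measure) \<Rightarrow> ('e \<Rightarrow> 'f measure) \<Rightarrow> 'e \<times> 'f \<Rightarrow> ('e::topological_space \<times> 'f::topological_space) measure"
  where "hmm_kernel P \<Phi> = (\<lambda>(x, y). P x \<bind> (\<lambda>x'. \<Phi> x' \<bind> (\<lambda>y'. return borel (x', y'))))"

locale hidden_markov_model = prob_space M
  for M :: "'w measure"
    and X :: "int \<Rightarrow> 'w \<Rightarrow> 'e::polish_space" and Y :: "int \<Rightarrow> 'w \<Rightarrow> 'f::polish_space"
    and P :: "'e \<Rightarrow> 'e measure" and \<Phi> :: "'e \<Rightarrow> 'f measure" +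
  assumes X_measurable: "X k \<in> borel_measurable M"
    and Y_measurable: "Y k \<in> borel_measurable M"
    and P_kernel: "P \<in> borel \<rightarrow>\<^sub>M prob_algebra borel"
    and \<Phi>_kernel: "\<Phi> \<in> borel \<rightarrow>\<^sub>M prob_algebra borel"
    and markov: "regular_cond_distr M (process_sigma M {..k} (\<lambda>j \<omega>. (X j \<omega>, Y j \<omega>)))
      (\<lambda>\<omega>. (X (k + 1) \<omega>, Y (k + 1) \<omega>)) (\<lambda>\<omega>. hmm_kernel P \<Phi> (X k \<omega>, Y k \<omega>))"

definition observation_density ::
    "('e::topological_space \<Rightarrow> 'f::topological_space measure) \<Rightarrow> ('e \<Rightarrow> 'f \<Rightarrow> real) \<Rightarrow> 'f measure \<Rightarrow> bool"
  where "observation_density \<Phi> g \<phi> \<longleftrightarrow>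
    sets \<phi> = sets borel \<and> sigma_finite_measure \<phi> \<and>
    (\<lambda>(x, y). g x y) \<in> borel_measurable borel \<and> (\<forall>x y. 0 \<le> g x y) \<and>
    (\<forall>x. \<Phi> x = density \<phi> (\<lambda>y. ennreal (g x y)))"

definition likelihood :: "('e \<Rightarrow> 'f \<Rightarrow> real) \<Rightarrow> 'e measure \<Rightarrow> 'f \<Rightarrow> ennreal"
  where "likelihood g \<nu> y = (\<integral>\<^sup>+x. ennreal (g x y) \<partial>\<nu>)"

(* The quotient is undefined when the likelihood is 0 or infinite. This happens with probability 0
   under the law of the observation, so the value chosen there does not affect filter_kernel; it
   is taken to be a probability measure so that bayes maps into prob_algebra. *)
definition bayes :: "('e \<Rightarrow> 'f \<Rightarrow> real) \<Rightarrow> 'e measure \<Rightarrow> 'f \<Rightarrow> 'e measure"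
  where "bayes g \<nu> y =
    (if likelihood g \<nu> y \<in> {0, \<infinity>} then \<nu>
     else density \<nu> (\<lambda>x. ennreal (g x y) / likelihood g \<nu> y))"

definition filter_kernel ::
    "('e::topological_space \<Rightarrow> 'e measure) \<Rightarrow> ('e \<Rightarrow> 'f \<Rightarrow> real) \<Rightarrow> 'f measure \<Rightarrow> 'e measure \<Rightarrow> 'e measure measure"
  where "filter_kernel P g \<phi> \<mu> =
    distr (density \<phi> (likelihood g (\<mu> \<bind> P))) (prob_algebra borel) (bayes g (\<mu> \<bind> P))"

definition invariant_prob :: "'s measure \<Rightarrow> ('s \<Rightarrow> 's measure) \<Rightarrow> 's measure \<Rightarrow> bool"
  where "invariant_prob S K m \<longleftrightarrow> m \<in> space (prob_algebra S) \<and> m \<bind> K = m"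

definition uniquely_ergodic :: "'s measure \<Rightarrow> ('s \<Rightarrow> 's measure) \<Rightarrow> bool"
  where "uniquely_ergodic S K \<longleftrightarrow> (\<exists>!m. invariant_prob S K m)"

definition nonlinear_filter ::
    "'w measure \<Rightarrow> (int \<Rightarrow> 'w \<Rightarrow> 'e::topological_space) \<Rightarrow> (int \<Rightarrow> 'w \<Rightarrow> 'f::topological_space)
      \<Rightarrow> (nat \<Rightarrow> 'w \<Rightarrow> 'e measure) \<Rightarrow> bool"
  where "nonlinear_filter M X Y \<pi> \<longleftrightarrow>
    (\<forall>k. regular_cond_distr M (process_sigma M {0..int k} Y) (X (int k)) (\<pi> k))"

end

theory Submission
  imports Defs "HOL-Library.Discrete_Functions"
begin

text \<open>Write \<open>\<xi>\<^sub>k = f(X\<^sub>k)\<close>. The loss of a truncated strategy minus that of the filter is at least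
  \<open>-2 h\<^sub>k (\<xi>\<^sub>k - \<Pi>\<^sub>k(f))\<close>, where \<open>h\<^sub>k\<close> is bounded and depends on \<open>Y\<^sub>0, \<dots>, Y\<^sub>k\<close>, so it suffices that the averages of
  \<open>h\<^sub>k (\<xi>\<^sub>k - \<Pi>\<^sub>k(f))\<close> vanish. Let \<open>L\<^sub>j\<close> be the conditional expectation of \<open>\<xi>\<^sub>k\<close> given the signal up to
  time \<open>k - j\<close> and the observations up to time \<open>k\<close>. Then \<open>\<xi>\<^sub>k - \<Pi>\<^sub>k(f)\<close> is the sum of \<open>L\<^sub>j - L\<^sub>j\<^sub>+\<^sub>1\<close>
  for \<open>j < n\<close> and of \<open>L\<^sub>n - \<Pi>\<^sub>k(f)\<close>. For fixed \<open>j\<close>, the products of \<open>h\<^sub>k\<close> with the former are bounded martingale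
  differences in \<open>k\<close>, and their averages vanish. The average of the remainder is controlled by the
  maximal ergodic inequality, provided that it is small in \<open>L\<^sup>1\<close>. By reverse martingale convergence
  and Doob's maximal inequality this holds if conditioning on the remote past of the signal, in addition to the
  observations, gives no more information than the observations alone. Both conditional
  distributions have a law that is invariant under the filter kernel. For the remote past this rests on
  the density of the observations, which allows the limit to pass through Bayes' formula, even though
  intersections of sigma-algebras do not commute with adjoining an observation in general. As the invariant law is unique,
  the two conditional expectations have the same second moment. One is a projection of the
  other, hence they are equal.\<close>

section \<open>Conditional expectations along monotone sequences of sigma-algebras\<close>

text \<open>The filter at time \<open>k\<close> sees observations from time 0 on. Shifted back to
  time 0, its window is \<open>{- int k..0}\<close> and changes with \<open>k\<close>, so its errors
  are not values of one function along the shift orbit. What replaces this is a single integrable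
  function \<open>S n\<close> of small mean that bounds the remainder at all times
  \<open>k \<ge> n\<close>; hence the supremum over windows, which L1 convergence alone would not
  control. The maximal ergodic inequality then bounds the probability that the averages of
  \<open>S n\<close> ever become large. The event to be excluded does not depend on
  \<open>n\<close>, so letting \<open>n\<close> grow finishes the proof without identifying any
  limit of averages. In the limit through Bayes' formula the observation is integrated out against
  its conditional density. For a fixed value \<open>y\<close> the unnormalised weights are
  conditional expectations of one function of the signal, so reverse martingale convergence applies
  separately for each \<open>y\<close>. Dominated convergence in \<open>y\<close> does the rest,
  with a multiple of the unconditional density of the observation as majorant.\<close>

context prob_space
begin

text \<open>Nonnegativity of the variance of \<open>\<bar>V\<bar>\<close>. It turns the L2 distances
  supplied by orthogonality of projections into L1 distances.\<close>

lemma expectation_abs_le_sqrt: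
  assumes "integrable M (\<lambda>x. (V x)\<^sup>2)" "V \<in> borel_measurable M"
  shows "expectation (\<lambda>x. \<bar>V x :: real\<bar>) \<le> sqrt (expectation (\<lambda>x. (V x)\<^sup>2))"
proof -
  have i: "integrable M V"
    using assms square_integrable_imp_integrable by blast
  have "0 \<le> variance (\<lambda>x. \<bar>V x\<bar>)" by (rule variance_positive)
  also have "\<dots> = expectation (\<lambda>x. (V x)\<^sup>2) - (expectation (\<lambda>x. \<bar>V x\<bar>))\<^sup>2"
    using assms i by (subst variance_eq) auto
  finally show ?thesis by (intro real_le_rsqrt) simp
qed

text \<open>Completeness of L1, with the limit given as a concrete pointwise \<open>lim\<close>
  along a subsequence. From the concrete form a caller can read off measurability with respect to a
  smaller sigma-algebra.\<close>

lemma L1_Cauchy_limit: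
  fixes u :: "nat \<Rightarrow> 'a \<Rightarrow> real"
  assumes u[measurable]: "\<And>n. integrable M (u n)"
    and cauchy: "\<And>e. e > 0 \<Longrightarrow> \<exists>N. \<forall>m\<ge>N. \<forall>n\<ge>N. expectation (\<lambda>x. \<bar>u m x - u n x\<bar>) < e"
  obtains r where "strict_mono r" "integrable M (\<lambda>x. lim (\<lambda>n. u (r n) x))"
    "(\<lambda>n. expectation (\<lambda>x. \<bar>u n x - lim (\<lambda>n. u (r n) x)\<bar>)) \<longlonglongrightarrow> 0"
proof -
  have [measurable]: "u n \<in> borel_measurable M" for n using u by auto
  \<comment> \<open>Geometric tolerances make the increments along the subsequence summable in L1,
    hence almost surely summable.\<close>
  define N where "N k = (SOME N. \<forall>m\<ge>N. \<forall>n\<ge>N. expectation (\<lambda>x. \<bar>u m x - u n x\<bar>) < (1/2)^k)" for k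
  have N: "expectation (\<lambda>x. \<bar>u m x - u n x\<bar>) < (1/2)^k" if "m \<ge> N k" "n \<ge> N k" for m n k
    using someI_ex[OF cauchy[of "(1/2)^k"]] that unfolding N_def by simp
  \<comment> \<open>Adding \<open>k\<close> to a partial sum of the \<open>N i\<close> makes
    \<open>r\<close> strictly increasing and keeps \<open>r k \<ge> N k\<close>.\<close>
  define r where "r k = k + (\<Sum>i\<le>k. N i)" for k
  have r: "strict_mono r" by (rule strict_mono_Suc_iff[THEN iffD2]) (auto simp: r_def)
  have rN: "r k \<ge> N k" for k
    using member_le_sum[of k "{..k}" N] by (simp add: r_def)
  have "(\<integral>\<^sup>+x. (\<Sum>k. ennreal \<bar>u (r (Suc k)) x - u (r k) x\<bar>) \<partial>M)
      = (\<Sum>k. \<integral>\<^sup>+x. ennreal \<bar>u (r (Suc k)) x - u (r k) x\<bar> \<partial>M)"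
    by (rule nn_integral_suminf) measurable
  also have "\<dots> = (\<Sum>k. ennreal (expectation (\<lambda>x. \<bar>u (r (Suc k)) x - u (r k) x\<bar>)))"
    using u by (subst nn_integral_eq_integral) auto
  also have "\<dots> \<le> (\<Sum>k. ennreal ((1/2)^k))"
  proof (rule suminf_le)
    fix k
    have "N k \<le> r (Suc k)" using rN[of k] strict_monoD[OF r, of k "Suc k"] by simp
    then show "ennreal (expectation (\<lambda>x. \<bar>u (r (Suc k)) x - u (r k) x\<bar>)) \<le> ennreal ((1/2)^k)"
      by (intro ennreal_leI less_imp_le[OF N] rN)
  qed auto
  also have "\<dots> = ennreal (\<Sum>k. (1/2)^k)" by (intro suminf_ennreal2) (auto intro: summable_geometric)
  also have "\<dots> < \<infinity>" by simp
  finally have fin: "(\<integral>\<^sup>+x. (\<Sum>k. ennreal \<bar>u (r (Suc k)) x - u (r k) x\<bar>) \<partial>M) \<noteq> \<infinity>" by simp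
  have "AE x in M. (\<Sum>k. ennreal \<bar>u (r (Suc k)) x - u (r k) x\<bar>) \<noteq> \<infinity>"
    by (rule nn_integral_PInf_AE[OF _ fin]) measurable
  then have conv: "AE x in M. convergent (\<lambda>k. u (r k) x)"
  proof eventually_elim
    case (elim x)
    then have "summable (\<lambda>k. \<bar>u (r (Suc k)) x - u (r k) x\<bar>)"
      by (intro summable_suminf_not_top) auto
    then have "summable (\<lambda>k. u (r (Suc k)) x - u (r k) x)" by (rule summable_rabs_cancel)
    then have "convergent (\<lambda>n. \<Sum>k<n. u (r (Suc k)) x - u (r k) x)" by (simp add: summable_iff_convergent)
    then have "convergent (\<lambda>n. u (r n) x - u (r 0) x)" by (subst (asm) sum_lessThan_telescope)
    from convergent_add[OF this convergent_const[of "u (r 0) x"]] show ?case by simp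
  qed
  define w where "w x = lim (\<lambda>n. u (r n) x)" for x
  have [measurable]: "w \<in> borel_measurable M" unfolding w_def by (rule borel_measurable_lim_metric) auto
  have lim: "AE x in M. (\<lambda>k. u (r k) x) \<longlonglongrightarrow> w x"
    using conv by eventually_elim (simp add: w_def convergent_LIMSEQ_iff)
  \<comment> \<open>Fatou's lemma in the second index: \<open>u n\<close> is compared with
    \<open>u (r j)\<close> as \<open>j\<close> grows. This controls the whole sequence and not only
    the subsequence.\<close>
  have bound: "(\<integral>\<^sup>+x. ennreal \<bar>u n x - w x\<bar> \<partial>M) \<le> ennreal ((1/2)^k)" if "n \<ge> N k" for n k
  proof -
    have "(\<integral>\<^sup>+x. ennreal \<bar>u n x - w x\<bar> \<partial>M) = (\<integral>\<^sup>+x. liminf (\<lambda>j. ennreal \<bar>u n x - u (r j) x\<bar>) \<partial>M)"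
    proof (rule nn_integral_cong_AE, use lim in eventually_elim)
      case (elim x)
      then have "(\<lambda>j. ennreal \<bar>u n x - u (r j) x\<bar>) \<longlonglongrightarrow> ennreal \<bar>u n x - w x\<bar>"
        by (intro tendsto_intros)
      then show ?case using lim_imp_Liminf[OF sequentially_bot] by fastforce
    qed
    also have "\<dots> \<le> liminf (\<lambda>j. \<integral>\<^sup>+x. ennreal \<bar>u n x - u (r j) x\<bar> \<partial>M)"
      by (rule nn_integral_liminf) measurable
    also have "\<dots> = liminf (\<lambda>j. ennreal (expectation (\<lambda>x. \<bar>u n x - u (r j) x\<bar>)))"
      using u by (subst nn_integral_eq_integral) auto
    also have "\<dots> \<le> limsup (\<lambda>j. ennreal (expectation (\<lambda>x. \<bar>u n x - u (r j) x\<bar>)))"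
      by (rule Liminf_le_Limsup) simp
    also have "\<dots> \<le> ennreal ((1/2)^k)"
    proof (rule Limsup_bounded, rule eventually_sequentiallyI)
      fix j assume "k \<le> j"
      then have "N k \<le> r j" using rN[of k] strict_mono_mono[OF r] by (meson monoD order_trans)
      then show "ennreal (expectation (\<lambda>x. \<bar>u n x - u (r j) x\<bar>)) \<le> ennreal ((1/2)^k)"
        using N[OF that] by (intro ennreal_leI less_imp_le)
    qed
    finally show ?thesis .
  qed
  have iw: "integrable M (\<lambda>x. u n x - w x)" if "n \<ge> N 0" for n
    using bound[OF that] by (intro integrableI_bounded) (auto simp: order_le_less_trans)
  have w: "integrable M w"
    using Bochner_Integration.integrable_diff[OF u[of "N 0"] iw[of "N 0"]] by simp
  have bound': "expectation (\<lambda>x. \<bar>u n x - w x\<bar>) \<le> (1/2)^k" if "n \<ge> N k" for n k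
    using bound[OF that] u w by (subst (asm) nn_integral_eq_integral) auto
  have "(\<lambda>n. expectation (\<lambda>x. \<bar>u n x - w x\<bar>)) \<longlonglongrightarrow> 0"
  proof (rule LIMSEQ_I)
    fix e :: real assume "e > 0"
    then obtain k where k: "(1/2)^k < e" using real_arch_pow_inv[of e "1/2"] by auto
    show "\<exists>no. \<forall>n\<ge>no. norm (expectation (\<lambda>x. \<bar>u n x - w x\<bar>) - 0) < e"
      using bound'[of k] k by (intro exI[of _ "N k"]) (force simp: integral_nonneg_AE intro: order_le_less_trans)
  qed
  then show thesis using r w that[of r] unfolding w_def by simp
qed

section \<open>Contraction, orthogonality and martingale convergence in L1\<close>

lemma finite_measure_subalgebraI: "subalgebra M F \<Longrightarrow> finite_measure_subalgebra M F"
  by unfold_locales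

lemma cond_exp_contraction:
  assumes "subalgebra M F" "integrable M V"
  shows "expectation (\<lambda>x. \<bar>real_cond_exp M F V x\<bar>) \<le> expectation (\<lambda>x. \<bar>V x\<bar>)"
proof -
  interpret finite_measure_subalgebra M F by (rule finite_measure_subalgebraI) fact
  have i: "integrable M (\<lambda>x. \<bar>V x\<bar>)" using assms by auto
  have "AE x in M. \<bar>real_cond_exp M F V x\<bar> \<le> real_cond_exp M F (\<lambda>x. \<bar>V x\<bar>) x"
  proof -
    have a: "AE x in M. real_cond_exp M F V x \<le> real_cond_exp M F (\<lambda>x. \<bar>V x\<bar>) x"
      using assms by (intro real_cond_exp_mono) auto
    have b: "AE x in M. real_cond_exp M F (\<lambda>x. -\<bar>V x\<bar>) x \<le> real_cond_exp M F V x"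
      using assms by (intro real_cond_exp_mono) auto
    have c: "AE x in M. real_cond_exp M F (\<lambda>x. -1 * \<bar>V x\<bar>) x = -1 * real_cond_exp M F (\<lambda>x. \<bar>V x\<bar>) x"
      using i by (rule real_cond_exp_cmult)
    from a b c show ?thesis by eventually_elim auto
  qed
  then have "expectation (\<lambda>x. \<bar>real_cond_exp M F V x\<bar>) \<le> expectation (real_cond_exp M F (\<lambda>x. \<bar>V x\<bar>))"
    using assms i by (intro integral_mono_AE) (auto intro: real_cond_exp_int)
  then show ?thesis using real_cond_exp_int(2)[OF i] by simp
qed

lemma cond_exp_bounded:
  assumes "subalgebra M F" "V \<in> borel_measurable M" "\<And>x. \<bar>V x\<bar> \<le> C"
  shows "AE x in M. \<bar>real_cond_exp M F V x\<bar> \<le> C"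
proof -
  interpret finite_measure_subalgebra M F by (rule finite_measure_subalgebraI) fact
  have i: "integrable M V" using assms by (intro integrable_const_bound[of _ C]) auto
  have "AE x in M. real_cond_exp M F V x \<le> C"
    by (rule real_cond_exp_le_c[OF i]) (use assms abs_le_D1 in auto)
  moreover have "AE x in M. real_cond_exp M F V x \<ge> -C"
    by (rule real_cond_exp_ge_c[OF i]) (use assms in \<open>auto intro!: AE_I2 simp: abs_le_iff minus_le_iff\<close>)
  ultimately show ?thesis by eventually_elim auto
qed

text \<open>Pythagoras: projecting onto \<open>G\<close> and then onto the coarser \<open>F\<close>
  is projecting onto \<open>F\<close>, so the mixed term equals the second moment of the coarser
  projection. The identity yields monotone second moments and, when these coincide, equality of the
  projections.\<close>

lemma cond_exp_diff_square:
  assumes FG: "subalgebra M G" "subalgebra G F" and V: "V \<in> borel_measurable M" "\<And>x. \<bar>V x\<bar> \<le> C"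
  shows "expectation (\<lambda>x. (real_cond_exp M G V x - real_cond_exp M F V x)\<^sup>2)
    = expectation (\<lambda>x. (real_cond_exp M G V x)\<^sup>2) - expectation (\<lambda>x. (real_cond_exp M F V x)\<^sup>2)"
proof -
  let ?G = "real_cond_exp M G V" and ?F = "real_cond_exp M F V"
  have MF: "subalgebra M F" using FG by (auto simp: subalgebra_def)
  interpret F: finite_measure_subalgebra M F by (rule finite_measure_subalgebraI[OF MF])
  interpret G: finite_measure_subalgebra M G by (rule finite_measure_subalgebraI[OF FG(1)])
  have [measurable]: "?G \<in> borel_measurable M" "?F \<in> borel_measurable M" by auto
  have bG: "AE x in M. \<bar>?G x\<bar> \<le> C" by (rule cond_exp_bounded[OF FG(1) V])
  have bF: "AE x in M. \<bar>?F x\<bar> \<le> C" by (rule cond_exp_bounded[OF MF V])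
  have C: "0 \<le> C" using V(2)[of undefined] by auto
  have i: "integrable M V" using V by (intro integrable_const_bound[of _ C]) auto
  have iG: "integrable M ?G" using G.real_cond_exp_int[OF i] by simp
  have iGG: "integrable M (\<lambda>x. (?G x)\<^sup>2)"
    by (rule integrable_const_bound[of _ "C\<^sup>2"], use bG in eventually_elim) (auto simp: abs_le_square_iff[symmetric] C)
  have iFF: "integrable M (\<lambda>x. (?F x)\<^sup>2)"
    by (rule integrable_const_bound[of _ "C\<^sup>2"], use bF in eventually_elim) (auto simp: abs_le_square_iff[symmetric] C)
  have iFG: "integrable M (\<lambda>x. ?F x * ?G x)"
    by (rule integrable_const_bound[of _ "C*C"], use bF bG in eventually_elim)
      (auto simp: abs_mult C intro!: mult_mono)
  have "expectation (\<lambda>x. ?F x * ?G x) = expectation (\<lambda>x. ?F x * real_cond_exp M F ?G x)"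
    by (rule F.real_cond_exp_intg(2)[symmetric]) (use iFG in auto)
  also have "\<dots> = expectation (\<lambda>x. (?F x)\<^sup>2)"
  proof (rule integral_cong_AE)
    show "AE x in M. ?F x * real_cond_exp M F ?G x = (?F x)\<^sup>2"
      using F.real_cond_exp_nested_subalg[OF FG i] by eventually_elim (simp add: power2_eq_square)
  qed auto
  finally have "expectation (\<lambda>x. ?F x * ?G x) = expectation (\<lambda>x. (?F x)\<^sup>2)" .
  moreover have "expectation (\<lambda>x. (?G x - ?F x)\<^sup>2)
      = expectation (\<lambda>x. (?G x)\<^sup>2 + (?F x)\<^sup>2 - 2 * (?F x * ?G x))"
    by (intro Bochner_Integration.integral_cong) (auto simp: power2_eq_square algebra_simps)
  ultimately show ?thesis using iGG iFF iFG by simp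
qed

lemma cond_exp_square_integrable:
  assumes F: "subalgebra M F" and V: "V \<in> borel_measurable M" "\<And>x. \<bar>V x\<bar> \<le> C"
  shows "integrable M (\<lambda>x. (real_cond_exp M F V x)\<^sup>2)"
    "expectation (\<lambda>x. (real_cond_exp M F V x)\<^sup>2) \<le> C\<^sup>2"
proof -
  have C: "0 \<le> C" using V(2)[of undefined] by auto
  interpret F: finite_measure_subalgebra M F by (rule finite_measure_subalgebraI[OF F])
  have b: "AE x in M. (real_cond_exp M F V x)\<^sup>2 \<le> C\<^sup>2"
    using cond_exp_bounded[OF F V] by eventually_elim (auto simp: abs_le_square_iff[symmetric] C)
  then show i: "integrable M (\<lambda>x. (real_cond_exp M F V x)\<^sup>2)"
    by (intro integrable_const_bound[of _ "C\<^sup>2"]) auto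
  show "expectation (\<lambda>x. (real_cond_exp M F V x)\<^sup>2) \<le> C\<^sup>2"
    using integral_mono_AE[OF i _ b] by (simp add: prob_space)
qed

text \<open>The second moments of the projections are monotone and bounded by
  \<open>C\<^sup>2\<close>, so they form a Cauchy sequence, and by Pythagoras their differences are
  squared L2 distances. Increasing and decreasing sequences are treated together, as the estimate
  only needs \<open>G m\<close> and \<open>G n\<close> to be comparable.\<close>

lemma cond_exp_monotone_Cauchy:
  fixes G :: "nat \<Rightarrow> 'a measure"
  assumes G: "\<And>n. subalgebra M (G n)"
    and mono: "(\<forall>m n. m \<le> n \<longrightarrow> subalgebra (G n) (G m)) \<or> (\<forall>m n. m \<le> n \<longrightarrow> subalgebra (G m) (G n))"
    and V: "V \<in> borel_measurable M" "\<And>x. \<bar>V x\<bar> \<le> C" and e: "e > 0"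
  shows "\<exists>N. \<forall>m\<ge>N. \<forall>n\<ge>N. expectation (\<lambda>x. \<bar>real_cond_exp M (G m) V x - real_cond_exp M (G n) V x\<bar>) < e"
proof -
  define U where "U n = real_cond_exp M (G n) V" for n
  define a where "a n = expectation (\<lambda>x. (U n x)\<^sup>2)" for n
  have [measurable]: "U n \<in> borel_measurable M" for n by (auto simp: U_def)
  have iU: "integrable M (\<lambda>x. (U n x)\<^sup>2)" and a_le: "a n \<le> C\<^sup>2" for n
    using cond_exp_square_integrable[OF G V] by (auto simp: U_def a_def)
  have diff: "expectation (\<lambda>x. (U m x - U n x)\<^sup>2) = a m - a n" if "subalgebra (G m) (G n)" for m n
    unfolding U_def a_def by (rule cond_exp_diff_square[OF G that V])
  then have mono_a: "a n \<le> a m" if "subalgebra (G m) (G n)" for m n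
    using that by (smt (verit) integral_nonneg_AE AE_I2 zero_le_power2)
  have a0: "0 \<le> a n" for n unfolding a_def by simp
  have "Bseq a" by (rule BseqI'[of _ "C\<^sup>2"]) (simp add: a0 a_le)
  moreover have "monoseq a" using mono mono_a unfolding monoseq_def by auto
  ultimately have "convergent a" by (rule Bseq_monoseq_convergent)
  then have "Cauchy a" by (rule convergent_Cauchy)
  then obtain N where N: "\<And>m n. m \<ge> N \<Longrightarrow> n \<ge> N \<Longrightarrow> \<bar>a m - a n\<bar> < e\<^sup>2"
    using e unfolding Cauchy_def dist_real_def by (meson zero_less_power)
  have "expectation (\<lambda>x. \<bar>U m x - U n x\<bar>) < e" if mn: "m \<ge> N" "n \<ge> N" for m n
  proof -
    have "integrable M (\<lambda>x. U m x * U n x)"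
    proof (rule Bochner_Integration.integrable_bound[OF Bochner_Integration.integrable_add[OF iU[of m] iU[of n]]])
      have "\<bar>a * b\<bar> \<le> a\<^sup>2 + b\<^sup>2" for a b :: real
      proof -
        have "2 * (\<bar>a\<bar> * \<bar>b\<bar>) \<le> a\<^sup>2 + b\<^sup>2" using sum_squares_bound[of "\<bar>a\<bar>" "\<bar>b\<bar>"] by simp
        moreover have "0 \<le> \<bar>a\<bar> * \<bar>b\<bar>" by simp
        ultimately show ?thesis unfolding abs_mult by linarith
      qed
      then show "AE x in M. norm (U m x * U n x) \<le> norm ((U m x)\<^sup>2 + (U n x)\<^sup>2)"
        by (intro AE_I2) simp
    qed measurable
    then have i: "integrable M (\<lambda>x. (U m x - U n x)\<^sup>2)"
      using iU by (simp add: power2_diff mult.assoc)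
    have "expectation (\<lambda>x. (U m x - U n x)\<^sup>2) = \<bar>a m - a n\<bar>"
    proof -
      consider "subalgebra (G m) (G n)" | "subalgebra (G n) (G m)" using mono by (metis nat_le_linear)
      then show ?thesis
      proof cases
        case 1 then show ?thesis using diff[OF 1] mono_a[OF 1] by simp
      next
        case 2
        have "expectation (\<lambda>x. (U m x - U n x)\<^sup>2) = expectation (\<lambda>x. (U n x - U m x)\<^sup>2)"
          by (simp add: power2_commute)
        then show ?thesis using diff[OF 2] mono_a[OF 2] by simp
      qed
    qed
    with N[OF mn] have "sqrt (expectation (\<lambda>x. (U m x - U n x)\<^sup>2)) < sqrt (e\<^sup>2)" by (subst real_sqrt_less_iff) simp
    then show ?thesis using expectation_abs_le_sqrt[OF i] e by simp
  qed
  then show ?thesis unfolding U_def by blast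
qed

lemma integrable_mult_bounded:
  fixes V U :: "'a \<Rightarrow> real"
  assumes "integrable M V" "U \<in> borel_measurable M" "\<And>x. \<bar>U x\<bar> \<le> C"
  shows "integrable M (\<lambda>x. U x * V x)"
proof (rule Bochner_Integration.integrable_bound)
  show "integrable M (\<lambda>x. C * V x)" using assms by auto
  show "AE x in M. norm (U x * V x) \<le> norm (C * V x)"
  proof (rule AE_I2)
    fix x
    have "\<bar>U x\<bar> \<le> \<bar>C\<bar>" using assms(3)[of x] by auto
    then show "norm (U x * V x) \<le> norm (C * V x)" by (auto simp: abs_mult intro: mult_right_mono)
  qed
qed (use assms in auto)

lemma set_integral_cond_exp:
  assumes "subalgebra M F" "integrable M V" "A \<in> sets F"
  shows "(\<integral>x\<in>A. real_cond_exp M F V x \<partial>M) = (\<integral>x\<in>A. V x \<partial>M)"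
proof -
  interpret finite_measure_subalgebra M F by (rule finite_measure_subalgebraI) fact
  show ?thesis by (rule real_cond_exp_intA[symmetric]) (use assms in auto)
qed

lemma tendsto_set_integral_L1:
  assumes "\<And>n. integrable M (u n)" "integrable M w" "A \<in> sets M"
    and "(\<lambda>n. expectation (\<lambda>x. \<bar>u n x - w x :: real\<bar>)) \<longlonglongrightarrow> 0"
  shows "(\<lambda>n. \<integral>x\<in>A. u n x \<partial>M) \<longlonglongrightarrow> (\<integral>x\<in>A. w x \<partial>M)"
proof (rule LIM_zero_cancel, rule Lim_null_comparison[OF _ assms(4)], rule always_eventually, rule allI)
  fix n
  have i: "set_integrable M A (u n)" "set_integrable M A w"
    using assms unfolding set_integrable_def by (intro integrable_mult_indicator; simp)+
  have "norm ((\<integral>x\<in>A. u n x \<partial>M) - (\<integral>x\<in>A. w x \<partial>M)) = \<bar>\<integral>x\<in>A. (u n x - w x) \<partial>M\<bar>"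
    using set_integral_diff(2)[OF i] by simp
  also have "\<dots> \<le> (\<integral>x. \<bar>indicator A x * (u n x - w x)\<bar> \<partial>M)"
    unfolding set_lebesgue_integral_def by (simp add: integral_abs_bound)
  also have "\<dots> \<le> (\<integral>x. \<bar>u n x - w x\<bar> \<partial>M)"
    using assms by (intro integral_mono) (auto simp: indicator_def intro!: integrable_mult_bounded[of _ _ 1])
  finally show "norm ((\<integral>x\<in>A. u n x \<partial>M) - (\<integral>x\<in>A. w x \<partial>M)) \<le> (\<integral>x. \<bar>u n x - w x\<bar> \<partial>M)" .
qed

lemma expectation_abs_diff_AE_cong:
  assumes "AE x in M. a x = a' x" "a \<in> borel_measurable M" "a' \<in> borel_measurable M" "b \<in> borel_measurable M"
  shows "expectation (\<lambda>x. \<bar>b x - a x :: real\<bar>) = expectation (\<lambda>x. \<bar>b x - a' x\<bar>)"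
  by (rule integral_cong_AE) (use assms in auto)

text \<open>Reverse martingale convergence. Sets of \<open>F\<close> lie in every
  \<open>G n\<close>, so the integrals of the projections over them do not change with
  \<open>n\<close>; this identifies the L1 limit as the projection onto \<open>F\<close>.\<close>

lemma cond_exp_decreasing_bounded:
  fixes G :: "nat \<Rightarrow> 'a measure"
  assumes G: "\<And>n. subalgebra M (G n)" and mono: "\<And>m n. m \<le> n \<Longrightarrow> subalgebra (G m) (G n)"
    and F: "space F = space M" "sets F = (\<Inter>n. sets (G n))"
    and V: "V \<in> borel_measurable M" "\<And>x. \<bar>V x\<bar> \<le> C"
  shows "(\<lambda>n. expectation (\<lambda>x. \<bar>real_cond_exp M (G n) V x - real_cond_exp M F V x\<bar>)) \<longlonglongrightarrow> 0"
proof -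
  define U where "U n = real_cond_exp M (G n) V" for n
  have iV: "integrable M V" using V by (intro integrable_const_bound[of _ C]) auto
  have iU: "integrable M (U n)" for n
    unfolding U_def using finite_measure_subalgebraI[OF G[of n]] iV
    by (metis finite_measure_subalgebra_is_sigma_finite sigma_finite_subalgebra.real_cond_exp_int(1))
  have MF: "subalgebra M F" using G[of 0] F unfolding subalgebra_def by auto
  interpret F: finite_measure_subalgebra M F by (rule finite_measure_subalgebraI[OF MF])
  obtain r where r: "strict_mono r" and w: "integrable M (\<lambda>x. lim (\<lambda>n. U (r n) x))"
    "(\<lambda>n. expectation (\<lambda>x. \<bar>U n x - lim (\<lambda>n. U (r n) x)\<bar>)) \<longlonglongrightarrow> 0"
  proof (rule L1_Cauchy_limit[OF iU])
    show "\<exists>N. \<forall>m\<ge>N. \<forall>n\<ge>N. expectation (\<lambda>x. \<bar>U m x - U n x\<bar>) < e" if "e > 0" for e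
      unfolding U_def by (rule cond_exp_monotone_Cauchy[OF G disjI2 V that]) (use mono in blast)
  qed
  define w where "w x = lim (\<lambda>n. U (r n) x)" for x
  note w = w[folded w_def]
  \<comment> \<open>Discarding the first \<open>m\<close> terms leaves the limit unchanged, and all
    remaining terms are \<open>G m\<close>-measurable. Hence \<open>w\<close> is measurable for
    every \<open>G m\<close>, and so for their intersection.\<close>
  have "w \<in> borel_measurable (G m)" for m
  proof -
    have "w x = lim (\<lambda>n. U (r (n + m)) x)" for x
      unfolding w_def lim_def using LIMSEQ_ignore_initial_segment[of "\<lambda>n. U (r n) x" _ m]
        LIMSEQ_offset[of "\<lambda>n. U (r n) x" m] by (metis (no_types, lifting))
    moreover have "U (r (n + m)) \<in> borel_measurable (G m)" for n
    proof (rule measurable_from_subalg)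
      show "subalgebra (G m) (G (r (n + m)))" using mono strict_mono_imp_increasing[OF r, of "n + m"] by auto
      show "U (r (n + m)) \<in> borel_measurable (G (r (n + m)))" unfolding U_def by simp
    qed
    ultimately show ?thesis by (subst measurable_cong) (auto intro: borel_measurable_lim_metric)
  qed
  then have wF: "w \<in> borel_measurable F"
    using F G unfolding measurable_def subalgebra_def by auto
  have "AE x in M. real_cond_exp M F V x = w x"
  proof (rule F.real_cond_exp_charact[OF _ iV w(1) wF])
    fix A assume A: "A \<in> sets F"
    then have AM: "A \<in> sets M" using MF by (auto simp: subalgebra_def)
    have "(\<integral>x\<in>A. U n x \<partial>M) = (\<integral>x\<in>A. V x \<partial>M)" for n
      unfolding U_def using A F(2) by (intro set_integral_cond_exp[OF G iV]) auto
    then show "(\<integral>x\<in>A. V x \<partial>M) = (\<integral>x\<in>A. w x \<partial>M)"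
      using tendsto_set_integral_L1[OF iU w(1) AM w(2)] LIMSEQ_unique[OF tendsto_const] by simp
  qed
  then have "expectation (\<lambda>x. \<bar>U n x - real_cond_exp M F V x\<bar>) = expectation (\<lambda>x. \<bar>U n x - w x\<bar>)" for n
    using iU[of n] w(1) by (intro expectation_abs_diff_AE_cong) auto
  with w(2) show ?thesis unfolding U_def by simp
qed

text \<open>Dynkin's argument: the sets with equal integrals are closed under disjoint unions and,
  as the whole space is one of them, under complements. It serves unions of increasing
  sigma-algebras and joins with an observation, where only a generating pi-system is
  explicit.\<close>

lemma cond_exp_charact_generator:
  fixes V U :: "'a \<Rightarrow> real"
  assumes MF: "subalgebra M F" and F: "sets F = sigma_sets (space M) E" and Int: "Int_stable E" and full: "space M \<in> E"
    and V: "integrable M V" and U: "integrable M U" and UF: "U \<in> borel_measurable F"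
    and eq: "\<And>A. A \<in> E \<Longrightarrow> (\<integral>x\<in>A. V x \<partial>M) = (\<integral>x\<in>A. U x \<partial>M)"
  shows "AE x in M. real_cond_exp M F V x = U x"
proof -
  interpret F: finite_measure_subalgebra M F by (rule finite_measure_subalgebraI[OF MF])
  have GP: "E \<subseteq> Pow (space M)"
  proof
    fix A assume "A \<in> E"
    then have "A \<in> sets M" using F MF unfolding subalgebra_def by (auto intro: sigma_sets.Basic)
    then show "A \<in> Pow (space M)" using sets.sets_into_space by auto
  qed
  show ?thesis
  proof (rule F.real_cond_exp_charact[OF _ V U UF])
    fix A assume A: "A \<in> sets F"
    have si: "set_integrable M B V" "set_integrable M B U" if "B \<in> sigma_sets (space M) E" for B
    proof -
      have "B \<in> sets M" using that F MF by (auto simp: subalgebra_def)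
      then show "set_integrable M B V" "set_integrable M B U"
        using V U unfolding set_integrable_def by (intro integrable_mult_indicator; simp)+
    qed
    have SM: "B \<in> sets M" if "B \<in> sigma_sets (space M) E" for B
      using that F MF by (auto simp: subalgebra_def)
    show "(\<integral>x\<in>A. V x \<partial>M) = (\<integral>x\<in>A. U x \<partial>M)"
    proof (rule sigma_sets_induct_disjoint[OF Int GP A[unfolded F]])
      show "(\<integral>x\<in>A. V x \<partial>M) = (\<integral>x\<in>A. U x \<partial>M)" if "A \<in> E" for A by (rule eq[OF that])
      show "(\<integral>x\<in>{}. V x \<partial>M) = (\<integral>x\<in>{}. U x \<partial>M)" by (simp add: set_lebesgue_integral_def)
    next
      fix A assume A: "A \<in> sigma_sets (space M) E" and IH: "(\<integral>x\<in>A. V x \<partial>M) = (\<integral>x\<in>A. U x \<partial>M)"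
      have c: "space M - A \<in> sigma_sets (space M) E" using A by (rule sigma_sets.Compl)
      have "(\<integral>x\<in>space M. h x \<partial>M) = (\<integral>x\<in>A. h x \<partial>M) + (\<integral>x\<in>space M - A. h x \<partial>M)"
        if "set_integrable M A h" "set_integrable M (space M - A) h" for h :: "'a \<Rightarrow> real"
        using set_integral_Un[OF _ that] sets.sets_into_space[OF SM[OF A]] by (auto simp: Un_absorb1)
      from this[OF si(1)[OF A] si(1)[OF c]] this[OF si(2)[OF A] si(2)[OF c]] IH eq[OF full]
      show "(\<integral>x\<in>space M - A. V x \<partial>M) = (\<integral>x\<in>space M - A. U x \<partial>M)" by simp
    next
      fix A :: "nat \<Rightarrow> 'a set"
      assume d: "disjoint_family A" and A: "range A \<subseteq> sigma_sets (space M) E"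
        and IH: "\<And>i. (\<integral>x\<in>A i. V x \<partial>M) = (\<integral>x\<in>A i. U x \<partial>M)"
      have Un: "(\<Union>i. A i) \<in> sigma_sets (space M) E" using A by (intro sigma_sets.Union) auto
      have AM: "A i \<in> sets M" for i using SM A by auto
      have dj: "A i \<inter> A j = {}" if "i \<noteq> j" for i j using d that by (auto simp: disjoint_family_on_def)
      from lebesgue_integral_countable_add[OF AM dj si(1)[OF Un]] lebesgue_integral_countable_add[OF AM dj si(2)[OF Un]] IH
      show "(\<integral>x\<in>(\<Union>i. A i). V x \<partial>M) = (\<integral>x\<in>(\<Union>i. A i). U x \<partial>M)" by simp
    qed
  qed
qed

text \<open>Levy's upward theorem. Over a set of \<open>G m\<close> the projections have a constant
  integral from \<open>m\<close> on, so the L1 limit passes the test on the union of the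
  \<open>G n\<close>, an intersection-stable generator of \<open>F\<close>.\<close>

lemma cond_exp_increasing_bounded:
  fixes G :: "nat \<Rightarrow> 'a measure"
  assumes G: "\<And>n. subalgebra M (G n)" and mono: "\<And>m n. m \<le> n \<Longrightarrow> subalgebra (G n) (G m)"
    and F: "space F = space M" "sets F = sigma_sets (space M) (\<Union>n. sets (G n))"
    and V: "V \<in> borel_measurable M" "\<And>x. \<bar>V x\<bar> \<le> C"
  shows "(\<lambda>n. expectation (\<lambda>x. \<bar>real_cond_exp M (G n) V x - real_cond_exp M F V x\<bar>)) \<longlonglongrightarrow> 0"
proof -
  define U where "U n = real_cond_exp M (G n) V" for n
  have iV: "integrable M V" using V by (intro integrable_const_bound[of _ C]) auto
  have iU: "integrable M (U n)" for n
    unfolding U_def using finite_measure_subalgebraI[OF G[of n]] iV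
    by (metis finite_measure_subalgebra_is_sigma_finite sigma_finite_subalgebra.real_cond_exp_int(1))
  have GP: "(\<Union>n. sets (G n)) \<subseteq> Pow (space M)"
    using G sets.sets_into_space unfolding subalgebra_def by fastforce
  have MF: "subalgebra M F"
  proof -
    have "(\<Union>n. sets (G n)) \<subseteq> sets M" using G unfolding subalgebra_def by auto
    from sets.sigma_sets_subset[OF this] show ?thesis using F unfolding subalgebra_def by simp
  qed
  have FG: "sets (G n) \<subseteq> sets F" for n unfolding F by (auto intro: sigma_sets.Basic)
  interpret F: finite_measure_subalgebra M F by (rule finite_measure_subalgebraI[OF MF])
  obtain r where r: "strict_mono r" and w: "integrable M (\<lambda>x. lim (\<lambda>n. U (r n) x))"
    "(\<lambda>n. expectation (\<lambda>x. \<bar>U n x - lim (\<lambda>n. U (r n) x)\<bar>)) \<longlonglongrightarrow> 0"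
  proof (rule L1_Cauchy_limit[OF iU])
    show "\<exists>N. \<forall>m\<ge>N. \<forall>n\<ge>N. expectation (\<lambda>x. \<bar>U m x - U n x\<bar>) < e" if "e > 0" for e
      unfolding U_def by (rule cond_exp_monotone_Cauchy[OF G disjI1 V that]) (use mono in blast)
  qed
  define w where "w x = lim (\<lambda>n. U (r n) x)" for x
  note w = w[folded w_def]
  have UF: "U n \<in> borel_measurable F" for n
    by (rule measurable_from_subalg[of _ "G n"]) (use F FG G in \<open>auto simp: U_def subalgebra_def\<close>)
  have wF: "w \<in> borel_measurable F"
    unfolding w_def by (rule borel_measurable_lim_metric) (rule UF)
  have "AE x in M. real_cond_exp M F V x = w x"
  proof (rule cond_exp_charact_generator[OF MF F(2) _ _ iV w(1) wF])
    show "(\<integral>x\<in>A. V x \<partial>M) = (\<integral>x\<in>A. w x \<partial>M)" if AU: "A \<in> (\<Union>n. sets (G n))" for A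
    proof -
      obtain m where m: "A \<in> sets (G m)" using AU by auto
      then have AM: "A \<in> sets M" using G by (auto simp: subalgebra_def)
      have "(\<integral>x\<in>A. U n x \<partial>M) = (\<integral>x\<in>A. V x \<partial>M)" if "n \<ge> m" for n
        unfolding U_def using m mono[OF that]
        by (intro set_integral_cond_exp[OF G iV]) (auto simp: subalgebra_def)
      then have "eventually (\<lambda>n. (\<integral>x\<in>A. V x \<partial>M) = (\<integral>x\<in>A. U n x \<partial>M)) sequentially"
        by (intro eventually_sequentiallyI[of m]) simp
      then have "(\<lambda>n. \<integral>x\<in>A. U n x \<partial>M) \<longlonglongrightarrow> (\<integral>x\<in>A. V x \<partial>M)"
        by (rule Lim_transform_eventually[OF tendsto_const])
      then show ?thesis
        using tendsto_set_integral_L1[OF iU w(1) AM w(2)] LIMSEQ_unique by blast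
    qed
    show "Int_stable (\<Union>n. sets (G n))"
    proof (rule Int_stableI)
      fix a b assume "a \<in> (\<Union>n. sets (G n))" "b \<in> (\<Union>n. sets (G n))"
      then obtain i j where "a \<in> sets (G i)" "b \<in> sets (G j)" by auto
      then have "a \<in> sets (G (max i j))" "b \<in> sets (G (max i j))"
        using mono[of i "max i j"] mono[of j "max i j"] unfolding subalgebra_def by auto
      then show "a \<inter> b \<in> (\<Union>n. sets (G n))" by blast
    qed
    show "space M \<in> (\<Union>n. sets (G n))" using G[of 0] sets.top[of "G 0"] by (auto simp: subalgebra_def)
  qed
  then have "expectation (\<lambda>x. \<bar>U n x - real_cond_exp M F V x\<bar>) = expectation (\<lambda>x. \<bar>U n x - w x\<bar>)" for n
    using iU[of n] w(1) by (intro expectation_abs_diff_AE_cong) auto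
  with w(2) show ?thesis unfolding U_def by simp
qed

end

text \<open>The sets of \<open>F'\<close> are the preimages of sets of \<open>F\<close>, so the
  defining integrals transform by substitution. Source and target may differ, which covers the shift
  on path space as well as the passage from the original probability space to path space.\<close>

lemma real_cond_exp_distr:
  assumes M: "prob_space M" and T[measurable]: "T \<in> M \<rightarrow>\<^sub>M N" and N: "distr M N T = N"
    and F: "subalgebra N F" and F': "space F' = space M" "sets F' = (\<lambda>A. T -` A \<inter> space M) ` sets F"
    and V: "integrable N V"
  shows "AE x in M. real_cond_exp M F' (\<lambda>x. V (T x)) x = real_cond_exp N F V (T x)"
proof -
  interpret M: prob_space M by fact
  interpret N: prob_space N using M.prob_space_distr[OF T] N by simp
  have TF: "T \<in> F' \<rightarrow>\<^sub>M F"
    using F F' measurable_space[OF T] unfolding subalgebra_def by (auto intro!: measurableI)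
  have F'M: "subalgebra M F'" using F F' measurable_sets[OF T] unfolding subalgebra_def by auto
  interpret F': finite_measure_subalgebra M F' by (rule M.finite_measure_subalgebraI[OF F'M])
  interpret F: finite_measure_subalgebra N F by (rule N.finite_measure_subalgebraI[OF F])
  have [measurable]: "V \<in> borel_measurable N" using V by auto
  have iU: "integrable N (real_cond_exp N F V)" by (rule F.real_cond_exp_int[OF V])
  show ?thesis
  proof (rule F'.real_cond_exp_charact)
    show "integrable M (\<lambda>x. V (T x))" using V by (subst (asm) N[symmetric]) (simp add: integrable_distr_eq)
    show "integrable M (\<lambda>x. real_cond_exp N F V (T x))"
      using iU by (subst (asm) (1) N[symmetric]) (simp add: integrable_distr_eq)
    show "(\<lambda>x. real_cond_exp N F V (T x)) \<in> borel_measurable F'"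
      by (rule measurable_compose[OF TF]) simp
    fix A assume "A \<in> sets F'"
    then obtain B where B: "B \<in> sets F" "A = T -` B \<inter> space M" using F' by auto
    have [measurable]: "B \<in> sets N" using B F by (auto simp: subalgebra_def)
    have *: "(\<integral>x\<in>A. W (T x) \<partial>M) = (\<integral>x\<in>B. W x \<partial>N)" if [measurable]: "W \<in> borel_measurable N" for W :: "_ \<Rightarrow> real"
    proof -
      have "(\<integral>x\<in>B. W x \<partial>N) = (\<integral>x\<in>B. W x \<partial>distr M N T)" using N by simp
      also have "\<dots> = (\<integral>x. indicator B (T x) *\<^sub>R W (T x) \<partial>M)"
        unfolding set_lebesgue_integral_def by (rule integral_distr) measurable
      also have "\<dots> = (\<integral>x\<in>A. W (T x) \<partial>M)"
        unfolding set_lebesgue_integral_def B by (rule Bochner_Integration.integral_cong) (auto simp: indicator_def)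
      finally show ?thesis by simp
    qed
    show "(\<integral>x\<in>A. V (T x) \<partial>M) = (\<integral>x\<in>A. real_cond_exp N F V (T x) \<partial>M)"
      using *[of V] *[of "real_cond_exp N F V"] N.set_integral_cond_exp[OF F V B(1)] by simp
  qed
qed

section \<open>Integrable variables, maximal inequalities and averages along orbits\<close>

context prob_space
begin

lemma cond_exp_integrable: "subalgebra M F \<Longrightarrow> integrable M V \<Longrightarrow> integrable M (real_cond_exp M F V)"
  using finite_measure_subalgebraI
  by (metis finite_measure_subalgebra_is_sigma_finite sigma_finite_subalgebra.real_cond_exp_int(1))

lemma cond_exp_L1_diff:
  assumes F: "subalgebra M F" and V: "integrable M V" "integrable M W"
  shows "expectation (\<lambda>x. \<bar>real_cond_exp M F V x - real_cond_exp M F W x\<bar>) \<le> expectation (\<lambda>x. \<bar>V x - W x\<bar>)"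
proof -
  interpret finite_measure_subalgebra M F by (rule finite_measure_subalgebraI[OF F])
  have "expectation (\<lambda>x. \<bar>real_cond_exp M F V x - real_cond_exp M F W x\<bar>)
      = expectation (\<lambda>x. \<bar>real_cond_exp M F (\<lambda>x. V x - W x) x\<bar>)"
  proof (rule integral_cong_AE)
    show "AE x in M. \<bar>real_cond_exp M F V x - real_cond_exp M F W x\<bar> = \<bar>real_cond_exp M F (\<lambda>x. V x - W x) x\<bar>"
      using real_cond_exp_diff[OF V] by eventually_elim simp
  qed measurable
  also have "\<dots> \<le> expectation (\<lambda>x. \<bar>V x - W x\<bar>)"
    using V by (intro cond_exp_contraction[OF F]) auto
  finally show ?thesis .
qed

text \<open>Truncation and L1 contraction extend reverse martingale convergence beyond bounded
  variables. This is required because a likelihood, as a function of the previous state, need only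
  be integrable.\<close>

lemma cond_exp_decreasing:
  fixes G :: "nat \<Rightarrow> 'a measure"
  assumes G: "\<And>n. subalgebra M (G n)" and mono: "\<And>m n. m \<le> n \<Longrightarrow> subalgebra (G m) (G n)"
    and F: "space F = space M" "sets F = (\<Inter>n. sets (G n))"
    and V: "integrable M V"
  shows "(\<lambda>n. expectation (\<lambda>x. \<bar>real_cond_exp M (G n) V x - real_cond_exp M F V x\<bar>)) \<longlonglongrightarrow> 0"
proof (rule LIMSEQ_I)
  fix e :: real assume e: "e > 0"
  have [measurable]: "V \<in> borel_measurable M" using V by auto
  have MF: "subalgebra M F" using G[of 0] F unfolding subalgebra_def by auto
  define W where "W c x = max (- real c) (min (real c) (V x))" for c :: nat and x
  have W[measurable]: "W c \<in> borel_measurable M" for c unfolding W_def by measurable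
  have Wb: "\<bar>W c x\<bar> \<le> real c" for c x unfolding W_def by auto
  have iW: "integrable M (W c)" for c using Wb by (intro integrable_const_bound[of _ c]) auto
  have "(\<lambda>c. expectation (\<lambda>x. \<bar>V x - W c x\<bar>)) \<longlonglongrightarrow> expectation (\<lambda>x. 0)"
  proof (rule integral_dominated_convergence)
    show "integrable M (\<lambda>x. \<bar>V x\<bar>)" using V by auto
    show "AE x in M. (\<lambda>c. \<bar>V x - W c x\<bar>) \<longlonglongrightarrow> 0"
    proof (rule AE_I2)
      fix x
      obtain c0 where c0: "\<bar>V x\<bar> \<le> real c0" using real_arch_simple by blast
      have "eventually (\<lambda>c. 0 = \<bar>V x - W c x\<bar>) sequentially"
        using c0 by (intro eventually_sequentiallyI[of c0]) (auto simp: W_def)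
      then show "(\<lambda>c. \<bar>V x - W c x\<bar>) \<longlonglongrightarrow> 0" by (rule Lim_transform_eventually[OF tendsto_const])
    qed
    show "AE x in M. norm \<bar>V x - W c x\<bar> \<le> \<bar>V x\<bar>" for c by (rule AE_I2) (auto simp: W_def)
  qed auto
  then have "eventually (\<lambda>c. expectation (\<lambda>x. \<bar>V x - W c x\<bar>) < e/4) sequentially"
    using e by (intro order_tendstoD) auto
  \<comment> \<open>The truncation error enters twice, under \<open>G n\<close> and under
    \<open>F\<close>, each time with at most \<open>e/4\<close>; the truncated variable gets
    \<open>e/2\<close>.\<close>
  then obtain c where c: "expectation (\<lambda>x. \<bar>V x - W c x\<bar>) < e/4" by (auto simp: eventually_sequentially)
  have "(\<lambda>n. expectation (\<lambda>x. \<bar>real_cond_exp M (G n) (W c) x - real_cond_exp M F (W c) x\<bar>)) \<longlonglongrightarrow> 0"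
    by (rule cond_exp_decreasing_bounded[OF G mono F W Wb])
  then have "eventually (\<lambda>n. expectation (\<lambda>x. \<bar>real_cond_exp M (G n) (W c) x - real_cond_exp M F (W c) x\<bar>) < e/2) sequentially"
    using e by (intro order_tendstoD) auto
  then obtain no where no: "expectation (\<lambda>x. \<bar>real_cond_exp M (G n) (W c) x - real_cond_exp M F (W c) x\<bar>) < e/2"
    if "n \<ge> no" for n by (auto simp: eventually_sequentially)
  have "expectation (\<lambda>x. \<bar>real_cond_exp M (G n) V x - real_cond_exp M F V x\<bar>) < e" if n: "n \<ge> no" for n
  proof -
    let ?a = "real_cond_exp M (G n) V" and ?b = "real_cond_exp M (G n) (W c)"
      and ?c = "real_cond_exp M F (W c)" and ?d = "real_cond_exp M F V"
    have i: "integrable M ?a" "integrable M ?b" "integrable M ?c" "integrable M ?d"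
      using cond_exp_integrable G MF V iW by auto
    have "expectation (\<lambda>x. \<bar>?a x - ?d x\<bar>) \<le> expectation (\<lambda>x. \<bar>?a x - ?b x\<bar> + \<bar>?b x - ?c x\<bar> + \<bar>?d x - ?c x\<bar>)"
      using i by (intro integral_mono) auto
    also have "\<dots> = expectation (\<lambda>x. \<bar>?a x - ?b x\<bar>) + expectation (\<lambda>x. \<bar>?b x - ?c x\<bar>) + expectation (\<lambda>x. \<bar>?d x - ?c x\<bar>)"
      using i by simp
    also have "\<dots> < e"
      using no[OF n] c cond_exp_L1_diff[OF G[of n] V iW[of c]] cond_exp_L1_diff[OF MF V iW[of c]] by simp
    finally show ?thesis .
  qed
  then show "\<exists>no. \<forall>n\<ge>no. norm (expectation (\<lambda>x. \<bar>real_cond_exp M (G n) V x - real_cond_exp M F V x\<bar>) - 0) < e"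
    by (intro exI[of _ no]) simp
qed

text \<open>Doob's argument: the event is split by the first index \<open>n\<close> at which the
  level \<open>e\<close> is reached. The piece \<open>B n\<close> belongs to \<open>G n\<close>, so
  over it the projection may be replaced by \<open>V\<close>.\<close>

lemma cond_exp_maximal:
  fixes G :: "nat \<Rightarrow> 'a measure"
  assumes G: "\<And>n. subalgebra M (G n)" and mono: "\<And>m n. m \<le> n \<Longrightarrow> subalgebra (G n) (G m)"
    and V: "integrable M V" and e: "e > 0"
  shows "prob {x\<in>space M. \<exists>n. e \<le> real_cond_exp M (G n) V x} \<le> expectation (\<lambda>x. \<bar>V x\<bar>) / e"
proof -
  define U where "U n = real_cond_exp M (G n) V" for n
  define B where "B n = {x\<in>space M. e \<le> U n x \<and> (\<forall>j<n. U j x < e)}" for n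
  have iU: "integrable M (U n)" for n unfolding U_def by (rule cond_exp_integrable[OF G V])
  have [measurable]: "V \<in> borel_measurable M" using V by auto
  have UG: "U j \<in> borel_measurable (G n)" if "j \<le> n" for j n
    by (rule measurable_from_subalg[OF mono[OF that]]) (simp add: U_def)
  have spG: "space (G n) = space M" for n using G by (auto simp: subalgebra_def)
  have BG: "B n \<in> sets (G n)" for n
  proof -
    have [measurable]: "U j \<in> borel_measurable (G n)" if "j \<in> {..n}" for j using UG that by auto
    have "B n = {x\<in>space (G n). e \<le> U n x} \<inter> (\<Inter>j\<in>{..n}. {x\<in>space (G n). j < n \<longrightarrow> U j x < e})"
      unfolding B_def spG by auto
    also have "\<dots> \<in> sets (G n)" using UG[of n n] by (intro sets.Int sets.finite_INT) (auto simp: UG)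
    finally show ?thesis .
  qed
  have BM[measurable]: "B n \<in> sets M" for n using BG G by (auto simp: subalgebra_def)
  have disj: "disjoint_family B"
  proof -
    have "B m \<inter> B n = {}" if "m < n" for m n
    proof -
      have False if "x \<in> B m" "x \<in> B n" for x
        using that \<open>m < n\<close> unfolding B_def by (auto dest: spec[of _ m])
      then show ?thesis by blast
    qed
    then show ?thesis unfolding disjoint_family_on_def by (metis Int_commute linorder_neqE_nat)
  qed
  have Un: "{x\<in>space M. \<exists>n. e \<le> U n x} = (\<Union>n. B n)"
  proof (intro equalityI subsetI)
    fix x assume "x \<in> {x\<in>space M. \<exists>n. e \<le> U n x}"
    then have x: "x \<in> space M" and ex: "\<exists>n. e \<le> U n x" by auto
    define n where "n = (LEAST n. e \<le> U n x)"
    have "e \<le> U n x" unfolding n_def using ex by (rule LeastI_ex)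
    moreover have "U j x < e" if "j < n" for j using not_less_Least[of j] that unfolding n_def by force
    ultimately show "x \<in> (\<Union>n. B n)" using x unfolding B_def by auto
  qed (auto simp: B_def)
  \<comment> \<open>Bounding the pieces by the measure with density \<open>\<bar>V\<bar>\<close>
    lets countable additivity sum the estimates over the disjoint \<open>B n\<close>.\<close>
  define D where "D = density M (\<lambda>x. ennreal \<bar>V x\<bar>)"
  have le: "ennreal e * emeasure M (B n) \<le> emeasure D (B n)" for n
  proof -
    have ind: "integrable M (\<lambda>x. indicator (B n) x * W x)" if "integrable M W" for W :: "'a \<Rightarrow> real"
      using that by (rule integrable_mult_bounded[of _ _ 1]) (auto simp: indicator_def)
    have i1: "integrable M (\<lambda>x. e * indicator (B n) x)"
      using ind[of "\<lambda>x. e"] by (simp add: mult.commute)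
    have "e * prob (B n) = (\<integral>x. e * indicator (B n) x \<partial>M)" by simp
    also have "\<dots> \<le> (\<integral>x\<in>B n. U n x \<partial>M)"
      unfolding set_lebesgue_integral_def real_scaleR_def
    proof (rule integral_mono[OF i1 ind[OF iU]])
      show "e * indicator (B n) x \<le> indicator (B n) x * U n x" for x
        by (cases "x \<in> B n") (auto simp: B_def)
    qed
    also have "\<dots> = (\<integral>x\<in>B n. V x \<partial>M)" unfolding U_def by (rule set_integral_cond_exp[OF G V BG])
    also have "\<dots> \<le> (\<integral>x. indicator (B n) x * \<bar>V x\<bar> \<partial>M)"
      unfolding set_lebesgue_integral_def real_scaleR_def
      by (rule integral_mono[OF ind[OF V] ind[OF integrable_abs[OF V]]]) (auto simp: indicator_def)
    finally have "ennreal (e * prob (B n)) \<le> ennreal (\<integral>x. indicator (B n) x * \<bar>V x\<bar> \<partial>M)" by (rule ennreal_leI)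
    also have "\<dots> = (\<integral>\<^sup>+x. ennreal (indicator (B n) x * \<bar>V x\<bar>) \<partial>M)"
      by (rule nn_integral_eq_integral[symmetric, OF ind[OF integrable_abs[OF V]]]) auto
    also have "\<dots> = emeasure D (B n)"
      unfolding D_def by (subst emeasure_density) (auto intro!: nn_integral_cong simp: indicator_def)
    finally show ?thesis using e by (simp add: emeasure_eq_measure ennreal_mult)
  qed
  have "ennreal e * emeasure M (\<Union>n. B n) = (\<Sum>n. ennreal e * emeasure M (B n))"
    using disj by (subst suminf_emeasure[symmetric]) (auto simp: ennreal_suminf_cmult)
  also have "\<dots> \<le> (\<Sum>n. emeasure D (B n))" by (intro suminf_le le) auto
  also have "\<dots> = emeasure D (\<Union>n. B n)" using disj by (intro suminf_emeasure) (auto simp: D_def)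
  also have "\<dots> \<le> emeasure D (space D)" by (rule emeasure_space)
  also have "\<dots> = (\<integral>\<^sup>+x. ennreal \<bar>V x\<bar> \<partial>M)"
    unfolding D_def space_density by (subst emeasure_density) (auto intro!: nn_integral_cong)
  also have "\<dots> = ennreal (expectation (\<lambda>x. \<bar>V x\<bar>))" using V by (intro nn_integral_eq_integral) auto
  finally have "ennreal (e * prob (\<Union>n. B n)) \<le> ennreal (expectation (\<lambda>x. \<bar>V x\<bar>))"
    using e by (simp add: emeasure_eq_measure ennreal_mult)
  then show ?thesis using e unfolding Un[unfolded U_def] by (simp add: field_simps)
qed

text \<open>Garsia's proof, applied to \<open>r - l\<close>: the integral of \<open>r - l\<close>
  over the set where some partial sum along the orbit is positive is nonnegative, which bounds
  \<open>l\<close> times the probability of that set by the mean of \<open>r\<close>.\<close>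

lemma maximal_ergodic:
  assumes T[measurable]: "T \<in> M \<rightarrow>\<^sub>M M" and MT: "distr M M T = M"
    and r: "integrable M r" "\<And>x. 0 \<le> r x" and l: "l > 0"
  shows "prob {x\<in>space M. \<exists>n>0. l * real n < (\<Sum>k<n. r ((T ^^ k) x))} \<le> expectation r / l"
proof -
  have [measurable]: "r \<in> borel_measurable M" using r by auto
  define f where "f x = r x - l" for x
  have if': "integrable M f" unfolding f_def using r by auto
  then have [measurable]: "f \<in> borel_measurable M" by auto
  \<comment> \<open>\<open>m n x\<close> is the largest of the sums of \<open>f\<close> over the
    first 0, ..., \<open>n\<close> points of the orbit of \<open>x\<close>. Peeling off the first
    point gives the recursion.\<close>
  define m where "m = rec_nat (\<lambda>x. 0) (\<lambda>n g x. max 0 (f x + g (T x)))"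
  have m0: "m 0 x = 0" and mS: "m (Suc n) x = max 0 (f x + m n (T x))" for n x by (auto simp: m_def)
  have inv: "integrable M (\<lambda>x. g (T x))" "expectation (\<lambda>x. g (T x)) = expectation g" if "integrable M g" for g :: "'a \<Rightarrow> real"
  proof -
    have [measurable]: "g \<in> borel_measurable M" using that by auto
    show "integrable M (\<lambda>x. g (T x))" using that by (subst (asm) MT[symmetric]) (simp add: integrable_distr_eq)
    show "expectation (\<lambda>x. g (T x)) = expectation g" by (subst (2) MT[symmetric]) (simp add: integral_distr)
  qed
  have im: "integrable M (m n)" for n
  proof (induction n)
    case (Suc n)
    have "m (Suc n) = (\<lambda>x. max 0 (f x + m n (T x)))" using mS by auto
    then show ?case using if' inv(1)[OF Suc] by auto
  qed (simp add: m_def)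
  then have [measurable]: "m n \<in> borel_measurable M" for n by auto
  have mpos: "0 \<le> m n x" for n x by (cases n) (auto simp: m0 mS)
  have mono: "m n x \<le> m (Suc n) x" for n x
  proof (induction n arbitrary: x)
    case (Suc n)
    show ?case using Suc[of "T x"] by (subst (1 2) mS) (simp add: max.coboundedI2)
  qed (simp add: m0 mS)
  have mono': "m n x \<le> m n' x" if "n \<le> n'" for n n' x
    using lift_Suc_mono_le[of "\<lambda>n. m n x", OF mono that] .
  have sum_le: "(\<Sum>k<n. r ((T ^^ k) x)) - l * real n \<le> m n x" for n x
  proof (induction n arbitrary: x)
    case (Suc n)
    have "(\<Sum>k<Suc n. r ((T ^^ k) x)) - l * real (Suc n) = f x + ((\<Sum>k<n. r ((T ^^ k) (T x))) - l * real n)"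
      unfolding sum.lessThan_Suc_shift f_def by (simp add: funpow_swap1 algebra_simps)
    also have "\<dots> \<le> m (Suc n) x" using Suc[of "T x"] by (simp add: mS)
    finally show ?case .
  qed (simp add: m0)
  have bound: "prob {x\<in>space M. 0 < m n x} \<le> expectation r / l" for n
  proof -
    define A where "A = {x\<in>space M. 0 < m n x}"
    have [measurable]: "A \<in> sets M" unfolding A_def by measurable
    \<comment> \<open>Garsia's inequality. Where \<open>m n\<close> is positive it equals
      \<open>f\<close> plus an earlier maximum at \<open>T x\<close>; elsewhere it is 0. By
      invariance of the measure the left side has mean 0.\<close>
    have "m n x - m n (T x) \<le> indicator A x * f x" if "x \<in> space M" for x
    proof (cases "x \<in> A")
      case True
      then obtain n' where n': "n = Suc n'" unfolding A_def by (cases n) (auto simp: m0)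
      have "m n x = f x + m n' (T x)" using True unfolding A_def n' by (auto simp: mS max_def split: if_splits)
      also have "\<dots> \<le> f x + m n (T x)" using mono[of n' "T x"] unfolding n' by simp
      finally show ?thesis using True by simp
    next
      case False
      then show ?thesis using that mpos[of n x] mpos[of n "T x"] by (simp add: A_def)
    qed
    moreover have iAf: "integrable M (\<lambda>x. indicator A x * f x)"
      using if' by (intro integrable_mult_bounded[of _ _ 1]) (auto simp: indicator_def)
    moreover have iAr: "integrable M (\<lambda>x. indicator A x * r x)"
      using r(1) by (rule integrable_mult_bounded[of _ _ 1]) (auto simp: indicator_def)
    ultimately have "expectation (\<lambda>x. m n x - m n (T x)) \<le> expectation (\<lambda>x. indicator A x * f x)"
      using im inv(1)[OF im] by (intro integral_mono) auto
    also have "expectation (\<lambda>x. m n x - m n (T x)) = 0" using im inv[OF im] by simp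
    also have "expectation (\<lambda>x. indicator A x * f x) = expectation (\<lambda>x. indicator A x * r x - l * indicator A x)"
      by (intro Bochner_Integration.integral_cong) (auto simp: f_def algebra_simps)
    also have "\<dots> = expectation (\<lambda>x. indicator A x * r x) - l * prob A"
    proof -
      have "integrable M (indicator A :: 'a \<Rightarrow> real)" by (rule integrable_const_bound[of _ 1]) auto
      then show ?thesis using iAr by (subst Bochner_Integration.integral_diff) auto
    qed
    also have "expectation (\<lambda>x. indicator A x * r x) \<le> expectation r"
      by (rule integral_mono[OF iAr r(1)]) (use r(2) in \<open>auto simp: indicator_def\<close>)
    finally show ?thesis using l unfolding A_def by (simp add: field_simps)
  qed
  have "incseq (\<lambda>n. {x\<in>space M. 0 < m n x})"
    by (rule incseq_SucI) (use mono in \<open>auto intro: less_le_trans\<close>)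
  then have "(\<lambda>n. prob {x\<in>space M. 0 < m n x}) \<longlonglongrightarrow> prob (\<Union>n. {x\<in>space M. 0 < m n x})"
    by (intro finite_Lim_measure_incseq) auto
  then have "prob (\<Union>n. {x\<in>space M. 0 < m n x}) \<le> expectation r / l"
    by (rule LIMSEQ_le_const2) (use bound in auto)
  moreover have "prob {x\<in>space M. \<exists>n>0. l * real n < (\<Sum>k<n. r ((T ^^ k) x))} \<le> prob (\<Union>n. {x\<in>space M. 0 < m n x})"
    using sum_le by (intro finite_measure_mono) (fastforce intro: less_le_trans[rotated])+
  ultimately show ?thesis by simp
qed

text \<open>Orthogonality bounds the second moment of the \<open>n\<close>-th partial sum by
  \<open>n * C\<^sup>2\<close>. Along the squares \<open>N = m\<^sup>2\<close> the averages then
  have summable second moments and converge almost surely; up to the next square the sum changes by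
  at most \<open>2 * m * C\<close>, which is negligible against \<open>m\<^sup>2\<close>.\<close>

lemma uncorrelated_average:
  fixes d :: "nat \<Rightarrow> 'a \<Rightarrow> real"
  assumes [measurable]: "\<And>k. d k \<in> borel_measurable M" and b: "\<And>k x. \<bar>d k x\<bar> \<le> C"
    and orth: "\<And>k l. k < l \<Longrightarrow> expectation (\<lambda>x. d k x * d l x) = 0"
  shows "AE x in M. (\<lambda>N. (\<Sum>k<N. d k x) / real N) \<longlonglongrightarrow> 0"
proof -
  define S where "S n x = (\<Sum>k<n. d k x)" for n x
  have [measurable]: "S n \<in> borel_measurable M" for n unfolding S_def by measurable
  have C: "0 \<le> C" using b[of 0 undefined] by simp
  have Sb: "\<bar>S n x\<bar> \<le> real n * C" for n x
    unfolding S_def using sum_bounded_above[of "{..<n}" "\<lambda>k. \<bar>d k x\<bar>" C] b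
    by (intro order_trans[OF sum_abs]) auto
  have iS: "integrable M (\<lambda>x. (S n x)\<^sup>2)" for n
    using Sb[of n] by (intro integrable_const_bound[of _ "(real n * C)\<^sup>2"]) (auto intro!: AE_I2 simp: abs_le_square_iff[symmetric] C)
  have i2: "integrable M (\<lambda>x. d k x * d l x)" for k l
    using b C by (intro integrable_const_bound[of _ "C*C"]) (auto intro!: AE_I2 mult_mono simp: abs_mult)
  have iSd: "integrable M (\<lambda>x. S n x * d n x)" for n
    unfolding S_def sum_distrib_right using i2 by (intro Bochner_Integration.integrable_sum) auto
  have ES: "expectation (\<lambda>x. (S n x)\<^sup>2) \<le> real n * C\<^sup>2" for n
  proof (induction n)
    case (Suc n)
    have "expectation (\<lambda>x. S n x * d n x) = (\<Sum>k<n. expectation (\<lambda>x. d k x * d n x))"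
      unfolding S_def sum_distrib_right using i2 by (intro Bochner_Integration.integral_sum) auto
    also have "\<dots> = 0" using orth by simp
    finally have z: "expectation (\<lambda>x. S n x * d n x) = 0" .
    have dd: "expectation (\<lambda>x. d n x * d n x) \<le> expectation (\<lambda>x. C\<^sup>2)"
    proof (rule integral_mono[OF i2])
      show "d n x * d n x \<le> C\<^sup>2" for x
        using b[of n x] C abs_le_square_iff[of "d n x" C] by (simp add: power2_eq_square)
    qed auto
    have "expectation (\<lambda>x. (S (Suc n) x)\<^sup>2) = expectation (\<lambda>x. (S n x)\<^sup>2 + 2 * (S n x * d n x) + d n x * d n x)"
      by (intro Bochner_Integration.integral_cong) (auto simp: S_def power2_eq_square algebra_simps)
    also have "\<dots> = expectation (\<lambda>x. (S n x)\<^sup>2) + expectation (\<lambda>x. d n x * d n x)"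
      using iS i2 iSd z by simp
    also have "\<dots> \<le> real (Suc n) * C\<^sup>2"
      using Suc dd by (simp add: prob_space algebra_simps)
    finally show ?case .
  qed (simp add: S_def)
  have sq: "expectation (\<lambda>x. (S (m\<^sup>2) x / real (m\<^sup>2))\<^sup>2) \<le> C\<^sup>2 * (1 / (real m)\<^sup>2)" for m
  proof (cases "m = 0")
    case False
    have "expectation (\<lambda>x. (S (m\<^sup>2) x / real (m\<^sup>2))\<^sup>2) = expectation (\<lambda>x. (S (m\<^sup>2) x)\<^sup>2) / (real (m\<^sup>2))\<^sup>2"
      by (simp add: power_divide)
    also have "\<dots> \<le> (real (m\<^sup>2) * C\<^sup>2) / (real (m\<^sup>2))\<^sup>2"
      by (intro divide_right_mono ES) simp
    also have "\<dots> = C\<^sup>2 * (1 / (real m)\<^sup>2)" using False by (simp add: power2_eq_square)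
    finally show ?thesis .
  qed simp
  have "(\<integral>\<^sup>+x. (\<Sum>m. ennreal ((S (m\<^sup>2) x / real (m\<^sup>2))\<^sup>2)) \<partial>M)
      = (\<Sum>m. \<integral>\<^sup>+x. ennreal ((S (m\<^sup>2) x / real (m\<^sup>2))\<^sup>2) \<partial>M)"
    by (rule nn_integral_suminf) measurable
  also have "\<dots> = (\<Sum>m. ennreal (expectation (\<lambda>x. (S (m\<^sup>2) x / real (m\<^sup>2))\<^sup>2)))"
    using iS by (subst nn_integral_eq_integral) (auto simp: power_divide)
  also have "\<dots> \<le> (\<Sum>m. ennreal (C\<^sup>2 * (1 / (real m)\<^sup>2)))"
    by (intro suminf_le ennreal_leI sq) auto
  also have "\<dots> = ennreal (\<Sum>m. C\<^sup>2 * (1 / (real m)\<^sup>2))"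
    using summable_mult[OF inverse_power_summable[of 2, where 'a=real], of "C\<^sup>2"]
    by (intro suminf_ennreal2) (auto simp: field_simps)
  also have "\<dots> < \<infinity>" by simp
  finally have fin: "(\<integral>\<^sup>+x. (\<Sum>m. ennreal ((S (m\<^sup>2) x / real (m\<^sup>2))\<^sup>2)) \<partial>M) \<noteq> \<infinity>" by simp
  have "AE x in M. (\<Sum>m. ennreal ((S (m\<^sup>2) x / real (m\<^sup>2))\<^sup>2)) \<noteq> \<infinity>"
    by (rule nn_integral_PInf_AE[OF _ fin]) measurable
  then show ?thesis
  proof eventually_elim
    case (elim x)
    then have "summable (\<lambda>m. (S (m\<^sup>2) x / real (m\<^sup>2))\<^sup>2)"
      by (intro summable_suminf_not_top) auto
    then have "(\<lambda>m. (S (m\<^sup>2) x / real (m\<^sup>2))\<^sup>2) \<longlonglongrightarrow> 0" by (rule summable_LIMSEQ_zero)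
    then have "(\<lambda>m. sqrt ((S (m\<^sup>2) x / real (m\<^sup>2))\<^sup>2)) \<longlonglongrightarrow> sqrt 0" by (intro tendsto_intros)
    then have lim1: "(\<lambda>m. \<bar>S (m\<^sup>2) x / real (m\<^sup>2)\<bar>) \<longlonglongrightarrow> 0" by simp
    have "(\<lambda>m. \<bar>S (m\<^sup>2) x / real (m\<^sup>2)\<bar> + 2 * C * inverse (real m)) \<longlonglongrightarrow> 0 + 2 * C * 0"
      by (intro tendsto_intros lim1 lim_inverse_n)
    moreover have fs: "filterlim floor_sqrt at_top sequentially"
      unfolding filterlim_at_top eventually_sequentially
    proof
      fix Z show "\<exists>N. \<forall>n\<ge>N. Z \<le> floor_sqrt n"
        using mono_floor_sqrt' floor_sqrt_inverse_power2 by (metis)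
    qed
    ultimately have lim: "(\<lambda>N. \<bar>S ((floor_sqrt N)\<^sup>2) x / real ((floor_sqrt N)\<^sup>2)\<bar> + 2 * C * inverse (real (floor_sqrt N))) \<longlonglongrightarrow> 0"
      using filterlim_compose by fastforce
    show "(\<lambda>N. (\<Sum>k<N. d k x) / real N) \<longlonglongrightarrow> 0"
    proof (rule Lim_null_comparison[OF _ lim], rule eventually_sequentiallyI[of 1])
      fix N :: nat assume N: "1 \<le> N"
      define m where "m = floor_sqrt N"
      have m: "m\<^sup>2 \<le> N" "N \<le> m\<^sup>2 + 2 * m" "1 \<le> m"
        using Suc_floor_sqrt_power2_gt[of N] N floor_sqrt_power2_le[of N] unfolding m_def
        by (auto simp: power2_eq_square) (use floor_sqrt_greater_zero_iff[of N] N in linarith)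
      have "S N x = S (m\<^sup>2) x + (\<Sum>k=m\<^sup>2..<N. d k x)"
        unfolding S_def lessThan_atLeast0 using m(1) by (subst sum.atLeastLessThan_concat) auto
      moreover have "\<bar>\<Sum>k=m\<^sup>2..<N. d k x\<bar> \<le> real (N - m\<^sup>2) * C"
        using sum_bounded_above[of "{m\<^sup>2..<N}" "\<lambda>k. \<bar>d k x\<bar>" C] b by (intro order_trans[OF sum_abs]) auto
      moreover have "real (N - m\<^sup>2) * C \<le> real (2 * m) * C" using m(2) C by (intro mult_right_mono) auto
      ultimately have "\<bar>S N x\<bar> \<le> \<bar>S (m\<^sup>2) x\<bar> + 2 * real m * C" by simp
      then have "\<bar>S N x\<bar> / real N \<le> (\<bar>S (m\<^sup>2) x\<bar> + 2 * real m * C) / real (m\<^sup>2)"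
        using m C by (intro frac_le) (auto simp del: of_nat_power)
      also have "\<dots> = \<bar>S (m\<^sup>2) x / real (m\<^sup>2)\<bar> + 2 * C * inverse (real m)"
        using m(3) by (simp add: field_simps power2_eq_square)
      finally show "norm ((\<Sum>k<N. d k x) / real N) \<le> \<bar>S ((floor_sqrt N)\<^sup>2) x / real ((floor_sqrt N)\<^sup>2)\<bar>
          + 2 * C * inverse (real (floor_sqrt N))"
        unfolding m_def S_def by simp
    qed
  qed
qed

text \<open>If \<open>\<bar>D N\<bar>\<close> exceeds a fixed level infinitely often, then for each
  \<open>n\<close> some average of \<open>R n\<close> is large, up to a null set. The maximal
  ergodic inequality bounds the probability of the latter by a multiple of the mean of
  \<open>R n\<close>. The former event does not involve \<open>n\<close>, so its probability is
  0.\<close>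

lemma tendsto_zero_by_ergodic_averages:
  fixes R :: "nat \<Rightarrow> 'a \<Rightarrow> real" and D :: "nat \<Rightarrow> 'a \<Rightarrow> real"
  assumes T: "T \<in> M \<rightarrow>\<^sub>M M" "distr M M T = M"
    and R: "\<And>n. integrable M (R n)" "\<And>n x. 0 \<le> R n x" "(\<lambda>n. expectation (R n)) \<longlonglongrightarrow> 0"
    and D[measurable]: "\<And>N. D N \<in> borel_measurable M" and c: "c > 0"
    and bound: "\<And>n. AE x in M. \<exists>e. e \<longlonglongrightarrow> 0 \<and> (\<forall>N. \<bar>D N x\<bar> \<le> e N + c * ((\<Sum>k<N. R n ((T ^^ k) x)) / real N))"
  shows "AE x in M. (\<lambda>N. D N x) \<longlonglongrightarrow> 0"
proof -
  have "AE x in M. \<not> (\<exists>\<^sub>F N in sequentially. 1 / real (Suc j) < \<bar>D N x\<bar>)" for j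
  proof -
    define \<epsilon> where "\<epsilon> = 1 / real (Suc j)"
    have \<epsilon>: "\<epsilon> > 0" by (simp add: \<epsilon>_def)
    define B where "B = {x\<in>space M. \<exists>\<^sub>F N in sequentially. \<epsilon> < \<bar>D N x\<bar>}"
    have B[measurable]: "B \<in> sets M" unfolding B_def frequently_sequentially by measurable
    have [measurable]: "R n \<in> borel_measurable M" for n using R(1) by auto
    have [measurable]: "T ^^ k \<in> M \<rightarrow>\<^sub>M M" for k using T(1) by (rule measurable_compose_n)
    \<comment> \<open>Half of \<open>\<epsilon>\<close> is reserved for the vanishing error
      \<open>e N\<close>, so the average of \<open>R n\<close> has to exceed
      \<open>\<epsilon> / (2 * c)\<close>.\<close>
    define l where "l = \<epsilon> / (2 * c)"
    have l: "l > 0" using \<epsilon> c by (simp add: l_def)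
    have "prob B \<le> expectation (R n) / l" for n
    proof -
      have "AE x in M. x \<in> B \<longrightarrow> x \<in> {x\<in>space M. \<exists>N>0. l * real N < (\<Sum>k<N. R n ((T ^^ k) x))}"
        using bound[of n]
      proof eventually_elim
        case (elim x)
        then obtain e where e: "e \<longlonglongrightarrow> 0" and le: "\<And>N. \<bar>D N x\<bar> \<le> e N + c * ((\<Sum>k<N. R n ((T ^^ k) x)) / real N)" by blast
        show ?case
        proof
          assume x: "x \<in> B"
          have "\<forall>\<^sub>F N in sequentially. e N < \<epsilon> / 2" using e \<epsilon> by (intro order_tendstoD) auto
          then have "\<forall>\<^sub>F N in sequentially. e N < \<epsilon> / 2 \<and> N > 0" using eventually_gt_at_top by (rule eventually_conj)
          moreover have "\<exists>\<^sub>F N in sequentially. \<epsilon> < \<bar>D N x\<bar>" using x by (simp add: B_def)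
          ultimately have "\<exists>\<^sub>F N in sequentially. \<epsilon> < \<bar>D N x\<bar> \<and> (e N < \<epsilon> / 2 \<and> N > 0)"
            by (rule frequently_eventually_frequently[rotated])
          then obtain N where N: "\<epsilon> < \<bar>D N x\<bar>" "e N < \<epsilon> / 2" "N > 0" by (auto dest: frequently_ex)
          then have "\<epsilon> / 2 < c * ((\<Sum>k<N. R n ((T ^^ k) x)) / real N)" using le[of N] by linarith
          then have "l * real N < (\<Sum>k<N. R n ((T ^^ k) x))" using c N(3) by (simp add: l_def field_simps)
          then show "x \<in> {x\<in>space M. \<exists>N>0. l * real N < (\<Sum>k<N. R n ((T ^^ k) x))}"
            using x N(3) by (auto simp: B_def)
        qed
      qed
      then have "prob B \<le> prob {x\<in>space M. \<exists>N>0. l * real N < (\<Sum>k<N. R n ((T ^^ k) x))}"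
        by (rule finite_measure_mono_AE) measurable
      also have "\<dots> \<le> expectation (R n) / l" by (rule maximal_ergodic[OF T R(1,2) l])
      finally show ?thesis .
    qed
    moreover have "(\<lambda>n. expectation (R n) / l) \<longlonglongrightarrow> 0 / l" by (intro tendsto_intros R) (use l in auto)
    ultimately have "prob B \<le> 0" by (intro LIMSEQ_le_const[of "\<lambda>n. expectation (R n) / l"]) auto
    then have "AE x in M. x \<notin> B" by (intro AE_not_in) (simp add: null_sets_def emeasure_eq_measure measure_le_0_iff)
    then show ?thesis using AE_space by eventually_elim (simp add: B_def \<epsilon>_def)
  qed
  then have "AE x in M. \<forall>j. \<not> (\<exists>\<^sub>F N in sequentially. 1 / real (Suc j) < \<bar>D N x\<bar>)" by (simp add: AE_all_countable)
  then show ?thesis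
  proof eventually_elim
    case (elim x)
    show ?case
    proof (rule tendstoI)
      fix e :: real assume "e > 0"
      then obtain j where j: "1 / real (Suc j) < e" using reals_Archimedean[of e] by (auto simp: inverse_eq_divide)
      have "\<forall>\<^sub>F N in sequentially. \<bar>D N x\<bar> \<le> 1 / real (Suc j)" using elim by (simp add: not_frequently not_less)
      then show "\<forall>\<^sub>F N in sequentially. dist (D N x) 0 < e" by eventually_elim (use j in simp)
    qed
  qed
qed

lemma uncorrelated_average_AE:
  fixes d :: "nat \<Rightarrow> 'a \<Rightarrow> real"
  assumes [measurable]: "\<And>k. d k \<in> borel_measurable M" and b: "\<And>k. AE x in M. \<bar>d k x\<bar> \<le> C"
    and orth: "\<And>k l. k < l \<Longrightarrow> expectation (\<lambda>x. d k x * d l x) = 0"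
  shows "AE x in M. (\<lambda>N. (\<Sum>k<N. d k x) / real N) \<longlonglongrightarrow> 0"
proof -
  define d' where "d' k x = max (- \<bar>C\<bar>) (min \<bar>C\<bar> (d k x))" for k x
  have [measurable]: "d' k \<in> borel_measurable M" for k unfolding d'_def by measurable
  have eq: "AE x in M. d' k x = d k x" for k using b[of k] by eventually_elim (auto simp: d'_def)
  have "AE x in M. (\<lambda>N. (\<Sum>k<N. d' k x) / real N) \<longlonglongrightarrow> 0"
  proof (rule uncorrelated_average)
    show "\<bar>d' k x\<bar> \<le> \<bar>C\<bar>" for k x by (auto simp: d'_def)
    fix k l :: nat assume "k < l"
    have "expectation (\<lambda>x. d' k x * d' l x) = expectation (\<lambda>x. d k x * d l x)"
      by (rule integral_cong_AE, measurable, use eq[of k] eq[of l] in eventually_elim) simp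
    then show "expectation (\<lambda>x. d' k x * d' l x) = 0" using orth[OF \<open>k < l\<close>] by simp
  qed simp
  moreover have "AE x in M. \<forall>k. d' k x = d k x" using eq by (simp add: AE_all_countable)
  ultimately show ?thesis by eventually_elim simp
qed

text \<open>One majorant \<open>R n\<close> for the errors at all indices \<open>k \<ge> n\<close>
  at once: the error at \<open>n\<close> plus the largest later fluctuation. Since the projection of
  \<open>L - U n\<close> onto \<open>G (n + m)\<close> is \<open>U (n + m) - U n\<close>, Doob's
  inequality for \<open>L - U n\<close> controls that fluctuation.\<close>

lemma cond_exp_uniform_bound:
  fixes G :: "nat \<Rightarrow> 'a measure"
  assumes G: "\<And>n. subalgebra M (G n)" and mono: "\<And>m n. m \<le> n \<Longrightarrow> subalgebra (G n) (G m)"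
    and F: "space F = space M" "sets F = sigma_sets (space M) (\<Union>n. sets (G n))"
    and V: "V \<in> borel_measurable M" "\<And>x. \<bar>V x\<bar> \<le> C"
  obtains R where "\<And>n. integrable M (R n)" "\<And>n x. 0 \<le> R n x" "(\<lambda>n. expectation (R n)) \<longlonglongrightarrow> 0"
    "\<And>n. AE x in M. \<forall>k\<ge>n. \<bar>real_cond_exp M F V x - real_cond_exp M (G k) V x\<bar> \<le> R n x"
proof -
  define U where "U n = real_cond_exp M (G n) V" for n
  define L where "L = real_cond_exp M F V"
  have C: "0 \<le> C" using V(2)[of undefined] by simp
  have iV: "integrable M V" using V by (intro integrable_const_bound[of _ C]) auto
  have MF: "subalgebra M F"
  proof -
    have "(\<Union>n. sets (G n)) \<subseteq> sets M" using G unfolding subalgebra_def by auto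
    from sets.sigma_sets_subset[OF this] show ?thesis using F unfolding subalgebra_def by simp
  qed
  have FG: "subalgebra F (G n)" for n
    using G[of n] F unfolding subalgebra_def by (auto intro: sigma_sets.Basic)
  have iL: "integrable M L" unfolding L_def by (rule cond_exp_integrable[OF MF iV])
  have iU: "integrable M (U n)" for n unfolding U_def by (rule cond_exp_integrable[OF G iV])
  have [measurable]: "L \<in> borel_measurable M" "U n \<in> borel_measurable M" for n using iL iU by auto
  have bU: "AE x in M. \<bar>U n x\<bar> \<le> C" for n unfolding U_def by (rule cond_exp_bounded[OF G V])
  define a where "a n = expectation (\<lambda>x. \<bar>L x - U n x\<bar>)" for n
  have a0: "0 \<le> a n" for n unfolding a_def by simp
  have a: "a \<longlonglongrightarrow> 0"
    using cond_exp_increasing_bounded[OF G mono F V] unfolding a_def U_def L_def by (simp add: abs_minus_commute)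
  \<comment> \<open>The cut at \<open>2 * C\<close> keeps the supremum bounded everywhere. Almost
    surely it changes nothing, because there \<open>\<bar>U n\<bar> \<le> C\<close> for all
    \<open>n\<close>.\<close>
  define S where "S n x = (SUP m. min (2 * C) \<bar>U (n + m) x - U n x\<bar>)" for n x
  have bdd: "bdd_above (range (\<lambda>m. min (2 * C) \<bar>U (n + m) x - U n x\<bar>))" for n x by (rule bdd_aboveI[of _ "2 * C"]) auto
  have [measurable]: "S n \<in> borel_measurable M" for n
    unfolding S_def[abs_def] by (rule borel_measurable_cSUP) (use bdd in auto)
  have S_ge: "min (2 * C) \<bar>U (n + m) x - U n x\<bar> \<le> S n x" for n m x unfolding S_def by (rule cSUP_upper[OF _ bdd]) simp
  have S0: "0 \<le> S n x" for n x using S_ge[of n 0 x] C by simp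
  have SC: "S n x \<le> 2 * C" for n x unfolding S_def by (rule cSUP_least) auto
  have iS: "integrable M (S n)" for n using S0 SC by (intro integrable_const_bound[of _ "2 * C"]) (auto intro!: AE_I2 simp: abs_of_nonneg)
  have maximal: "prob {x\<in>space M. e < S n x} \<le> 2 * a n / e" if e: "e > 0" for n e
  proof -
    define W where "W x = L x - U n x" for x
    have iW: "integrable M W" "integrable M (\<lambda>x. - W x)" unfolding W_def using iL iU by auto
    \<comment> \<open>The sign \<open>s\<close> will be 1 and -1, so that the one-sided maximal
      inequality yields both tails.\<close>
    define E where "E s m = real_cond_exp M (G (n + m)) (\<lambda>x. s * W x)" for s :: real and m
    have Em: "AE x in M. E s m x = s * (U (n + m) x - U n x)" for s m
    proof -
      interpret finite_measure_subalgebra M "G (n + m)" by (rule finite_measure_subalgebraI[OF G])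
      have 1: "AE x in M. real_cond_exp M (G (n + m)) L x = U (n + m) x"
        unfolding L_def U_def by (rule real_cond_exp_nested_subalg[OF MF FG iV])
      have "U n \<in> borel_measurable (G (n + m))"
        by (rule measurable_from_subalg[OF mono[of n "n + m"]]) (simp_all add: U_def)
      then have 2: "AE x in M. real_cond_exp M (G (n + m)) (U n) x = U n x" by (rule real_cond_exp_F_meas[OF iU])
      have 3: "AE x in M. real_cond_exp M (G (n + m)) W x = real_cond_exp M (G (n + m)) L x - real_cond_exp M (G (n + m)) (U n) x"
        unfolding W_def by (rule real_cond_exp_diff[OF iL iU])
      have 4: "AE x in M. E s m x = s * real_cond_exp M (G (n + m)) W x"
        unfolding E_def by (rule real_cond_exp_cmult[OF iW(1)])
      from 1 2 3 4 show ?thesis by eventually_elim simp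
    qed
    have mx: "prob {x\<in>space M. \<exists>m. e \<le> E s m x} \<le> a n / e" if "\<bar>s\<bar> = 1" for s
    proof -
      have "prob {x\<in>space M. \<exists>m. e \<le> E s m x} \<le> expectation (\<lambda>x. \<bar>s * W x\<bar>) / e"
        unfolding E_def using iW(1) by (intro cond_exp_maximal[OF G mono _ e]) auto
      then show ?thesis using that by (simp add: abs_mult a_def W_def)
    qed
    have [measurable]: "E s m \<in> borel_measurable M" for s m unfolding E_def by simp
    have "AE x in M. \<forall>m. E 1 m x = U (n + m) x - U n x \<and> E (-1) m x = -(U (n + m) x - U n x)"
      using Em[of 1] Em[of "-1"] by (simp add: AE_all_countable)
    then have "AE x in M. x \<in> {x\<in>space M. e < S n x} \<longrightarrow> x \<in> {x\<in>space M. \<exists>m. e \<le> E 1 m x} \<union> {x\<in>space M. \<exists>m. e \<le> E (-1) m x}"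
    proof eventually_elim
      case (elim x)
      show ?case
      proof
        assume x: "x \<in> {x\<in>space M. e < S n x}"
        then obtain m where "e < min (2 * C) \<bar>U (n + m) x - U n x\<bar>"
          unfolding S_def using less_cSUP_iff[OF _ bdd] by auto
        then have "e \<le> E 1 m x \<or> e \<le> E (-1) m x" using elim by (auto simp: abs_if split: if_splits)
        with x show "x \<in> {x\<in>space M. \<exists>m. e \<le> E 1 m x} \<union> {x\<in>space M. \<exists>m. e \<le> E (-1) m x}" by auto
      qed
    qed
    then have "prob {x\<in>space M. e < S n x} \<le> prob ({x\<in>space M. \<exists>m. e \<le> E 1 m x} \<union> {x\<in>space M. \<exists>m. e \<le> E (-1) m x})"
      by (rule finite_measure_mono_AE) measurable
    also have "\<dots> \<le> prob {x\<in>space M. \<exists>m. e \<le> E 1 m x} + prob {x\<in>space M. \<exists>m. e \<le> E (-1) m x}"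
      by (rule measure_Un_le) measurable
    also have "\<dots> \<le> 2 * a n / e" using mx[of 1] mx[of "-1"] by simp
    finally show ?thesis .
  qed
  \<comment> \<open>Up to the level \<open>e\<close> the variable contributes at most
    \<open>e\<close>; above it, \<open>2 * C\<close> on an event of probability at most
    \<open>2 * a n / e\<close>. For fixed \<open>e\<close> the second part vanishes as
    \<open>n\<close> grows.\<close>
  have ES: "expectation (S n) \<le> e + 2 * C * (2 * a n / e)" if e: "e > 0" for n e
  proof -
    let ?B = "{x\<in>space M. e < S n x}"
    have ind: "integrable M (indicator ?B :: 'a \<Rightarrow> real)" by (intro integrable_const_bound[of _ 1]) auto
    then have iB: "integrable M (\<lambda>x. e + 2 * C * indicator ?B x)" by simp
    have "expectation (S n) \<le> expectation (\<lambda>x. e + 2 * C * indicator ?B x)"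
    proof (rule integral_mono[OF iS iB])
      fix x assume "x \<in> space M"
      then show "S n x \<le> e + 2 * C * indicator ?B x"
        using SC[of n x] e by (cases "e < S n x") auto
    qed
    also have "\<dots> = e + 2 * C * prob ?B"
      using ind by (subst Bochner_Integration.integral_add) (auto simp: prob_space)
    also have "\<dots> \<le> e + 2 * C * (2 * a n / e)" using maximal[OF e] C by (intro add_left_mono mult_left_mono) auto
    finally show ?thesis .
  qed
  have limS: "(\<lambda>n. expectation (S n)) \<longlonglongrightarrow> 0"
  proof (rule LIMSEQ_I)
    fix e :: real assume e: "e > 0"
    have "(\<lambda>n. e/2 + 2 * C * (2 * a n / (e/2))) \<longlonglongrightarrow> e/2 + 2 * C * (2 * 0 / (e/2))"
      by (intro tendsto_intros a) (use e in auto)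
    then have "\<forall>\<^sub>F n in sequentially. e/2 + 2 * C * (2 * a n / (e/2)) < e" by (rule order_tendstoD(2)) (use e in simp)
    then obtain no where no: "\<And>n. n \<ge> no \<Longrightarrow> e/2 + 2 * C * (2 * a n / (e/2)) < e" by (auto simp: eventually_sequentially)
    have "norm (expectation (S n) - 0) < e" if "n \<ge> no" for n
      using no[OF that] ES[of "e/2" n] e integral_nonneg_AE[of "S n" M] S0 by simp
    then show "\<exists>no. \<forall>n\<ge>no. norm (expectation (S n) - 0) < e" by blast
  qed
  define R where "R n x = \<bar>L x - U n x\<bar> + S n x" for n x
  show thesis
  proof
    show "integrable M (R n)" for n unfolding R_def using iL iU iS by auto
    show "0 \<le> R n x" for n x unfolding R_def using S0 by simp
    have "expectation (R n) = a n + expectation (S n)" for n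
      unfolding R_def a_def using iL iU iS by (intro Bochner_Integration.integral_add) auto
    then show "(\<lambda>n. expectation (R n)) \<longlonglongrightarrow> 0" using tendsto_add[OF a limS] by simp
    fix n
    have "AE x in M. \<forall>k. \<bar>U k x\<bar> \<le> C" using bU by (simp add: AE_all_countable)
    then show "AE x in M. \<forall>k\<ge>n. \<bar>real_cond_exp M F V x - real_cond_exp M (G k) V x\<bar> \<le> R n x"
    proof eventually_elim
      case (elim x)
      show ?case
      proof (intro allI impI)
        fix k assume "n \<le> k"
        then obtain m where m: "k = n + m" using le_Suc_ex by blast
        have "\<bar>U (n + m) x - U n x\<bar> \<le> 2 * C" using elim[rule_format, of "n + m"] elim[rule_format, of n] by linarith
        then have "\<bar>U k x - U n x\<bar> \<le> S n x" using S_ge[of n m x] unfolding m by simp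
        then show "\<bar>real_cond_exp M F V x - real_cond_exp M (G k) V x\<bar> \<le> R n x"
          unfolding R_def L_def[symmetric] U_def[symmetric] by linarith
      qed
    qed
  qed
qed

end

section \<open>Regular conditional distributions on Polish spaces\<close>

text \<open>Compactness supplies countable additivity. If the content stayed above
  \<open>\<epsilon>\<close> along a decreasing sequence with empty intersection, compact subsets
  losing less than \<open>\<epsilon>\<close> in total would have nonempty finite intersections and
  hence a common point. The measure is built from \<open>\<A>\<close>; the larger
  \<open>\<B>\<close> holds the compact sets, on which the content must be additive as well.\<close>

lemma content_extends_to_prob:
  fixes q :: "'e::polish_space set \<Rightarrow> real"
  assumes A: "algebra UNIV \<A>" and B: "algebra UNIV \<B>" and AB: "\<A> \<subseteq> \<B>"
    and pos: "\<And>a. a \<in> \<B> \<Longrightarrow> 0 \<le> q a" and UN: "q UNIV = 1"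
    and add: "\<And>a b. a \<in> \<B> \<Longrightarrow> b \<in> \<B> \<Longrightarrow> a \<inter> b = {} \<Longrightarrow> q (a \<union> b) = q a + q b"
    and inner: "\<And>a \<epsilon>. a \<in> \<A> \<Longrightarrow> \<epsilon> > 0 \<Longrightarrow> \<exists>c\<in>\<B>. compact c \<and> c \<subseteq> a \<and> q (a - c) < \<epsilon>"
    and gen: "sigma_sets UNIV \<A> = sets borel"
  shows "\<exists>\<mu>. \<mu> \<in> space (prob_algebra borel) \<and> (\<forall>a\<in>\<A>. emeasure \<mu> a = ennreal (q a))"
proof -
  interpret A: algebra UNIV \<A> by fact
  interpret B: algebra UNIV \<B> by fact
  have empty: "q {} = 0" using add[of "{}" "{}"] by simp
  have mono: "q a \<le> q b" if "a \<in> \<B>" "b \<in> \<B>" "a \<subseteq> b" for a b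
  proof -
    have d: "b - a \<in> \<B>" using that by (intro B.Diff)
    have "a \<union> (b - a) = b" using that by auto
    then have "q b = q a + q (b - a)" using add[OF that(1) d] by simp
    then show ?thesis using pos[OF d] by simp
  qed
  have subadd: "q (a \<union> b) \<le> q a + q b" if "a \<in> \<B>" "b \<in> \<B>" for a b
  proof -
    have d: "b - a \<in> \<B>" using that by (intro B.Diff)
    have "q (a \<union> b) = q a + q (b - a)" using add[OF that(1) d] by (simp add: Un_Diff_cancel)
    also have "q (b - a) \<le> q b" using that d by (intro mono) auto
    finally show ?thesis by simp
  qed
  have cont: "(\<lambda>i. ennreal (q (a i))) \<longlonglongrightarrow> 0" if a: "range a \<subseteq> \<A>" "decseq a" "(\<Inter>i. a i) = {}" for a :: "nat \<Rightarrow> 'e set"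
  proof -
    have aA: "a i \<in> \<A>" and aB: "a i \<in> \<B>" for i using a AB by auto
    have anti: "q (a j) \<le> q (a i)" if "i \<le> j" for i j
      using a(2) that by (intro mono aB) (auto simp: decseq_def)
    have "\<exists>i. q (a i) < \<epsilon>" if \<epsilon>: "\<epsilon> > 0" for \<epsilon>
    proof (rule ccontr)
      assume "\<not> (\<exists>i. q (a i) < \<epsilon>)"
      then have ge: "\<epsilon> \<le> q (a i)" for i by (meson not_less)
      \<comment> \<open>The losses \<open>\<epsilon> / 2^(i+1)\<close> add up to strictly less than
        \<open>\<epsilon>\<close> over any finite range, so no finite intersection
        \<open>k n\<close> can be empty.\<close>
      have "\<forall>i. \<exists>c\<in>\<B>. compact c \<and> c \<subseteq> a i \<and> q (a i - c) < \<epsilon> * (1/2)^Suc i"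
        using \<epsilon> by (intro allI inner aA) simp
      then obtain c where c: "\<And>i. c i \<in> \<B>" "\<And>i. compact (c i)" "\<And>i. c i \<subseteq> a i"
        "\<And>i. q (a i - c i) < \<epsilon> * (1/2)^Suc i" by metis
      define k where "k n = (\<Inter>i\<le>n. c i)" for n
      have kB: "k n \<in> \<B>" for n unfolding k_def using c(1) by (intro B.finite_INT) auto
      have comp: "compact (k n)" for n
        by (induction n) (auto simp: k_def atMost_Suc intro: compact_Int c(2))
      have le: "q (a n - k n) \<le> (\<Sum>i\<le>n. q (a i - c i))" for n
      proof (induction n)
        case (Suc n)
        have "a (Suc n) - k (Suc n) \<subseteq> (a n - k n) \<union> (a (Suc n) - c (Suc n))"
          using decseqD[OF a(2), of n "Suc n"] unfolding k_def by (auto simp: atMost_Suc)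
        then have "q (a (Suc n) - k (Suc n)) \<le> q ((a n - k n) \<union> (a (Suc n) - c (Suc n)))"
          using aB kB c(1) by (intro mono B.Un B.Diff) auto
        also have "\<dots> \<le> q (a n - k n) + q (a (Suc n) - c (Suc n))"
          using aB kB c(1) by (intro subadd B.Diff) auto
        finally show ?case using Suc by simp
      qed (simp add: k_def)
      have ne: "k n \<noteq> {}" for n
      proof
        assume "k n = {}"
        then have "\<epsilon> \<le> (\<Sum>i\<le>n. q (a i - c i))" using le[of n] ge[of n] by simp
        also have "\<dots> \<le> (\<Sum>i\<le>n. \<epsilon> * (1/2)^Suc i)" using c(4) by (intro sum_mono) (simp add: less_imp_le)
        also have "\<dots> = \<epsilon> * (1 - (1/2)^Suc n)"
          by (induction n) (simp_all add: field_simps)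
        finally have "\<epsilon> \<le> \<epsilon> - \<epsilon> * (1/2)^Suc n" by (simp only: right_diff_distrib mult_1_right)
        moreover have "0 < \<epsilon> * (1/2)^Suc n" using \<epsilon> by simp
        ultimately show False by linarith
      qed
      have "k 0 \<inter> (\<Inter>n\<in>UNIV. k n) \<noteq> {}"
      proof (rule compact_imp_fip_image[OF comp])
        fix I :: "nat set" assume I: "finite I"
        have "k (Max (insert 0 I)) \<subseteq> k i" if "i \<in> insert 0 I" for i
          using Max_ge[of "insert 0 I" i] I that unfolding k_def by (intro INF_superset_mono) auto
        then have "k (Max (insert 0 I)) \<subseteq> k 0 \<inter> (\<Inter>n\<in>I. k n)" by blast
        then show "k 0 \<inter> (\<Inter>n\<in>I. k n) \<noteq> {}" using ne[of "Max (insert 0 I)"] by blast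
      qed (auto intro: compact_imp_closed comp)
      then have "(\<Inter>n. k n) \<noteq> {}" by blast
      moreover have "(\<Inter>n. k n) \<subseteq> (\<Inter>i. a i)" using c(3) unfolding k_def by auto
      ultimately show False using a(3) by simp
    qed
    then have "(\<lambda>i. q (a i)) \<longlonglongrightarrow> 0"
      using anti pos[OF aB] by (intro LIMSEQ_I) (metis (no_types, opaque_lifting) abs_of_nonneg diff_zero le_less_trans real_norm_def)
    then show ?thesis using tendsto_ennrealI[of _ 0] by simp
  qed
  obtain \<mu> where mu: "\<And>s. s \<in> \<A> \<Longrightarrow> \<mu> s = ennreal (q s)" "measure_space UNIV (sigma_sets UNIV \<A>) \<mu>"
  proof -
    have "\<exists>\<mu>. (\<forall>s\<in>\<A>. \<mu> s = ennreal (q s)) \<and> measure_space UNIV (sigma_sets UNIV \<A>) \<mu>"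
    proof (rule A.caratheodory_empty_continuous)
      show "positive \<A> (\<lambda>s. ennreal (q s))" by (simp add: positive_def empty)
      show "additive \<A> (\<lambda>s. ennreal (q s))"
        unfolding additive_def using add AB pos by (auto simp: ennreal_plus subset_iff)
    qed (use cont in auto)
    then show ?thesis using that by auto
  qed
  define m where "m = measure_of UNIV \<A> \<mu>"
  have sm: "sets m = sets borel" "space m = UNIV"
    unfolding m_def using gen A.space_closed by (auto simp: sets_measure_of space_measure_of_conv)
  have em: "emeasure m a = ennreal (q a)" if "a \<in> \<A>" for a
  proof -
    have "emeasure m a = \<mu> a"
      by (rule emeasure_measure_of[OF m_def])
        (use mu(2) that sm gen[symmetric] in \<open>auto simp: measure_space_def\<close>)
    then show ?thesis using mu(1)[OF that] by simp
  qed
  have "prob_space m"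
    by (rule prob_spaceI) (use em[OF A.top] sm UN in simp)
  then show ?thesis using em sm by (intro exI[of _ m]) (simp add: space_prob_algebra)
qed

text \<open>Building the algebra in stages, each adding single complements and binary unions of the
  previous one, keeps every stage countable.\<close>

fun algebra_hull_step :: "'a set set \<Rightarrow> nat \<Rightarrow> 'a set set" where
  "algebra_hull_step S 0 = insert {} S"
| "algebra_hull_step S (Suc n) = algebra_hull_step S n \<union> uminus ` algebra_hull_step S n
    \<union> (\<lambda>(a, b). a \<union> b) ` (algebra_hull_step S n \<times> algebra_hull_step S n)"

lemma countable_algebra_hull:
  assumes S: "countable S" "S \<subseteq> sets M" and M: "space M = UNIV"
  obtains \<A> where "countable \<A>" "S \<subseteq> \<A>" "\<A> \<subseteq> sets M" "algebra UNIV \<A>"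
proof
  define \<A> where "\<A> = (\<Union>n. algebra_hull_step S n)"
  have "countable (algebra_hull_step S n)" for n by (induction n) (use S in auto)
  then show "countable (\<Union>n. algebra_hull_step S n)" by simp
  have "S \<subseteq> algebra_hull_step S 0" by auto
  then show "S \<subseteq> (\<Union>n. algebra_hull_step S n)" by blast
  have "algebra_hull_step S n \<subseteq> sets M" for n
  proof (induction n)
    case (Suc n)
    have "- a \<in> sets M" if "a \<in> sets M" for a using sets.compl_sets[OF that] M by (simp add: Compl_eq_Diff_UNIV)
    then show ?case using Suc by (auto simp: subset_iff)
  qed (use S in auto)
  then show "(\<Union>n. algebra_hull_step S n) \<subseteq> sets M" by blast
  have mono: "algebra_hull_step S m \<subseteq> algebra_hull_step S n" if "m \<le> n" for m n
    using lift_Suc_mono_le[of "algebra_hull_step S", OF _ that] by auto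
  show "algebra UNIV (\<Union>n. algebra_hull_step S n)"
    unfolding algebra_iff_Un
  proof (intro conjI ballI)
    show "{} \<in> (\<Union>n. algebra_hull_step S n)" by (rule UN_I[of 0]) auto
    fix a assume "a \<in> (\<Union>n. algebra_hull_step S n)"
    then obtain i where i: "a \<in> algebra_hull_step S i" by auto
    then have "UNIV - a \<in> algebra_hull_step S (Suc i)" by (auto simp: Compl_eq_Diff_UNIV[symmetric])
    then show "UNIV - a \<in> (\<Union>n. algebra_hull_step S n)" by blast
    fix b assume "b \<in> (\<Union>n. algebra_hull_step S n)"
    then obtain j where j: "b \<in> algebra_hull_step S j" by auto
    have "a \<in> algebra_hull_step S (max i j)" "b \<in> algebra_hull_step S (max i j)"
      using mono[of i "max i j"] mono[of j "max i j"] i j by auto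
    then have "a \<union> b \<in> algebra_hull_step S (Suc (max i j))" by force
    then show "a \<union> b \<in> (\<Union>n. algebra_hull_step S n)" by blast
  qed simp
qed

lemma countable_generating_algebra:
  obtains \<A> :: "'e::second_countable_topology set set"
  where "countable \<A>" "\<A> \<subseteq> sets borel" "algebra UNIV \<A>" "sigma_sets UNIV \<A> = sets borel"
proof -
  obtain U :: "'e set set" where U: "countable U" "topological_basis U" using ex_countable_basis by auto
  have UB: "U \<subseteq> sets borel" using topological_basis_open[OF U(2)] borel_open by blast
  obtain \<A> where A: "countable \<A>" "U \<subseteq> \<A>" "\<A> \<subseteq> sets borel" "algebra UNIV \<A>"
    using countable_algebra_hull[OF U(1) UB] by auto
  have "sigma_sets UNIV \<A> = sets borel"
  proof
    show "sigma_sets UNIV \<A> \<subseteq> sets borel" using sets.sigma_sets_subset[OF A(3)] by simp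
    show "sets borel \<subseteq> sigma_sets UNIV \<A>"
      unfolding borel_eq_countable_basis[OF U] using A(2) by (simp add: sigma_sets_subseteq)
  qed
  with A that show thesis by blast
qed

text \<open>Both sides integrate \<open>h\<close> against finite measures on the state space, the
  law of \<open>V\<close> on \<open>B\<close> and the mixture of the \<open>K \<omega>\<close> over
  \<open>B\<close>, and these agree on a generating pi-system. As the hypothesis is tested on
  \<open>\<A>\<close> only, the formula is available while a conditional distribution is still being
  constructed.\<close>

lemma (in prob_space) regular_cond_distr_nn_integral:
  fixes V :: "'a \<Rightarrow> 'e::topological_space"
  assumes G: "subalgebra M G" and V[measurable]: "V \<in> borel_measurable M"
    and K: "K \<in> G \<rightarrow>\<^sub>M prob_algebra borel" and gen: "sigma_sets UNIV \<A> = sets borel" "Int_stable \<A>" "UNIV \<in> \<A>"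
    and rcd: "\<And>A. A \<in> \<A> \<Longrightarrow> AE \<omega> in M. real_cond_exp M G (\<lambda>\<omega>. indicator A (V \<omega>)) \<omega> = measure (K \<omega>) A"
    and B: "B \<in> sets G" and h[measurable]: "h \<in> borel_measurable borel"
  shows "(\<integral>\<^sup>+\<omega>. indicator B \<omega> * h (V \<omega>) \<partial>M) = (\<integral>\<^sup>+\<omega>. indicator B \<omega> * (\<integral>\<^sup>+x. h x \<partial>K \<omega>) \<partial>M)"
proof -
  interpret finite_measure_subalgebra M G by (rule finite_measure_subalgebraI[OF G])
  have BM[measurable]: "B \<in> sets M" using B G by (auto simp: subalgebra_def)
  have KM[measurable]: "K \<in> M \<rightarrow>\<^sub>M prob_algebra borel" by (rule measurable_from_subalg[OF G K])
  have KS[measurable]: "K \<in> M \<rightarrow>\<^sub>M subprob_algebra borel" by (rule measurable_prob_algebraD[OF KM])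
  define N where "N = density M (indicator B)"
  have [measurable_cong]: "sets N = sets M" by (simp add: N_def)
  have KN: "K \<in> N \<rightarrow>\<^sub>M subprob_algebra borel" by measurable
  have spN: "space N \<noteq> {}" by (simp add: N_def not_empty)
  have PK: "prob_space (K \<omega>)" "sets (K \<omega>) = sets borel" if "\<omega> \<in> space M" for \<omega>
    using measurable_space[OF KM that] by (auto simp: space_prob_algebra)
  have gen': "\<A> \<subseteq> sets borel" unfolding gen(1)[symmetric] by auto
  have "distr N borel V = N \<bind> K"
  proof (rule measure_eqI_generator_eq[where \<Omega>=UNIV and E=\<A> and A="\<lambda>_. UNIV"])
    show "sets (distr N borel V) = sigma_sets UNIV \<A>" using gen by simp
    show "sets (N \<bind> K) = sigma_sets UNIV \<A>" using sets_bind[of N K borel] KN spN gen by (simp add: sets_kernel[OF KN])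
    fix A assume A: "A \<in> \<A>"
    then have [measurable]: "A \<in> sets borel" using gen' by auto
    have "emeasure (N \<bind> K) A = (\<integral>\<^sup>+\<omega>. emeasure (K \<omega>) A \<partial>N)"
      by (rule emeasure_bind[OF spN KN]) simp
    also have "\<dots> = (\<integral>\<^sup>+\<omega>. indicator B \<omega> * emeasure (K \<omega>) A \<partial>M)"
      unfolding N_def by (rule nn_integral_density) measurable
    also have "\<dots> = (\<integral>\<^sup>+\<omega>. ennreal (indicator B \<omega> * measure (K \<omega>) A) \<partial>M)"
      using PK by (intro nn_integral_cong) (simp add: indicator_def finite_measure.emeasure_eq_measure prob_space_def)
    also have "\<dots> = ennreal (\<integral>\<omega>. indicator B \<omega> * measure (K \<omega>) A \<partial>M)"
      using PK by (intro nn_integral_eq_integral integrable_const_bound[of _ 1])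
        (auto simp: indicator_def prob_space.prob_le_1)
    also have "(\<integral>\<omega>. indicator B \<omega> * measure (K \<omega>) A \<partial>M)
        = (\<integral>\<omega>. indicator B \<omega> * real_cond_exp M G (\<lambda>\<omega>. indicator A (V \<omega>)) \<omega> \<partial>M)"
    proof (rule integral_cong_AE)
      show "AE \<omega> in M. indicator B \<omega> * measure (K \<omega>) A = indicator B \<omega> * real_cond_exp M G (\<lambda>\<omega>. indicator A (V \<omega>)) \<omega>"
        using rcd[OF A] by eventually_elim simp
    qed measurable
    also have "\<dots> = (\<integral>\<omega>. indicator B \<omega> * indicator A (V \<omega>) \<partial>M)"
      using B by (intro real_cond_exp_intg(2) integrable_const_bound[of _ 1]) (auto simp: indicator_def)
    also have "ennreal \<dots> = (\<integral>\<^sup>+\<omega>. ennreal (indicator B \<omega> * indicator A (V \<omega>)) \<partial>M)"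
      by (intro nn_integral_eq_integral[symmetric] integrable_const_bound[of _ 1]) (auto simp: indicator_def)
    also have "\<dots> = (\<integral>\<^sup>+\<omega>. indicator B \<omega> * indicator (V -` A \<inter> space M) \<omega> \<partial>M)"
      by (intro nn_integral_cong) (auto simp: indicator_def)
    also have "\<dots> = emeasure N (V -` A \<inter> space M)"
      unfolding N_def by (rule emeasure_density[symmetric]) measurable
    also have "\<dots> = emeasure (distr N borel V) A"
      by (subst emeasure_distr) (auto simp: N_def)
    finally show "emeasure (distr N borel V) A = emeasure (N \<bind> K) A" by simp
  next
    show "emeasure (distr N borel V) UNIV \<noteq> \<infinity>" for i :: nat
      by (subst emeasure_distr) (auto simp: N_def emeasure_density emeasure_eq_measure)
  qed (use gen gen' in auto)
  then have "(\<integral>\<^sup>+x. h x \<partial>distr N borel V) = (\<integral>\<^sup>+x. h x \<partial>(N \<bind> K))" by simp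
  also have "(\<integral>\<^sup>+x. h x \<partial>distr N borel V) = (\<integral>\<^sup>+\<omega>. h (V \<omega>) \<partial>N)"
    by (rule nn_integral_distr) measurable
  also have "\<dots> = (\<integral>\<^sup>+\<omega>. indicator B \<omega> * h (V \<omega>) \<partial>M)"
    unfolding N_def by (rule nn_integral_density) measurable
  also have "(\<integral>\<^sup>+x. h x \<partial>(N \<bind> K)) = (\<integral>\<^sup>+\<omega>. (\<integral>\<^sup>+x. h x \<partial>K \<omega>) \<partial>N)"
    by (rule nn_integral_bind[OF h KN])
  also have "\<dots> = (\<integral>\<^sup>+\<omega>. indicator B \<omega> * (\<integral>\<^sup>+x. h x \<partial>K \<omega>) \<partial>M)"
    unfolding N_def by (rule nn_integral_density) measurable
  finally show ?thesis .
qed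

lemma (in prob_space) regular_cond_distrI:
  fixes V :: "'a \<Rightarrow> 'e::topological_space"
  assumes G: "subalgebra M G" and V[measurable]: "V \<in> borel_measurable M"
    and K: "K \<in> G \<rightarrow>\<^sub>M prob_algebra borel" and gen: "sigma_sets UNIV \<A> = sets borel" "Int_stable \<A>" "UNIV \<in> \<A>"
    and rcd: "\<And>A. A \<in> \<A> \<Longrightarrow> AE \<omega> in M. real_cond_exp M G (\<lambda>\<omega>. indicator A (V \<omega>)) \<omega> = measure (K \<omega>) A"
  shows "regular_cond_distr M G V K"
  unfolding regular_cond_distr_def
proof (intro conjI ballI K)
  fix A :: "'e set" assume [measurable]: "A \<in> sets borel"
  interpret finite_measure_subalgebra M G by (rule finite_measure_subalgebraI[OF G])
  have KM[measurable]: "K \<in> M \<rightarrow>\<^sub>M prob_algebra borel" by (rule measurable_from_subalg[OF G K])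
  have PK: "prob_space (K \<omega>)" "sets (K \<omega>) = sets borel" if "\<omega> \<in> space M" for \<omega>
    using measurable_space[OF KM that] by (auto simp: space_prob_algebra)
  have bnd: "AE \<omega> in M. norm (measure (K \<omega>) A) \<le> 1" by (rule AE_I2) (simp add: PK prob_space.prob_le_1)
  show "AE \<omega> in M. real_cond_exp M G (\<lambda>\<omega>. indicator A (V \<omega>)) \<omega> = measure (K \<omega>) A"
  proof (rule real_cond_exp_charact)
    show "integrable M (\<lambda>\<omega>. measure (K \<omega>) A)" using bnd by (intro integrable_const_bound[of _ 1]) auto
    show "integrable M (\<lambda>\<omega>. indicator A (V \<omega>) :: real)" by (intro integrable_const_bound[of _ 1]) auto
    show "(\<lambda>\<omega>. measure (K \<omega>) A) \<in> borel_measurable G" using K by measurable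
    fix B assume B: "B \<in> sets G"
    then have BM[measurable]: "B \<in> sets M" using G by (auto simp: subalgebra_def)
    have "ennreal (\<integral>\<omega>\<in>B. indicator A (V \<omega>) \<partial>M) = (\<integral>\<^sup>+\<omega>. ennreal (indicator B \<omega> *\<^sub>R indicator A (V \<omega>)) \<partial>M)"
      unfolding set_lebesgue_integral_def
      by (intro nn_integral_eq_integral[symmetric] integrable_const_bound[of _ 1]) (auto simp: indicator_def)
    also have "\<dots> = (\<integral>\<^sup>+\<omega>. indicator B \<omega> * indicator A (V \<omega>) \<partial>M)"
      by (intro nn_integral_cong) (auto simp: indicator_def)
    also have "\<dots> = (\<integral>\<^sup>+\<omega>. indicator B \<omega> * (\<integral>\<^sup>+x. indicator A x \<partial>K \<omega>) \<partial>M)"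
      by (rule regular_cond_distr_nn_integral[OF G V K gen rcd B]) auto
    also have "\<dots> = (\<integral>\<^sup>+\<omega>. ennreal (indicator B \<omega> *\<^sub>R measure (K \<omega>) A) \<partial>M)"
      using PK by (intro nn_integral_cong) (simp add: indicator_def[of B] finite_measure.emeasure_eq_measure prob_space_def)
    also have "\<dots> = ennreal (\<integral>\<omega>\<in>B. measure (K \<omega>) A \<partial>M)"
      unfolding set_lebesgue_integral_def using bnd
      by (intro nn_integral_eq_integral integrable_const_bound[of _ 1]) (auto simp: indicator_def)
    finally show "(\<integral>\<omega>\<in>B. indicator A (V \<omega>) \<partial>M) = (\<integral>\<omega>\<in>B. measure (K \<omega>) A \<partial>M)"
      by (subst (asm) ennreal_inj) (auto simp: set_lebesgue_integral_def intro!: integral_nonneg_AE)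
  qed
qed

text \<open>Inner regularity on a Polish space, in sequence form: countably many compact sets
  suffice for each \<open>a\<close>, so that they can be adjoined to a countable algebra.\<close>

lemma inner_regular_sequence:
  fixes \<mu> :: "'e::polish_space measure"
  assumes "prob_space \<mu>" "sets \<mu> = sets borel" "a \<in> sets borel"
  shows "\<exists>C :: nat \<Rightarrow> 'e set. \<forall>i. compact (C i) \<and> C i \<subseteq> a \<and> measure \<mu> (a - C i) < 1 / real (Suc i)"
proof -
  interpret prob_space \<mu> by fact
  have a: "emeasure \<mu> a = (SUP K \<in> {K. K \<subseteq> a \<and> compact K}. emeasure \<mu> K)"
    using assms by (intro inner_regular) auto
  have "\<exists>K. compact K \<and> K \<subseteq> a \<and> measure \<mu> (a - K) < e" if e: "e > 0" for e
  proof (cases "emeasure \<mu> a = 0")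
    case True
    then show ?thesis using e by (intro exI[of _ "{}"]) (simp add: measure_def)
  next
    case False
    then have "ennreal (measure \<mu> a - e) < emeasure \<mu> a"
      using e by (cases "measure \<mu> a \<le> e") (auto simp: emeasure_eq_measure ennreal_neg zero_less_iff_neq_zero intro!: ennreal_lessI)
    then obtain K where K: "K \<subseteq> a" "compact K" "ennreal (measure \<mu> a - e) < emeasure \<mu> K"
      unfolding a less_SUP_iff by auto
    have KS: "K \<in> sets \<mu>" using K(2) assms(2) by (simp add: borel_compact)
    have "measure \<mu> a - e < measure \<mu> K"
      using K(3) by (cases "measure \<mu> a \<le> e") (auto simp: emeasure_eq_measure ennreal_less_iff ennreal_neg not_le intro: le_less_trans)
    moreover have "measure \<mu> (a - K) = measure \<mu> a - measure \<mu> K"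
      using K(1) KS assms by (intro finite_measure_Diff) auto
    ultimately show ?thesis using K by (intro exI[of _ K]) simp
  qed
  then show ?thesis by (intro choice allI) simp
qed

text \<open>Only countably many almost sure identities can hold simultaneously. The conditional
  probabilities are therefore considered on a countable generating algebra enlarged by countably
  many compact sets; off a null set they form a content with compact approximation, which extends to
  a measure.\<close>

theorem (in prob_space) regular_cond_distr_exists:
  fixes V :: "'a \<Rightarrow> 'e::polish_space"
  assumes G: "subalgebra M G" and V[measurable]: "V \<in> borel_measurable M"
  shows "\<exists>K. regular_cond_distr M G V K"
proof -
  interpret finite_measure_subalgebra M G by (rule finite_measure_subalgebraI[OF G])
  obtain \<A> :: "'e set set" where A: "countable \<A>" "\<A> \<subseteq> sets borel" "algebra UNIV \<A>"
    and gen: "sigma_sets UNIV \<A> = sets borel"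
    by (rule countable_generating_algebra)
  interpret D: prob_space "distr M borel V" by (rule prob_space_distr) measurable
  have "\<forall>a\<in>\<A>. \<exists>C :: nat \<Rightarrow> 'e set. \<forall>i. compact (C i) \<and> C i \<subseteq> a \<and> measure (distr M borel V) (a - C i) < 1 / real (Suc i)"
    using A(2) by (intro ballI inner_regular_sequence D.prob_space_axioms) auto
  then obtain C :: "'e set \<Rightarrow> nat \<Rightarrow> 'e set" where C: "\<And>a i. a \<in> \<A> \<Longrightarrow> compact (C a i)" "\<And>a i. a \<in> \<A> \<Longrightarrow> C a i \<subseteq> a"
    "\<And>a i. a \<in> \<A> \<Longrightarrow> measure (distr M borel V) (a - C a i) < 1 / real (Suc i)" by metis
  \<comment> \<open>The compact sets are adjoined before conditioning, so additivity on them is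
    among the countably many conditions.\<close>
  have "countable (\<A> \<union> (\<Union>a\<in>\<A>. range (C a)))" using A(1) by simp
  moreover have "\<A> \<union> (\<Union>a\<in>\<A>. range (C a)) \<subseteq> sets borel" using A(2) C(1) by (auto intro: borel_compact)
  ultimately obtain \<B> where B: "countable \<B>" "\<A> \<union> (\<Union>a\<in>\<A>. range (C a)) \<subseteq> \<B>" "\<B> \<subseteq> sets borel" "algebra UNIV \<B>"
    by (rule countable_algebra_hull) auto
  interpret B: algebra UNIV \<B> by (rule B(4))
  interpret A: algebra UNIV \<A> by (rule A(3))
  have CB: "a \<in> \<A> \<Longrightarrow> C a i \<in> \<B>" "a \<in> \<A> \<Longrightarrow> a \<in> \<B>" for a i using B(2) by blast+
  have Bm[measurable]: "a \<in> \<B> \<Longrightarrow> a \<in> sets borel" for a using B(3) by auto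
  define q where "q a = real_cond_exp M G (\<lambda>\<omega>. indicator a (V \<omega>))" for a
  have qG[measurable]: "q a \<in> borel_measurable G" for a unfolding q_def by simp
  have ii: "integrable M (\<lambda>\<omega>. indicator a (V \<omega>) :: real)" if "a \<in> \<B>" for a
    using Bm[OF that] by (intro integrable_const_bound[of _ 1]) auto
  have iq: "integrable M (q a)" if "a \<in> \<B>" for a unfolding q_def by (rule real_cond_exp_int[OF ii[OF that]])
  have pos: "AE \<omega> in M. 0 \<le> q a \<omega>" if "a \<in> \<B>" for a
    unfolding q_def using Bm[OF that] by (intro real_cond_exp_pos) auto
  have "AE \<omega> in M. real_cond_exp M G (\<lambda>\<omega>. 1) \<omega> = 1" by (rule real_cond_exp_F_meas) auto
  then have one: "AE \<omega> in M. q UNIV \<omega> = 1" by (simp add: q_def)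
  have add: "AE \<omega> in M. q (a \<union> b) \<omega> = q a \<omega> + q b \<omega>" if "a \<in> \<B>" "b \<in> \<B>" "a \<inter> b = {}" for a b
  proof -
    have "(\<lambda>\<omega>. indicator (a \<union> b) (V \<omega>) :: real) = (\<lambda>\<omega>. indicator a (V \<omega>) + indicator b (V \<omega>))"
      using that(3) by (auto simp: indicator_def fun_eq_iff)
    then show ?thesis unfolding q_def using real_cond_exp_add[OF ii[OF that(1)] ii[OF that(2)]] by simp
  qed
  \<comment> \<open>The unconditional mass of \<open>a - C a i\<close> tends to 0, hence the
    conditional mass does so in L1 and, along a subsequence, almost surely. The extension only needs
    some suitable \<open>i\<close> for each tolerance.\<close>
  have inner: "AE \<omega> in M. \<forall>j::nat. \<exists>i. q (a - C a i) \<omega> < 1 / real (Suc j)" if a: "a \<in> \<A>" for a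
  proof -
    have dB: "a - C a i \<in> \<B>" for i using CB[OF a] by (intro B.Diff)
    have "norm (\<integral>\<omega>. norm (q (a - C a i) \<omega>) \<partial>M) \<le> inverse (real (Suc i))" for i
    proof -
      have "(\<integral>\<omega>. norm (q (a - C a i) \<omega>) \<partial>M) = (\<integral>\<omega>. q (a - C a i) \<omega> \<partial>M)"
      proof (rule integral_cong_AE)
        show "AE \<omega> in M. norm (q (a - C a i) \<omega>) = q (a - C a i) \<omega>"
          using pos[OF dB[of i]] by eventually_elim simp
      qed (use iq[OF dB[of i]] in auto)
      also have "\<dots> = (\<integral>\<omega>. indicator (a - C a i) (V \<omega>) \<partial>M)"
        unfolding q_def by (rule real_cond_exp_int(2)[OF ii[OF dB]])
      also have "\<dots> = (\<integral>x. indicator (a - C a i) x \<partial>distr M borel V)"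
        using Bm[OF dB] by (subst integral_distr) auto
      also have "\<dots> = measure (distr M borel V) (a - C a i)"
        using Bm[OF dB] by simp
      also have "\<dots> \<le> inverse (real (Suc i))" using C(3)[OF a, of i] by (simp add: inverse_eq_divide)
      finally show ?thesis by simp
    qed
    then have "(\<lambda>i. \<integral>\<omega>. norm (q (a - C a i) \<omega>) \<partial>M) \<longlonglongrightarrow> 0"
      by (intro Lim_null_comparison[OF _ LIMSEQ_inverse_real_of_nat] always_eventually allI)
    then obtain r :: "nat \<Rightarrow> nat" where r: "AE \<omega> in M. (\<lambda>n. q (a - C a (r n)) \<omega>) \<longlonglongrightarrow> 0"
      using tendsto_L1_AE_subseq[of M "\<lambda>i. q (a - C a i)"] iq[OF dB] by blast
    show ?thesis using r
    proof eventually_elim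
      case (elim \<omega>)
      show ?case
      proof
        fix j :: nat
        have "eventually (\<lambda>n. q (a - C a (r n)) \<omega> < 1 / real (Suc j)) sequentially"
          using elim by (intro order_tendstoD) auto
        then show "\<exists>i. q (a - C a i) \<omega> < 1 / real (Suc j)" by (auto simp: eventually_sequentially)
      qed
    qed
  qed
  define good where "good \<omega> \<longleftrightarrow> (\<forall>a\<in>\<B>. 0 \<le> q a \<omega>) \<and> q UNIV \<omega> = 1
    \<and> (\<forall>a\<in>\<B>. \<forall>b\<in>\<B>. a \<inter> b = {} \<longrightarrow> q (a \<union> b) \<omega> = q a \<omega> + q b \<omega>)
    \<and> (\<forall>a\<in>\<A>. \<forall>j::nat. \<exists>i. q (a - C a i) \<omega> < 1 / real (Suc j))" for \<omega>
  have good_pred[measurable]: "Measurable.pred G good"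
    unfolding good_def using A(1) B(1) by (intro pred_intros_logic pred_intros_countable_bounded pred_intros_countable) measurable
  have good_AE: "AE \<omega> in M. good \<omega>"
    unfolding good_def using pos one add inner A(1) B(1)
    by (simp add: AE_ball_countable AE_conj_iff del: AE_all_countable)
  define \<Psi> where "\<Psi> \<omega> \<mu> \<longleftrightarrow> \<mu> \<in> space (prob_algebra borel) \<and> (\<forall>a\<in>\<A>. emeasure \<mu> a = ennreal (q a \<omega>))" for \<omega> and \<mu> :: "'e measure"
  have ex: "\<exists>\<mu>. \<Psi> \<omega> \<mu>" if g: "good \<omega>" for \<omega>
    unfolding \<Psi>_def
  proof (rule content_extends_to_prob[OF A(3) B(4) _ _ _ _ _ gen])
    fix a and \<epsilon> :: real assume a: "a \<in> \<A>" and e: "\<epsilon> > 0"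
    obtain j where j: "1 / real (Suc j) < \<epsilon>" using reals_Archimedean[OF e] by (auto simp: inverse_eq_divide)
    obtain i where "q (a - C a i) \<omega> < 1 / real (Suc j)" using g a unfolding good_def by blast
    then show "\<exists>c\<in>\<B>. compact c \<and> c \<subseteq> a \<and> q (a - c) \<omega> < \<epsilon>"
      using C(1,2)[OF a] CB(1)[OF a] j by (intro bexI[of _ "C a i"]) auto
  qed (use g CB in \<open>auto simp: good_def\<close>)
  \<comment> \<open>Outside the full-measure event \<open>good\<close> a fixed point mass is used,
    since a kernel must be a probability measure everywhere.\<close>
  define K where "K \<omega> = (if good \<omega> then SOME \<mu>. \<Psi> \<omega> \<mu> else return borel undefined)" for \<omega>
  have K1: "\<Psi> \<omega> (K \<omega>)" if "good \<omega>" for \<omega>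
    unfolding K_def using someI_ex[OF ex[OF that]] that by simp
  have Kp: "K \<omega> \<in> space (prob_algebra borel)" for \<omega>
    using K1[of \<omega>] unfolding \<Psi>_def by (cases "good \<omega>") (auto simp: K_def space_prob_algebra prob_space_return)
  have Int: "Int_stable \<A>" by (rule Int_stableI) (rule A.Int)
  have K: "K \<in> G \<rightarrow>\<^sub>M prob_algebra borel"
  proof (rule measurable_prob_algebra_generated[OF _ Int])
    show "sets borel = sigma_sets UNIV \<A>" using gen by simp
    show "prob_space (K \<omega>)" "sets (K \<omega>) = sets borel" for \<omega> using Kp[of \<omega>] by (auto simp: space_prob_algebra)
    fix a assume a: "a \<in> \<A>"
    have "(\<lambda>\<omega>. emeasure (K \<omega>) a) = (\<lambda>\<omega>. if good \<omega> then ennreal (q a \<omega>) else indicator a undefined)"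
      using K1 a A(2) unfolding \<Psi>_def by (auto simp: fun_eq_iff K_def)
    then show "(\<lambda>\<omega>. emeasure (K \<omega>) a) \<in> borel_measurable G" by simp
  qed auto
  have "regular_cond_distr M G V K"
  proof (rule regular_cond_distrI[OF G V K gen Int A.top])
    fix a assume a: "a \<in> \<A>"
    show "AE \<omega> in M. real_cond_exp M G (\<lambda>\<omega>. indicator a (V \<omega>)) \<omega> = measure (K \<omega>) a"
      using good_AE
    proof eventually_elim
      case (elim \<omega>)
      then have "emeasure (K \<omega>) a = ennreal (q a \<omega>)" "0 \<le> q a \<omega>"
        using K1[OF elim] a CB(2)[OF a] by (auto simp: \<Psi>_def good_def)
      then show ?case by (simp add: measure_def q_def)
    qed
  qed
  then show ?thesis by blast
qed

section \<open>Bayes' formula and the filter kernel\<close>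

context prob_space
begin

lemma regular_cond_distr_measurable:
  assumes "subalgebra M G" "regular_cond_distr M G V K"
  shows "K \<in> G \<rightarrow>\<^sub>M prob_algebra borel" "K \<in> M \<rightarrow>\<^sub>M prob_algebra borel"
  using assms measurable_from_subalg[OF assms(1)] unfolding regular_cond_distr_def by auto

lemma regular_cond_distr_integral:
  fixes V :: "'a \<Rightarrow> 'e::topological_space"
  assumes G: "subalgebra M G" and V[measurable]: "V \<in> borel_measurable M" and K: "regular_cond_distr M G V K"
    and B: "B \<in> sets G" and h: "h \<in> borel_measurable borel"
  shows "(\<integral>\<^sup>+\<omega>. indicator B \<omega> * h (V \<omega>) \<partial>M) = (\<integral>\<^sup>+\<omega>. indicator B \<omega> * (\<integral>\<^sup>+x. h x \<partial>K \<omega>) \<partial>M)"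
proof (rule regular_cond_distr_nn_integral[OF G V _ _ _ _ _ B h])
  show "sigma_sets UNIV (sets borel) = sets (borel :: 'e measure)" using sets.sigma_sets_eq[of borel] by simp
qed (use K in \<open>auto simp: regular_cond_distr_def sets.Int_stable\<close>)

text \<open>A version for nonnegative, possibly infinite \<open>h\<close> of finite mean, such as
  likelihoods. Both \<open>h (V \<omega>)\<close> and its kernel integral are almost surely finite,
  so \<open>enn2real\<close> loses nothing.\<close>

lemma regular_cond_distr_cond_exp:
  fixes V :: "'a \<Rightarrow> 'e::topological_space"
  assumes G: "subalgebra M G" and V[measurable]: "V \<in> borel_measurable M" and K: "regular_cond_distr M G V K"
    and h[measurable]: "h \<in> borel_measurable borel" and fin: "(\<integral>\<^sup>+\<omega>. h (V \<omega>) \<partial>M) < \<infinity>"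
  shows "AE \<omega> in M. (\<integral>\<^sup>+x. h x \<partial>K \<omega>) < \<infinity>"
    and "integrable M (\<lambda>\<omega>. enn2real (h (V \<omega>)))"
    and "AE \<omega> in M. real_cond_exp M G (\<lambda>\<omega>. enn2real (h (V \<omega>))) \<omega> = enn2real (\<integral>\<^sup>+x. h x \<partial>K \<omega>)"
proof -
  interpret finite_measure_subalgebra M G by (rule finite_measure_subalgebraI[OF G])
  note KG = regular_cond_distr_measurable[OF G K]
  have [measurable]: "K \<in> G \<rightarrow>\<^sub>M subprob_algebra borel" "K \<in> M \<rightarrow>\<^sub>M subprob_algebra borel"
    using KG measurable_prob_algebraD by auto
  define W where "W \<omega> = (\<integral>\<^sup>+x. h x \<partial>K \<omega>)" for \<omega>
  have WG[measurable]: "W \<in> borel_measurable G" and [measurable]: "W \<in> borel_measurable M"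
    unfolding W_def by measurable
  have int: "(\<integral>\<^sup>+\<omega>. indicator B \<omega> * h (V \<omega>) \<partial>M) = (\<integral>\<^sup>+\<omega>. indicator B \<omega> * W \<omega> \<partial>M)" if "B \<in> sets G" for B
    unfolding W_def by (rule regular_cond_distr_integral[OF G V K that h])
  have sp: "space M \<in> sets G" using G sets.top[of G] by (simp add: subalgebra_def)
  have "(\<integral>\<^sup>+\<omega>. W \<omega> \<partial>M) = (\<integral>\<^sup>+\<omega>. indicator (space M) \<omega> * W \<omega> \<partial>M)"
    by (intro nn_integral_cong) simp
  also have "\<dots> = (\<integral>\<^sup>+\<omega>. indicator (space M) \<omega> * h (V \<omega>) \<partial>M)" by (rule int[OF sp, symmetric])
  also have "\<dots> = (\<integral>\<^sup>+\<omega>. h (V \<omega>) \<partial>M)"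
    by (intro nn_integral_cong) simp
  finally have finW: "(\<integral>\<^sup>+\<omega>. W \<omega> \<partial>M) < \<infinity>" using fin by simp
  have hf: "AE \<omega> in M. h (V \<omega>) \<noteq> \<infinity>" and Wf: "AE \<omega> in M. W \<omega> \<noteq> \<infinity>"
    using fin finW by (intro nn_integral_PInf_AE; simp)+
  show "AE \<omega> in M. (\<integral>\<^sup>+x. h x \<partial>K \<omega>) < \<infinity>" using Wf by (simp add: W_def less_top)
  have re: "(\<integral>\<^sup>+\<omega>. ennreal (indicator B \<omega> *\<^sub>R enn2real (u \<omega>)) \<partial>M) = (\<integral>\<^sup>+\<omega>. indicator B \<omega> * u \<omega> \<partial>M)"
    if "AE \<omega> in M. u \<omega> \<noteq> \<infinity>" for u B
    by (rule nn_integral_cong_AE, use that in eventually_elim)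
      (auto simp: indicator_def ennreal_enn2real_if)
  have ire: "integrable M (\<lambda>\<omega>. enn2real (u \<omega>))" if "AE \<omega> in M. u \<omega> \<noteq> \<infinity>" "(\<integral>\<^sup>+\<omega>. u \<omega> \<partial>M) < \<infinity>" "u \<in> borel_measurable M" for u
  proof (rule integrableI_bounded)
    have "(\<integral>\<^sup>+\<omega>. ennreal (norm (enn2real (u \<omega>))) \<partial>M) = (\<integral>\<^sup>+\<omega>. u \<omega> \<partial>M)"
      by (rule nn_integral_cong_AE, use that(1) in eventually_elim) (simp add: ennreal_enn2real_if)
    then show "(\<integral>\<^sup>+\<omega>. ennreal (norm (enn2real (u \<omega>))) \<partial>M) < \<infinity>" using that(2) by simp
  qed (use that(3) in measurable)
  show ih: "integrable M (\<lambda>\<omega>. enn2real (h (V \<omega>)))" by (rule ire[OF hf fin]) measurable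
  have iW: "integrable M (\<lambda>\<omega>. enn2real (W \<omega>))" by (rule ire[OF Wf finW]) measurable
  have "AE \<omega> in M. real_cond_exp M G (\<lambda>\<omega>. enn2real (h (V \<omega>))) \<omega> = enn2real (W \<omega>)"
  proof (rule real_cond_exp_charact[OF _ ih iW])
    fix B assume B: "B \<in> sets G"
    then have BM[measurable]: "B \<in> sets M" using G by (auto simp: subalgebra_def)
    have eq: "(\<integral>\<omega>\<in>B. enn2real (u \<omega>) \<partial>M) = enn2real (\<integral>\<^sup>+\<omega>. indicator B \<omega> * u \<omega> \<partial>M)"
      if "AE \<omega> in M. u \<omega> \<noteq> \<infinity>" "u \<in> borel_measurable M" for u
      unfolding re[OF that(1), symmetric] set_lebesgue_integral_def
      using that(2) by (intro integral_eq_nn_integral) auto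
    show "(\<integral>\<omega>\<in>B. enn2real (h (V \<omega>)) \<partial>M) = (\<integral>\<omega>\<in>B. enn2real (W \<omega>) \<partial>M)"
      using eq[OF hf] eq[OF Wf] int[OF B] by simp
  qed measurable
  then show "AE \<omega> in M. real_cond_exp M G (\<lambda>\<omega>. enn2real (h (V \<omega>))) \<omega> = enn2real (\<integral>\<^sup>+x. h x \<partial>K \<omega>)"
    by (simp add: W_def)
qed

end

section \<open>Product form and measurability of Bayes' formula\<close>

lemma bayes_in_prob_algebra:
  assumes \<nu>: "\<nu> \<in> space (prob_algebra borel)" and g: "(\<lambda>x. g x y) \<in> borel_measurable borel"
  shows "bayes g \<nu> y \<in> space (prob_algebra borel)"
proof (cases "likelihood g \<nu> y \<in> {0, \<infinity>}")
  case False
  have [measurable_cong]: "sets \<nu> = sets borel" using \<nu> by (simp add: space_prob_algebra)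
  note g[measurable]
  have "prob_space (density \<nu> (\<lambda>x. ennreal (g x y) / likelihood g \<nu> y))"
  proof (rule prob_spaceI)
    have "emeasure (density \<nu> (\<lambda>x. ennreal (g x y) / likelihood g \<nu> y)) (space (density \<nu> (\<lambda>x. ennreal (g x y) / likelihood g \<nu> y)))
      = (\<integral>\<^sup>+x. ennreal (g x y) / likelihood g \<nu> y \<partial>\<nu>)"
      unfolding space_density by (subst emeasure_density) (auto intro!: nn_integral_cong)
    also have "\<dots> = likelihood g \<nu> y / likelihood g \<nu> y"
      unfolding likelihood_def by (rule nn_integral_divide) measurable
    also have "\<dots> = 1" using False by (intro ennreal_divide_self) (auto simp: less_top)
    finally show "emeasure (density \<nu> (\<lambda>x. ennreal (g x y) / likelihood g \<nu> y)) (space (density \<nu> (\<lambda>x. ennreal (g x y) / likelihood g \<nu> y))) = 1" .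
  qed
  then show ?thesis using False \<nu> by (simp add: bayes_def space_prob_algebra)
qed (use \<nu> in \<open>simp add: bayes_def\<close>)

text \<open>As a product, Bayes' formula survives a likelihood equal to 0: the right side is at most
  the likelihood and vanishes with it, whatever default \<open>bayes\<close> takes there.\<close>

lemma likelihood_times_bayes:
  assumes \<nu>: "sets \<nu> = sets borel" and g[measurable]: "(\<lambda>x. g x y) \<in> borel_measurable borel"
    and C[measurable]: "C \<in> sets borel" and fin: "likelihood g \<nu> y < \<infinity>"
  shows "likelihood g \<nu> y * emeasure (bayes g \<nu> y) C = (\<integral>\<^sup>+x. indicator C x * ennreal (g x y) \<partial>\<nu>)"
proof (cases "likelihood g \<nu> y = 0")
  case True
  have "(\<integral>\<^sup>+x. indicator C x * ennreal (g x y) \<partial>\<nu>) \<le> likelihood g \<nu> y"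
    unfolding likelihood_def by (intro nn_integral_mono) (auto simp: indicator_def)
  then show ?thesis using True by simp
next
  case False
  note \<nu>[measurable_cong]
  have "emeasure (bayes g \<nu> y) C = (\<integral>\<^sup>+x. (ennreal (g x y) / likelihood g \<nu> y) * indicator C x \<partial>\<nu>)"
    using False fin by (simp add: bayes_def emeasure_density)
  also have "\<dots> = (\<integral>\<^sup>+x. (indicator C x * ennreal (g x y)) / likelihood g \<nu> y \<partial>\<nu>)"
    by (intro nn_integral_cong) (simp add: indicator_def)
  also have "\<dots> = (\<integral>\<^sup>+x. indicator C x * ennreal (g x y) \<partial>\<nu>) / likelihood g \<nu> y"
    by (rule nn_integral_divide) measurable
  finally show ?thesis using False fin by (simp add: ennreal_mult_divide_eq ennreal_times_divide less_top mult.commute[of "likelihood g \<nu> y"] ennreal_divide_times)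
qed

lemma bayes_measurable:
  fixes g :: "'e::second_countable_topology \<Rightarrow> 'f::second_countable_topology \<Rightarrow> real"
  assumes g: "(\<lambda>(x, y). g x y) \<in> borel_measurable borel"
    and K: "K \<in> N \<rightarrow>\<^sub>M prob_algebra borel" and h[measurable]: "h \<in> N \<rightarrow>\<^sub>M borel"
  shows "(\<lambda>z. likelihood g (K z) (h z)) \<in> borel_measurable N"
    and "(\<lambda>z. bayes g (K z) (h z)) \<in> N \<rightarrow>\<^sub>M prob_algebra borel"
proof -
  have g'[measurable]: "(\<lambda>(x, y). g x y) \<in> borel_measurable (borel \<Otimes>\<^sub>M borel)" using g by (simp add: borel_prod)
  have KS[measurable]: "K \<in> N \<rightarrow>\<^sub>M subprob_algebra borel" by (rule measurable_prob_algebraD[OF K])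
  have gx: "(\<lambda>x. g x y) \<in> borel_measurable borel" for y by measurable
  show L[measurable]: "(\<lambda>z. likelihood g (K z) (h z)) \<in> borel_measurable N"
    unfolding likelihood_def by (rule nn_integral_measurable_subprob_algebra2[OF _ KS]) measurable
  have Kp: "K z \<in> space (prob_algebra borel)" if "z \<in> space N" for z using measurable_space[OF K that] .
  show "(\<lambda>z. bayes g (K z) (h z)) \<in> N \<rightarrow>\<^sub>M prob_algebra borel"
  proof (rule measurable_prob_algebra_generated)
    show "sets borel = sigma_sets UNIV (sets (borel :: 'e measure))" using sets.sigma_sets_eq[of "borel :: 'e measure"] by simp
    show "Int_stable (sets borel)" by (rule sets.Int_stable)
    fix z assume "z \<in> space N"
    then have "bayes g (K z) (h z) \<in> space (prob_algebra borel)" by (rule bayes_in_prob_algebra[OF Kp gx])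
    then show "prob_space (bayes g (K z) (h z))" "sets (bayes g (K z) (h z)) = sets borel"
      by (auto simp: space_prob_algebra)
  next
    fix A :: "'e set" assume A[measurable]: "A \<in> sets borel"
    have "emeasure (bayes g (K z) (h z)) A = (if likelihood g (K z) (h z) \<in> {0, \<infinity>} then emeasure (K z) A
      else (\<integral>\<^sup>+x. ennreal (g x (h z)) / likelihood g (K z) (h z) * indicator A x \<partial>K z))" if "z \<in> space N" for z
    proof -
      have s: "sets (K z) = sets borel" using Kp[OF that] by (simp add: space_prob_algebra)
      have "(\<lambda>x. ennreal (g x y) / c) \<in> borel_measurable borel" for y c using gx[of y] by measurable
      then have "(\<lambda>x. ennreal (g x (h z)) / likelihood g (K z) (h z)) \<in> borel_measurable (K z)"
        by (simp add: measurable_cong_sets[OF s refl])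
      with s show ?thesis by (auto simp: bayes_def emeasure_density)
    qed
    moreover have "(\<lambda>z. if likelihood g (K z) (h z) \<in> {0, \<infinity>} then emeasure (K z) A
      else (\<integral>\<^sup>+x. ennreal (g x (h z)) / likelihood g (K z) (h z) * indicator A x \<partial>K z)) \<in> borel_measurable N"
    proof (rule measurable_If)
      show "(\<lambda>z. \<integral>\<^sup>+x. ennreal (g x (h z)) / likelihood g (K z) (h z) * indicator A x \<partial>K z) \<in> borel_measurable N"
        by (rule nn_integral_measurable_subprob_algebra2[OF _ KS]) measurable
    qed measurable
    ultimately show "(\<lambda>z. emeasure (bayes g (K z) (h z)) A) \<in> borel_measurable N"
      by (subst measurable_cong) auto
  qed auto
qed

text \<open>One transition from time 0 to time 1 with an abstract past \<open>G0\<close>. The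
  assumption \<open>step\<close> is the Markov property on rectangles: given \<open>G0\<close>, the
  next state is drawn from \<open>P (X0 \<omega>)\<close> and the observation from the density
  \<open>g\<close> at that state. Any sub-sigma-algebra of \<open>G0\<close> can then serve as the
  available information, in particular the observations with or without a delayed signal.\<close>

locale filter_step = prob_space M for M :: "'w measure" +
  fixes G0 :: "'w measure" and X0 X1 :: "'w \<Rightarrow> 'e::polish_space" and Y1 :: "'w \<Rightarrow> 'f::polish_space"
    and P :: "'e \<Rightarrow> 'e measure" and g :: "'e \<Rightarrow> 'f \<Rightarrow> real" and \<phi> :: "'f measure"
  assumes G0: "subalgebra M G0"
    and X0[measurable]: "X0 \<in> borel_measurable M" and X1[measurable]: "X1 \<in> borel_measurable M"
    and Y1[measurable]: "Y1 \<in> borel_measurable M"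
    and P_kernel: "P \<in> borel \<rightarrow>\<^sub>M prob_algebra borel"
    and sets_ref[measurable_cong]: "sets \<phi> = sets borel" and sigma_finite_ref: "sigma_finite_measure \<phi>"
    and g_meas: "(\<lambda>(x, y). g x y) \<in> borel_measurable borel"
    and g_norm: "\<And>x. (\<integral>\<^sup>+y. ennreal (g x y) \<partial>\<phi>) = 1"
    and step: "\<And>B C D. B \<in> sets G0 \<Longrightarrow> C \<in> sets borel \<Longrightarrow> D \<in> sets borel \<Longrightarrow>
      (\<integral>\<^sup>+\<omega>. indicator B \<omega> * indicator C (X1 \<omega>) * indicator D (Y1 \<omega>) \<partial>M)
      = (\<integral>\<^sup>+\<omega>. indicator B \<omega> * (\<integral>\<^sup>+x. indicator C x * (\<integral>\<^sup>+y. indicator D y * ennreal (g x y) \<partial>\<phi>) \<partial>P (X0 \<omega>)) \<partial>M)"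
begin

section \<open>The unnormalised filter and the filter kernel\<close>

sublocale ref: sigma_finite_measure \<phi> by (rule sigma_finite_ref)

lemma g_pair[measurable]: "(\<lambda>(x, y). g x y) \<in> borel_measurable (borel \<Otimes>\<^sub>M borel)"
  using g_meas by (simp add: borel_prod)

lemma P_subprob[measurable]: "P \<in> borel \<rightarrow>\<^sub>M subprob_algebra borel"
  by (rule measurable_prob_algebraD[OF P_kernel])

text \<open>The unnormalised posterior mass of \<open>C\<close> after predicting with
  \<open>P\<close> and observing \<open>y\<close>. For \<open>C = UNIV\<close> it is the normalising
  constant of the filter and also the \<open>\<phi>\<close>-density of the next observation when the
  present state has law \<open>\<mu>\<close>.\<close>

definition weight :: "'e set \<Rightarrow> 'e measure \<Rightarrow> 'f \<Rightarrow> ennreal"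
  where "weight C \<mu> y = (\<integral>\<^sup>+x0. (\<integral>\<^sup>+x. indicator C x * ennreal (g x y) \<partial>P x0) \<partial>\<mu>)"

lemma obs_weight_measurable:
  assumes [measurable]: "C \<in> sets borel" "h \<in> N \<rightarrow>\<^sub>M borel" "k \<in> N \<rightarrow>\<^sub>M borel"
  shows "(\<lambda>z. \<integral>\<^sup>+x. indicator C x * ennreal (g x (h z)) \<partial>P (k z)) \<in> borel_measurable N"
  by (rule nn_integral_measurable_subprob_algebra2[where N=borel]) measurable

lemma weight_measurable:
  assumes C[measurable]: "C \<in> sets borel" and K: "K \<in> N \<rightarrow>\<^sub>M prob_algebra borel" and h[measurable]: "h \<in> N \<rightarrow>\<^sub>M borel"
  shows "(\<lambda>z. weight C (K z) (h z)) \<in> borel_measurable N"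
proof -
  have [measurable]: "K \<in> N \<rightarrow>\<^sub>M subprob_algebra borel" by (rule measurable_prob_algebraD[OF K])
  have [measurable]: "(\<lambda>z. \<integral>\<^sup>+x. indicator C x * ennreal (g x (h (fst z))) \<partial>P (snd z)) \<in> borel_measurable (N \<Otimes>\<^sub>M borel)"
    by (rule obs_weight_measurable) measurable
  show ?thesis unfolding weight_def
    by (rule nn_integral_measurable_subprob_algebra2[where N=borel]) (auto simp: split_beta')
qed

lemma predict_in_prob_algebra: "\<mu> \<in> space (prob_algebra borel) \<Longrightarrow> \<mu> \<bind> P \<in> space (prob_algebra borel)"
  using prob_space_bind'[OF _ P_kernel] sets_bind'[OF _ P_kernel] by (simp add: space_prob_algebra)

lemma weight_predict:
  assumes \<mu>: "\<mu> \<in> space (prob_algebra borel)" and C[measurable]: "C \<in> sets borel"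
  shows "(\<integral>\<^sup>+x. indicator C x * ennreal (g x y) \<partial>(\<mu> \<bind> P)) = weight C \<mu> y"
proof -
  have s: "sets \<mu> = sets borel" using \<mu> by (simp add: space_prob_algebra)
  have Pm: "P \<in> \<mu> \<rightarrow>\<^sub>M subprob_algebra borel" using measurable_cong_sets[OF s refl] P_subprob by blast
  show ?thesis unfolding weight_def by (rule nn_integral_bind[OF _ Pm]) measurable
qed

lemma likelihood_predict:
  assumes \<mu>: "\<mu> \<in> space (prob_algebra borel)"
  shows "likelihood g (\<mu> \<bind> P) y = weight UNIV \<mu> y"
  using weight_predict[OF \<mu>, of UNIV] by (simp add: likelihood_def)

definition update :: "'e measure \<Rightarrow> 'f \<Rightarrow> 'e measure"
  where "update \<mu> y = bayes g (\<mu> \<bind> P) y"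

lemma g_section: "(\<lambda>x. g x y) \<in> borel_measurable borel" by measurable

lemma weight_times_update:
  assumes \<mu>: "\<mu> \<in> space (prob_algebra borel)" and C: "C \<in> sets borel" and fin: "weight UNIV \<mu> y < \<infinity>"
  shows "weight UNIV \<mu> y * emeasure (update \<mu> y) C = weight C \<mu> y"
  using likelihood_times_bayes[where \<nu>="\<mu> \<bind> P" and g=g and y=y, OF _ g_section C] fin
    weight_predict[OF \<mu> C] predict_in_prob_algebra[OF \<mu>]
  unfolding likelihood_predict[OF \<mu>] update_def by (simp add: space_prob_algebra)

lemma predict_measurable: "K \<in> N \<rightarrow>\<^sub>M prob_algebra borel \<Longrightarrow> (\<lambda>z. K z \<bind> P) \<in> N \<rightarrow>\<^sub>M prob_algebra borel"
  by (rule measurable_bind_prob_space[OF _ P_kernel])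

lemma update_measurable:
  assumes "K \<in> N \<rightarrow>\<^sub>M prob_algebra borel" "h \<in> N \<rightarrow>\<^sub>M borel"
  shows "(\<lambda>z. update (K z) (h z)) \<in> N \<rightarrow>\<^sub>M prob_algebra borel"
  unfolding update_def by (rule bayes_measurable(2)[OF g_meas predict_measurable[OF assms(1)] assms(2)])

lemma update_in_prob_algebra: "\<mu> \<in> space (prob_algebra borel) \<Longrightarrow> update \<mu> y \<in> space (prob_algebra borel)"
  unfolding update_def by (intro bayes_in_prob_algebra predict_in_prob_algebra g_section)

text \<open>Tonelli's theorem moves the observation outside. This exhibits
  \<open>weight C \<mu>\<close> as the density of the next observation on the event that the next
  state lies in \<open>C\<close>.\<close>

lemma weight_integral:
  assumes \<mu>: "\<mu> \<in> space (prob_algebra borel)" and C[measurable]: "C \<in> sets borel" and D[measurable]: "D \<in> sets borel"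
  shows "(\<integral>\<^sup>+x0. (\<integral>\<^sup>+x. indicator C x * (\<integral>\<^sup>+y. indicator D y * ennreal (g x y) \<partial>\<phi>) \<partial>P x0) \<partial>\<mu>)
    = (\<integral>\<^sup>+y. indicator D y * weight C \<mu> y \<partial>\<phi>)"
proof -
  have [measurable_cong]: "sets \<mu> = sets borel" and mu: "prob_space \<mu>" using \<mu> by (auto simp: space_prob_algebra)
  interpret mu: prob_space \<mu> by fact
  have Px: "prob_space (P x)" "sets (P x) = sets borel" for x
    using measurable_space[OF P_kernel, of x] by (auto simp: space_prob_algebra)
  interpret pair_sigma_finite \<mu> \<phi> by unfold_locales
  have ow[measurable]: "(\<lambda>z. \<integral>\<^sup>+x. indicator C x * ennreal (g x (snd z)) \<partial>P (fst z)) \<in> borel_measurable (\<mu> \<Otimes>\<^sub>M \<phi>)"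
    by (rule obs_weight_measurable) measurable
  have "(\<integral>\<^sup>+x. indicator C x * (\<integral>\<^sup>+y. indicator D y * ennreal (g x y) \<partial>\<phi>) \<partial>P x0)
    = (\<integral>\<^sup>+y. indicator D y * (\<integral>\<^sup>+x. indicator C x * ennreal (g x y) \<partial>P x0) \<partial>\<phi>)" for x0
  proof -
    have [measurable_cong]: "sets (P x0) = sets borel" by (rule Px)
    interpret Px: prob_space "P x0" by (rule Px)
    interpret S: pair_sigma_finite "P x0" \<phi> by unfold_locales
    have "(\<integral>\<^sup>+x. indicator C x * (\<integral>\<^sup>+y. indicator D y * ennreal (g x y) \<partial>\<phi>) \<partial>P x0)
      = (\<integral>\<^sup>+x. (\<integral>\<^sup>+y. indicator C x * (indicator D y * ennreal (g x y)) \<partial>\<phi>) \<partial>P x0)"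
      by (intro nn_integral_cong nn_integral_cmult[symmetric]) measurable
    also have "\<dots> = (\<integral>\<^sup>+y. (\<integral>\<^sup>+x. indicator C x * (indicator D y * ennreal (g x y)) \<partial>P x0) \<partial>\<phi>)"
      by (rule S.Fubini'[symmetric]) measurable
    also have "\<dots> = (\<integral>\<^sup>+y. (\<integral>\<^sup>+x. indicator D y * (indicator C x * ennreal (g x y)) \<partial>P x0) \<partial>\<phi>)"
      by (simp add: mult.left_commute)
    also have "\<dots> = (\<integral>\<^sup>+y. indicator D y * (\<integral>\<^sup>+x. indicator C x * ennreal (g x y) \<partial>P x0) \<partial>\<phi>)"
      by (intro nn_integral_cong nn_integral_cmult) measurable
    finally show ?thesis .
  qed
  then have "(\<integral>\<^sup>+x0. (\<integral>\<^sup>+x. indicator C x * (\<integral>\<^sup>+y. indicator D y * ennreal (g x y) \<partial>\<phi>) \<partial>P x0) \<partial>\<mu>)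
      = (\<integral>\<^sup>+x0. (\<integral>\<^sup>+y. indicator D y * (\<integral>\<^sup>+x. indicator C x * ennreal (g x y) \<partial>P x0) \<partial>\<phi>) \<partial>\<mu>)" by simp
  also have "\<dots> = (\<integral>\<^sup>+y. (\<integral>\<^sup>+x0. indicator D y * (\<integral>\<^sup>+x. indicator C x * ennreal (g x y) \<partial>P x0) \<partial>\<mu>) \<partial>\<phi>)"
    by (rule Fubini'[symmetric]) (simp add: split_beta')
  also have "\<dots> = (\<integral>\<^sup>+y. indicator D y * weight C \<mu> y \<partial>\<phi>)"
    unfolding weight_def
  proof (intro nn_integral_cong nn_integral_cmult)
    fix y
    show "(\<lambda>x0. \<integral>\<^sup>+x. indicator C x * ennreal (g x y) \<partial>P x0) \<in> borel_measurable \<mu>"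
      by (rule obs_weight_measurable) measurable
  qed
  finally show ?thesis .
qed

lemma weight_total:
  assumes \<mu>: "\<mu> \<in> space (prob_algebra borel)"
  shows "(\<integral>\<^sup>+y. weight UNIV \<mu> y \<partial>\<phi>) = 1"
proof -
  have "emeasure (P x) (space (P x)) = 1" for x
    using measurable_space[OF P_kernel, of x] by (auto simp: space_prob_algebra prob_space.emeasure_space_1)
  moreover have "emeasure \<mu> (space \<mu>) = 1" using \<mu> by (auto simp: space_prob_algebra prob_space.emeasure_space_1)
  ultimately show ?thesis using weight_integral[OF \<mu>, of UNIV UNIV] by (simp add: g_norm)
qed

lemma filter_kernel_emeasure:
  assumes \<mu>: "\<mu> \<in> space (prob_algebra borel)" and W[measurable]: "W \<in> sets (prob_algebra borel)"
  shows "emeasure (filter_kernel P g \<phi> \<mu>) W = (\<integral>\<^sup>+y. weight UNIV \<mu> y * indicator W (update \<mu> y) \<partial>\<phi>)"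
proof -
  have [measurable]: "(\<lambda>y. weight UNIV \<mu> y) \<in> borel_measurable borel"
    by (rule weight_measurable) (use \<mu> in auto)
  have u[measurable]: "update \<mu> \<in> borel \<rightarrow>\<^sub>M prob_algebra borel"
    by (rule update_measurable[where K="\<lambda>_. \<mu>" and h="\<lambda>y. y"]) (use \<mu> in auto)
  have l: "likelihood g (\<mu> \<bind> P) = weight UNIV \<mu>" using likelihood_predict[OF \<mu>] by auto
  have [simp]: "bayes g (\<mu> \<bind> P) = update \<mu>" by (simp add: update_def fun_eq_iff)
  have "emeasure (filter_kernel P g \<phi> \<mu>) W = emeasure (density \<phi> (weight UNIV \<mu>)) (update \<mu> -` W \<inter> space \<phi>)"
    unfolding filter_kernel_def l by (subst emeasure_distr) auto
  also have "\<dots> = (\<integral>\<^sup>+y. weight UNIV \<mu> y * indicator (update \<mu> -` W \<inter> space \<phi>) y \<partial>\<phi>)"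
    by (rule emeasure_density) measurable
  also have "\<dots> = (\<integral>\<^sup>+y. weight UNIV \<mu> y * indicator W (update \<mu> y) \<partial>\<phi>)"
    by (intro nn_integral_cong) (simp add: indicator_def)
  finally show ?thesis .
qed

lemma filter_kernel_measurable:
  "filter_kernel P g \<phi> \<in> prob_algebra borel \<rightarrow>\<^sub>M prob_algebra (prob_algebra borel)"
proof (rule measurable_prob_algebra_generated)
  let ?N = "prob_algebra borel :: 'e measure measure"
  show "sets ?N = sigma_sets (space ?N) (sets ?N)" by (simp add: sets.sigma_sets_eq)
  show "Int_stable (sets ?N)" by (rule sets.Int_stable)
  show "sets ?N \<subseteq> Pow (space ?N)" by (rule sets.space_closed)
  fix \<mu> assume \<mu>: "\<mu> \<in> space ?N"
  show s: "sets (filter_kernel P g \<phi> \<mu>) = sets ?N" by (simp add: filter_kernel_def)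
  have "emeasure (filter_kernel P g \<phi> \<mu>) (space ?N) = (\<integral>\<^sup>+y. weight UNIV \<mu> y \<partial>\<phi>)"
    using update_in_prob_algebra[OF \<mu>] by (subst filter_kernel_emeasure[OF \<mu>]) auto
  then show "prob_space (filter_kernel P g \<phi> \<mu>)"
    using weight_total[OF \<mu>] sets_eq_imp_space_eq[OF s] by (intro prob_spaceI) simp
next
  fix W :: "'e measure set" assume W[measurable]: "W \<in> sets (prob_algebra borel)"
  have [measurable]: "(\<lambda>z. weight UNIV (fst z) (snd z)) \<in> borel_measurable (prob_algebra borel \<Otimes>\<^sub>M \<phi>)"
    by (rule weight_measurable) measurable
  have [measurable]: "(\<lambda>z. update (fst z) (snd z)) \<in> prob_algebra borel \<Otimes>\<^sub>M \<phi> \<rightarrow>\<^sub>M prob_algebra borel"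
    by (rule update_measurable) measurable
  have "(\<lambda>\<mu>. \<integral>\<^sup>+y. weight UNIV \<mu> y * indicator W (update \<mu> y) \<partial>\<phi>) \<in> borel_measurable (prob_algebra borel)"
    by (rule ref.borel_measurable_nn_integral) (simp add: split_beta')
  then show "(\<lambda>\<mu>. emeasure (filter_kernel P g \<phi> \<mu>) W) \<in> borel_measurable (prob_algebra borel)"
    by (subst measurable_cong) (auto simp: filter_kernel_emeasure)
qed

section \<open>Conditional law of the next observation and of the next state\<close>

lemma subalgebra_past: "subalgebra G0 A \<Longrightarrow> subalgebra M A"
  using G0 by (auto simp: subalgebra_def)

lemma kernel_space:
  assumes "subalgebra G0 A" "regular_cond_distr M A X0 K" "\<omega> \<in> space M"
  shows "K \<omega> \<in> space (prob_algebra borel)"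
  using measurable_space[OF regular_cond_distr_measurable(2)[OF subalgebra_past[OF assms(1)] assms(2)] assms(3)] .

text \<open>Conditioning in two stages: the Markov property given the full past \<open>G0\<close>,
  then an average of \<open>X0\<close> over its conditional law \<open>K\<close> given the smaller
  \<open>A\<close>.\<close>

lemma predictive_law:
  assumes A: "subalgebra G0 A" and K: "regular_cond_distr M A X0 K"
    and B: "B \<in> sets A" and C[measurable]: "C \<in> sets borel" and D[measurable]: "D \<in> sets borel"
  shows "(\<integral>\<^sup>+\<omega>. indicator B \<omega> * indicator C (X1 \<omega>) * indicator D (Y1 \<omega>) \<partial>M)
    = (\<integral>\<^sup>+\<omega>. indicator B \<omega> * (\<integral>\<^sup>+y. indicator D y * weight C (K \<omega>) y \<partial>\<phi>) \<partial>M)"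
proof -
  have "B \<in> sets G0" using A B by (auto simp: subalgebra_def)
  then have "(\<integral>\<^sup>+\<omega>. indicator B \<omega> * indicator C (X1 \<omega>) * indicator D (Y1 \<omega>) \<partial>M)
    = (\<integral>\<^sup>+\<omega>. indicator B \<omega> * (\<integral>\<^sup>+x. indicator C x * (\<integral>\<^sup>+y. indicator D y * ennreal (g x y) \<partial>\<phi>) \<partial>P (X0 \<omega>)) \<partial>M)"
    by (rule step) measurable
  also have "\<dots> = (\<integral>\<^sup>+\<omega>. indicator B \<omega> * (\<integral>\<^sup>+x0. (\<integral>\<^sup>+x. indicator C x * (\<integral>\<^sup>+y. indicator D y * ennreal (g x y) \<partial>\<phi>) \<partial>P x0) \<partial>K \<omega>) \<partial>M)"
    by (rule regular_cond_distr_integral[OF subalgebra_past[OF A] X0 K B]) measurable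
  also have "\<dots> = (\<integral>\<^sup>+\<omega>. indicator B \<omega> * (\<integral>\<^sup>+y. indicator D y * weight C (K \<omega>) y \<partial>\<phi>) \<partial>M)"
    using kernel_space[OF A K] by (intro nn_integral_cong) (simp add: weight_integral)
  finally show ?thesis .
qed

text \<open>Given \<open>A\<close>, the observation has the density
  \<open>weight UNIV (K \<omega>)\<close>. Rectangles are settled by the predictive law; the
  extension to functions \<open>F\<close> of the pair is needed because the updated filter depends
  jointly on the past and the observation.\<close>

lemma observation_nn_integral:
  assumes A: "subalgebra G0 A" and K: "regular_cond_distr M A X0 K"
    and F: "F \<in> borel_measurable (A \<Otimes>\<^sub>M borel)"
  shows "(\<integral>\<^sup>+\<omega>. F (\<omega>, Y1 \<omega>) \<partial>M) = (\<integral>\<^sup>+\<omega>. (\<integral>\<^sup>+y. weight UNIV (K \<omega>) y * F (\<omega>, y) \<partial>\<phi>) \<partial>M)"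
proof -
  have MA: "subalgebra M A" by (rule subalgebra_past[OF A])
  have KA[measurable]: "K \<in> A \<rightarrow>\<^sub>M prob_algebra borel" by (rule regular_cond_distr_measurable[OF MA K])
  \<comment> \<open>\<open>F\<close> lives on the product of \<open>A\<close> with the observation
    space, so the past is carried by the restriction of \<open>M\<close> to
    \<open>A\<close>.\<close>
  define MA' where "MA' = restr_to_subalg M A"
  have [measurable_cong]: "sets MA' = sets A" by (simp add: MA'_def sets_restr_to_subalg[OF MA])
  have spA: "space A = space M" using MA by (simp add: subalgebra_def)
  have idA: "(\<lambda>x. x) \<in> M \<rightarrow>\<^sub>M A" by (rule measurable_from_subalg[OF MA]) simp
  have pairm: "(\<lambda>\<omega>. (\<omega>, Y1 \<omega>)) \<in> M \<rightarrow>\<^sub>M A \<Otimes>\<^sub>M borel" using idA by measurable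
  have w[measurable]: "(\<lambda>z. weight UNIV (K (fst z)) (snd z)) \<in> borel_measurable (A \<Otimes>\<^sub>M borel)"
    by (rule weight_measurable) measurable
  define N1 where "N1 = distr M (A \<Otimes>\<^sub>M borel) (\<lambda>\<omega>. (\<omega>, Y1 \<omega>))"
  define N2 where "N2 = density (MA' \<Otimes>\<^sub>M \<phi>) (\<lambda>z. weight UNIV (K (fst z)) (snd z))"
  have N2: "(\<integral>\<^sup>+z. H z \<partial>N2) = (\<integral>\<^sup>+\<omega>. (\<integral>\<^sup>+y. weight UNIV (K \<omega>) y * H (\<omega>, y) \<partial>\<phi>) \<partial>M)"
    if H[measurable]: "H \<in> borel_measurable (A \<Otimes>\<^sub>M borel)" for H
  proof -
    have "(\<integral>\<^sup>+z. H z \<partial>N2) = (\<integral>\<^sup>+z. weight UNIV (K (fst z)) (snd z) * H z \<partial>(MA' \<Otimes>\<^sub>M \<phi>))"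
      unfolding N2_def by (rule nn_integral_density) measurable
    also have "\<dots> = (\<integral>\<^sup>+\<omega>. (\<integral>\<^sup>+y. weight UNIV (K \<omega>) y * H (\<omega>, y) \<partial>\<phi>) \<partial>MA')"
      by (subst ref.nn_integral_fst[symmetric]) simp_all
    also have "\<dots> = (\<integral>\<^sup>+\<omega>. (\<integral>\<^sup>+y. weight UNIV (K \<omega>) y * H (\<omega>, y) \<partial>\<phi>) \<partial>M)"
      unfolding MA'_def
    proof (rule nn_integral_subalgebra2[OF MA])
      have "(\<lambda>(\<omega>, y). weight UNIV (K \<omega>) y * H (\<omega>, y)) \<in> borel_measurable (A \<Otimes>\<^sub>M \<phi>)"
        by (simp add: split_beta')
      then show "(\<lambda>\<omega>. \<integral>\<^sup>+y. weight UNIV (K \<omega>) y * H (\<omega>, y) \<partial>\<phi>) \<in> borel_measurable A"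
        by (rule ref.borel_measurable_nn_integral)
    qed
    finally show ?thesis .
  qed
  have N1: "(\<integral>\<^sup>+z. H z \<partial>N1) = (\<integral>\<^sup>+\<omega>. H (\<omega>, Y1 \<omega>) \<partial>M)"
    if H[measurable]: "H \<in> borel_measurable (A \<Otimes>\<^sub>M borel)" for H
    unfolding N1_def by (rule nn_integral_distr[OF pairm]) measurable
  have "N1 = N2"
  proof (rule measure_eqI_generator_eq[OF Int_stable_pair_measure_generator, where \<Omega>="space A \<times> space borel" and A="\<lambda>_. space A \<times> space borel"])
    show "{a \<times> b |a b. a \<in> sets A \<and> b \<in> sets (borel :: 'f measure)} \<subseteq> Pow (space A \<times> space borel)"
      by (rule pair_measure_closed)
    show "sets N1 = sigma_sets (space A \<times> space borel) {a \<times> b |a b. a \<in> sets A \<and> b \<in> sets (borel :: 'f measure)}"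
      by (simp add: N1_def sets_pair_measure)
    show "sets N2 = sigma_sets (space A \<times> space borel) {a \<times> b |a b. a \<in> sets A \<and> b \<in> sets (borel :: 'f measure)}"
    proof -
      have "sets N2 = sets (A \<Otimes>\<^sub>M borel)" unfolding N2_def sets_density by (intro sets_pair_measure_cong) (simp_all add: MA'_def sets_restr_to_subalg[OF MA] sets_ref)
      then show ?thesis by (simp add: sets_pair_measure)
    qed
    show "range (\<lambda>_::nat. space A \<times> space borel) \<subseteq> {a \<times> b |a b. a \<in> sets A \<and> b \<in> sets (borel :: 'f measure)}"
      using sets.top[of A] sets.top[of "borel :: 'f measure"] by blast
    show "emeasure N1 (space A \<times> space borel) \<noteq> \<infinity>" for i :: nat
    proof -
      interpret N1: prob_space N1 unfolding N1_def by (rule prob_space_distr[OF pairm])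
      show ?thesis by (simp add: N1.emeasure_eq_measure)
    qed
    fix Z assume "Z \<in> {a \<times> b |a b. a \<in> sets A \<and> b \<in> sets (borel :: 'f measure)}"
    then obtain B D where Z: "Z = B \<times> D" and B[measurable]: "B \<in> sets A" and D[measurable]: "D \<in> sets borel" by auto
    have ZS: "Z \<in> sets (A \<Otimes>\<^sub>M borel)" unfolding Z by measurable
    have "emeasure N1 Z = (\<integral>\<^sup>+\<omega>. indicator Z (\<omega>, Y1 \<omega>) \<partial>M)"
      using ZS N1[of "indicator Z"] by (simp add: N1_def)
    also have "\<dots> = (\<integral>\<^sup>+\<omega>. indicator B \<omega> * indicator UNIV (X1 \<omega>) * indicator D (Y1 \<omega>) \<partial>M)"
      by (intro nn_integral_cong) (simp add: Z indicator_def)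
    also have "\<dots> = (\<integral>\<^sup>+\<omega>. indicator B \<omega> * (\<integral>\<^sup>+y. indicator D y * weight UNIV (K \<omega>) y \<partial>\<phi>) \<partial>M)"
      by (rule predictive_law[OF A K B]) measurable
    also have "\<dots> = (\<integral>\<^sup>+\<omega>. (\<integral>\<^sup>+y. weight UNIV (K \<omega>) y * indicator Z (\<omega>, y) \<partial>\<phi>) \<partial>M)"
      by (intro nn_integral_cong) (auto simp: Z indicator_def mult.commute cong: if_cong intro!: nn_integral_cong)
    also have "\<dots> = emeasure N2 Z"
    proof -
      have "Z \<in> sets N2" using ZS by (simp add: N2_def sets_pair_measure_cong[OF \<open>sets MA' = sets A\<close> sets_ref])
      then show ?thesis using N2[of "indicator Z"] ZS by simp
    qed
    finally show "emeasure N1 Z = emeasure N2 Z" .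
  qed auto
  then show ?thesis using N1[OF F] N2[OF F] by simp
qed

lemma weight_finite:
  assumes \<mu>: "\<mu> \<in> space (prob_algebra borel)"
  shows "AE y in \<phi>. weight UNIV \<mu> y < \<infinity>"
proof -
  have [measurable]: "(\<lambda>y. weight UNIV \<mu> y) \<in> borel_measurable \<phi>"
    by (rule weight_measurable) (use \<mu> in auto)
  have "AE y in \<phi>. weight UNIV \<mu> y \<noteq> \<infinity>"
    using weight_total[OF \<mu>] by (intro nn_integral_PInf_AE) auto
  then show ?thesis by (simp add: less_top)
qed

lemma update_is_cond_exp:
  assumes A: "subalgebra G0 A" and K: "regular_cond_distr M A X0 K"
    and A': "space A' = space M" "sets A' = sigma_sets (space M) {B \<inter> (Y1 -` D \<inter> space M) |B D. B \<in> sets A \<and> D \<in> sets borel}"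
    and C[measurable]: "C \<in> sets borel"
  shows "AE \<omega> in M. real_cond_exp M A' (\<lambda>\<omega>. indicator C (X1 \<omega>)) \<omega> = measure (update (K \<omega>) (Y1 \<omega>)) C"
proof -
  let ?E = "{B \<inter> (Y1 -` D \<inter> space M) |B D. B \<in> sets A \<and> D \<in> sets borel}"
  have EI: "B \<inter> (Y1 -` D \<inter> space M) \<in> ?E" if "B \<in> sets A" "D \<in> sets borel" for B D
    using that by blast
  define U where "U \<omega> = measure (update (K \<omega>) (Y1 \<omega>)) C" for \<omega>
  have MA: "subalgebra M A" by (rule subalgebra_past[OF A])
  have spA: "space A = space M" using MA by (simp add: subalgebra_def)
  have KA: "K \<in> A \<rightarrow>\<^sub>M prob_algebra borel" by (rule regular_cond_distr_measurable[OF MA K])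
  have "?E \<subseteq> sets M" using MA by (auto simp: subalgebra_def)
  then have MA': "subalgebra M A'" unfolding subalgebra_def A' using sets.sigma_sets_subset by auto
  have AA': "subalgebra A' A"
    unfolding subalgebra_def
  proof (intro conjI subsetI)
    fix B assume B: "B \<in> sets A"
    have "B \<inter> (Y1 -` UNIV \<inter> space M) = B" using sets.sets_into_space[OF B] spA by auto
    then have "B \<in> ?E" using EI[OF B, of UNIV] by simp
    then show "B \<in> sets A'" unfolding A'(2) by (rule sigma_sets.Basic)
  qed (simp add: A' spA)
  have YA'[measurable]: "Y1 \<in> A' \<rightarrow>\<^sub>M borel"
  proof (rule measurableI)
    fix D :: "'f set" assume "D \<in> sets borel"
    then have "space A \<inter> (Y1 -` D \<inter> space M) \<in> ?E" by (rule EI[OF sets.top])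
    then have "Y1 -` D \<inter> space A' \<in> ?E" by (simp add: spA A' Int_ac)
    then show "Y1 -` D \<inter> space A' \<in> sets A'" unfolding A'(2) by (rule sigma_sets.Basic)
  qed auto
  have KA'[measurable]: "K \<in> A' \<rightarrow>\<^sub>M prob_algebra borel" by (rule measurable_from_subalg[OF AA' KA])
  have updA'[measurable]: "(\<lambda>\<omega>. update (K \<omega>) (Y1 \<omega>)) \<in> A' \<rightarrow>\<^sub>M prob_algebra borel" by (rule update_measurable) measurable
  have UA'[measurable]: "U \<in> borel_measurable A'" unfolding U_def by measurable
  have UM[measurable]: "U \<in> borel_measurable M" by (rule measurable_from_subalg[OF MA' UA'])
  have pu: "prob_space (update (K \<omega>) y)" if "\<omega> \<in> space M" for \<omega> y
    using update_in_prob_algebra[OF kernel_space[OF A K that]] by (simp add: space_prob_algebra)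
  have U01: "0 \<le> U \<omega>" "\<omega> \<in> space M \<Longrightarrow> U \<omega> \<le> 1" for \<omega>
    using pu[of \<omega> "Y1 \<omega>"] by (auto simp: U_def prob_space.prob_le_1)
  have conv: "ennreal (\<integral>\<omega>\<in>Z. u \<omega> \<partial>M) = (\<integral>\<^sup>+\<omega>. indicator Z \<omega> * ennreal (u \<omega>) \<partial>M)"
    if "Z \<in> sets M" "u \<in> borel_measurable M" "\<And>\<omega>. 0 \<le> u \<omega>" "\<And>\<omega>. \<omega> \<in> space M \<Longrightarrow> u \<omega> \<le> 1" for u :: "_ \<Rightarrow> real" and Z
  proof -
    have "(\<integral>\<^sup>+\<omega>. ennreal (indicator Z \<omega> *\<^sub>R u \<omega>) \<partial>M) = ennreal (\<integral>\<omega>\<in>Z. u \<omega> \<partial>M)"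
      unfolding set_lebesgue_integral_def using that
      by (intro nn_integral_eq_integral integrable_const_bound[of _ 1] AE_I2) (auto simp: indicator_def)
    moreover have "ennreal (indicator Z \<omega> *\<^sub>R u \<omega>) = indicator Z \<omega> * ennreal (u \<omega>)" for \<omega> by (simp add: indicator_def)
    ultimately show ?thesis by simp
  qed
  have iU: "integrable M U" using U01 by (intro integrable_const_bound[of _ 1] AE_I2) auto
  have "AE \<omega> in M. real_cond_exp M A' (\<lambda>\<omega>. indicator C (X1 \<omega>)) \<omega> = U \<omega>"
  proof (rule cond_exp_charact_generator[OF MA' A'(2) _ _ _ iU UA'])
    show "Int_stable ?E"
    proof (rule Int_stableI)
      fix a b assume "a \<in> ?E" "b \<in> ?E"
      then obtain B D B' D' where *: "a = B \<inter> (Y1 -` D \<inter> space M)" "b = B' \<inter> (Y1 -` D' \<inter> space M)"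
        "B \<in> sets A" "B' \<in> sets A" "D \<in> sets borel" "D' \<in> sets borel" by blast
      have "(B \<inter> B') \<inter> (Y1 -` (D \<inter> D') \<inter> space M) \<in> ?E" using * by (intro EI) auto
      then show "a \<inter> b \<in> ?E" unfolding *(1,2) by (simp add: vimage_Int Int_ac)
    qed
    show "space M \<in> ?E" using EI[OF sets.top, of UNIV] by (simp add: spA)
    show "integrable M (\<lambda>\<omega>. indicator C (X1 \<omega>) :: real)" by (intro integrable_const_bound[of _ 1]) auto
    fix Z assume "Z \<in> ?E"
    then obtain B D where Z: "Z = B \<inter> (Y1 -` D \<inter> space M)" and B[measurable]: "B \<in> sets A" and D[measurable]: "D \<in> sets borel" by blast
    have BM[measurable]: "B \<in> sets M" using MA B by (auto simp: subalgebra_def)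
    have ZM[measurable]: "Z \<in> sets M" unfolding Z by measurable
    define F where "F = (\<lambda>z. indicator B (fst z) * indicator D (snd z) * emeasure (update (K (fst z)) (snd z)) C)"
    have [measurable]: "(\<lambda>z. update (K (fst z)) (snd z)) \<in> A \<Otimes>\<^sub>M borel \<rightarrow>\<^sub>M prob_algebra borel"
      by (rule update_measurable[OF measurable_compose[OF measurable_fst KA] measurable_snd])
    have [measurable]: "(\<lambda>z. update (K (fst z)) (snd z)) \<in> A \<Otimes>\<^sub>M borel \<rightarrow>\<^sub>M subprob_algebra borel"
      by (rule measurable_prob_algebraD) measurable
    have F: "F \<in> borel_measurable (A \<Otimes>\<^sub>M borel)" unfolding F_def by measurable
    have "ennreal (\<integral>\<omega>\<in>Z. U \<omega> \<partial>M) = (\<integral>\<^sup>+\<omega>. indicator Z \<omega> * ennreal (U \<omega>) \<partial>M)"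
      using U01 by (intro conv) auto
    also have "\<dots> = (\<integral>\<^sup>+\<omega>. F (\<omega>, Y1 \<omega>) \<partial>M)"
      using pu by (intro nn_integral_cong) (simp add: F_def Z U_def indicator_def finite_measure.emeasure_eq_measure prob_space_def)
    also have "\<dots> = (\<integral>\<^sup>+\<omega>. (\<integral>\<^sup>+y. weight UNIV (K \<omega>) y * F (\<omega>, y) \<partial>\<phi>) \<partial>M)"
      by (rule observation_nn_integral[OF A K F])
    also have "\<dots> = (\<integral>\<^sup>+\<omega>. indicator B \<omega> * (\<integral>\<^sup>+y. indicator D y * weight C (K \<omega>) y \<partial>\<phi>) \<partial>M)"
    proof (intro nn_integral_cong)
      fix \<omega> assume "\<omega> \<in> space M"
      then have k: "K \<omega> \<in> space (prob_algebra borel)" by (rule kernel_space[OF A K])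
      have [measurable]: "(\<lambda>y. weight C (K \<omega>) y) \<in> borel_measurable \<phi>"
        by (rule weight_measurable) (use k in auto)
      have "(\<integral>\<^sup>+y. weight UNIV (K \<omega>) y * F (\<omega>, y) \<partial>\<phi>) = (\<integral>\<^sup>+y. indicator B \<omega> * (indicator D y * weight C (K \<omega>) y) \<partial>\<phi>)"
        by (rule nn_integral_cong_AE, use weight_finite[OF k] in eventually_elim)
          (simp add: F_def indicator_def weight_times_update[OF k C])
      also have "\<dots> = indicator B \<omega> * (\<integral>\<^sup>+y. indicator D y * weight C (K \<omega>) y \<partial>\<phi>)"
        by (rule nn_integral_cmult) measurable
      finally show "(\<integral>\<^sup>+y. weight UNIV (K \<omega>) y * F (\<omega>, y) \<partial>\<phi>) = \<dots>" .
    qed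
    also have "\<dots> = (\<integral>\<^sup>+\<omega>. indicator B \<omega> * indicator C (X1 \<omega>) * indicator D (Y1 \<omega>) \<partial>M)"
      by (rule predictive_law[OF A K B C D, symmetric])
    also have "\<dots> = (\<integral>\<^sup>+\<omega>. indicator Z \<omega> * ennreal (indicator C (X1 \<omega>)) \<partial>M)"
      by (intro nn_integral_cong) (simp add: Z indicator_def)
    also have "\<dots> = ennreal (\<integral>\<omega>\<in>Z. indicator C (X1 \<omega>) \<partial>M)"
      by (rule conv[symmetric]) (auto simp: indicator_def)
    finally show "(\<integral>\<omega>\<in>Z. indicator C (X1 \<omega>) \<partial>M) = (\<integral>\<omega>\<in>Z. U \<omega> \<partial>M)"
      using U01 by (subst (asm) ennreal_inj) (auto simp: set_lebesgue_integral_def intro!: integral_nonneg_AE)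
  qed
  then show ?thesis by (simp add: U_def)
qed

text \<open>The filter kernel at \<open>K \<omega>\<close> draws the observation with density
  \<open>weight UNIV (K \<omega>)\<close>, which is exactly its conditional law given
  \<open>A\<close>. Averaging over \<open>\<omega>\<close> gives the composition.\<close>

lemma update_law:
  assumes A: "subalgebra G0 A" and K: "regular_cond_distr M A X0 K"
  shows "distr M (prob_algebra borel) (\<lambda>\<omega>. update (K \<omega>) (Y1 \<omega>)) = distr M (prob_algebra borel) K \<bind> filter_kernel P g \<phi>"
proof -
  have MA: "subalgebra M A" by (rule subalgebra_past[OF A])
  note KA = regular_cond_distr_measurable[OF MA K]
  have [measurable]: "K \<in> M \<rightarrow>\<^sub>M prob_algebra borel" by (rule KA)
  have u[measurable]: "(\<lambda>\<omega>. update (K \<omega>) (Y1 \<omega>)) \<in> M \<rightarrow>\<^sub>M prob_algebra borel" by (rule update_measurable) measurable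
  have FK[measurable]: "filter_kernel P g \<phi> \<in> prob_algebra borel \<rightarrow>\<^sub>M subprob_algebra (prob_algebra borel)"
    by (rule measurable_prob_algebraD[OF filter_kernel_measurable])
  let ?D = "distr M (prob_algebra borel) K"
  have ne: "space ?D \<noteq> {}"
    using measurable_space[OF KA(2)] not_empty by auto
  have FK': "filter_kernel P g \<phi> \<in> ?D \<rightarrow>\<^sub>M subprob_algebra (prob_algebra borel)" by measurable
  show ?thesis
  proof (rule measure_eqI)
    show "sets (distr M (prob_algebra borel) (\<lambda>\<omega>. update (K \<omega>) (Y1 \<omega>))) = sets (?D \<bind> filter_kernel P g \<phi>)"
      using sets_bind[OF _ ne, of "filter_kernel P g \<phi>" "prob_algebra borel"] sets_kernel[OF FK'] by simp
    fix W assume "W \<in> sets (distr M (prob_algebra borel) (\<lambda>\<omega>. update (K \<omega>) (Y1 \<omega>)))"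
    then have W[measurable]: "W \<in> sets (prob_algebra borel)" by simp
    have m: "(\<lambda>z. update (K (fst z)) (snd z)) \<in> A \<Otimes>\<^sub>M borel \<rightarrow>\<^sub>M prob_algebra borel"
      by (rule update_measurable[OF measurable_compose[OF measurable_fst KA(1)] measurable_snd])
    have "emeasure (distr M (prob_algebra borel) (\<lambda>\<omega>. update (K \<omega>) (Y1 \<omega>))) W
      = (\<integral>\<^sup>+\<mu>. indicator W \<mu> \<partial>distr M (prob_algebra borel) (\<lambda>\<omega>. update (K \<omega>) (Y1 \<omega>)))"
      by simp
    also have "\<dots> = (\<integral>\<^sup>+\<omega>. indicator W (update (K \<omega>) (Y1 \<omega>)) \<partial>M)"
      by (rule nn_integral_distr) measurable
    also have "\<dots> = (\<integral>\<^sup>+\<omega>. (\<integral>\<^sup>+y. weight UNIV (K \<omega>) y * indicator W (update (K \<omega>) y) \<partial>\<phi>) \<partial>M)"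
      using observation_nn_integral[OF A K, of "\<lambda>z. indicator W (update (K (fst z)) (snd z))"] m by simp
    also have "\<dots> = (\<integral>\<^sup>+\<omega>. emeasure (filter_kernel P g \<phi> (K \<omega>)) W \<partial>M)"
      using kernel_space[OF A K] by (intro nn_integral_cong) (simp add: filter_kernel_emeasure)
    also have "\<dots> = (\<integral>\<^sup>+\<mu>. emeasure (filter_kernel P g \<phi> \<mu>) W \<partial>?D)"
      by (rule nn_integral_distr[symmetric]) measurable
    also have "\<dots> = emeasure (?D \<bind> filter_kernel P g \<phi>) W"
      by (rule emeasure_bind[OF ne FK' W, symmetric])
    finally show "emeasure (distr M (prob_algebra borel) (\<lambda>\<omega>. update (K \<omega>) (Y1 \<omega>))) W = emeasure (?D \<bind> filter_kernel P g \<phi>) W" .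
  qed
qed

text \<open>Distance of two unnormalised filters on one set. \<open>enn2real\<close> sends an
  infinite weight to 0, so the quantity is used for those \<open>y\<close>, almost all with respect
  to \<open>\<phi>\<close>, at which both weights are finite.\<close>

definition discrepancy :: "'e set \<Rightarrow> 'e measure \<Rightarrow> 'e measure \<Rightarrow> 'f \<Rightarrow> ennreal"
  where "discrepancy C \<mu> \<nu> y = ennreal \<bar>enn2real (weight C \<mu> y) - enn2real (weight C \<nu> y)\<bar>"

lemma discrepancy_measurable:
  assumes [measurable]: "C \<in> sets borel" "K \<in> N \<rightarrow>\<^sub>M prob_algebra borel" "L \<in> N \<rightarrow>\<^sub>M prob_algebra borel" "h \<in> N \<rightarrow>\<^sub>M borel"
  shows "(\<lambda>z. discrepancy C (K z) (L z) (h z)) \<in> borel_measurable N"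
proof -
  have [measurable]: "(\<lambda>z. weight C (K z) (h z)) \<in> borel_measurable N" "(\<lambda>z. weight C (L z) (h z)) \<in> borel_measurable N"
    by (rule weight_measurable; measurable)+
  show ?thesis unfolding discrepancy_def by measurable
qed

text \<open>Multiplying by the normalising constant of \<open>\<mu>\<close>, which is also the density of the observation,
  removes the quotient in Bayes' formula, so no lower bound on the likelihood is needed.\<close>

lemma update_discrepancy:
  assumes \<mu>: "\<mu> \<in> space (prob_algebra borel)" and \<nu>: "\<nu> \<in> space (prob_algebra borel)" and C: "C \<in> sets borel"
    and fin: "weight UNIV \<mu> y < \<infinity>" "weight UNIV \<nu> y < \<infinity>"
  shows "weight UNIV \<mu> y * ennreal \<bar>measure (update \<mu> y) C - measure (update \<nu> y) C\<bar>
    \<le> discrepancy C \<mu> \<nu> y + discrepancy UNIV \<mu> \<nu> y"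
proof -
  define w q u where "w \<rho> = enn2real (weight UNIV \<rho> y)" and "q \<rho> = enn2real (weight C \<rho> y)" and "u \<rho> = measure (update \<rho> y) C" for \<rho>
  have p: "prob_space (update \<rho> y)" if "\<rho> \<in> {\<mu>, \<nu>}" for \<rho>
    using update_in_prob_algebra[of \<rho> y] that \<mu> \<nu> by (auto simp: space_prob_algebra)
  have eq: "w \<rho> * u \<rho> = q \<rho>" if "\<rho> \<in> {\<mu>, \<nu>}" for \<rho>
  proof -
    interpret u: prob_space "update \<rho> y" by (rule p[OF that])
    have "weight UNIV \<rho> y * emeasure (update \<rho> y) C = weight C \<rho> y"
      using that \<mu> \<nu> fin by (intro weight_times_update C) auto
    then show ?thesis unfolding w_def q_def u_def by (metis enn2real_mult measure_def)
  qed
  have u: "0 \<le> u \<nu>" "u \<nu> \<le> 1" using prob_space.prob_le_1[OF p[of \<nu>]] by (auto simp: u_def)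
  have w0: "0 \<le> w \<mu>" by (simp add: w_def)
  have "w \<mu> * \<bar>u \<mu> - u \<nu>\<bar> = \<bar>(q \<mu> - q \<nu>) - (w \<mu> - w \<nu>) * u \<nu>\<bar>"
  proof -
    have "w \<mu> * \<bar>u \<mu> - u \<nu>\<bar> = \<bar>w \<mu> * (u \<mu> - u \<nu>)\<bar>" using w0 by (simp add: abs_mult)
    \<comment> \<open>Products replace both quotients: \<open>w \<mu> * u \<mu>\<close> is
      \<open>q \<mu>\<close>, and \<open>w \<nu> * u \<nu> = q \<nu>\<close> is added and
      subtracted.\<close>
    also have "w \<mu> * (u \<mu> - u \<nu>) = (q \<mu> - q \<nu>) - (w \<mu> - w \<nu>) * u \<nu>"
      using eq[of \<mu>] eq[of \<nu>] by (simp add: algebra_simps)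
    finally show ?thesis .
  qed
  also have "\<dots> \<le> \<bar>q \<mu> - q \<nu>\<bar> + \<bar>(w \<mu> - w \<nu>) * u \<nu>\<bar>" by (rule abs_triangle_ineq4)
  also have "\<bar>(w \<mu> - w \<nu>) * u \<nu>\<bar> \<le> \<bar>w \<mu> - w \<nu>\<bar>"
    using u by (simp add: abs_mult mult_left_le)
  finally have "ennreal (w \<mu> * \<bar>u \<mu> - u \<nu>\<bar>) \<le> ennreal (\<bar>q \<mu> - q \<nu>\<bar> + \<bar>w \<mu> - w \<nu>\<bar>)" by (intro ennreal_leI) simp
  moreover have "ennreal (w \<mu>) = weight UNIV \<mu> y" using fin by (simp add: w_def)
  ultimately show ?thesis
    unfolding discrepancy_def w_def[symmetric] q_def[symmetric] u_def[symmetric] using w0 by (simp add: ennreal_mult)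
qed

lemma initial_law_in_prob_algebra: "distr M borel X0 \<in> space (prob_algebra borel)"
  using prob_space_distr[OF X0] by (simp add: space_prob_algebra)

text \<open>By the tower property the mean weight is the same for every information
  \<open>A\<close>. Its bound, the unconditional density of the observation, depends neither on
  \<open>A\<close> nor on \<open>C\<close> and provides the majorant for dominated
  convergence.\<close>

lemma expected_weight:
  assumes A: "subalgebra G0 A" and K: "regular_cond_distr M A X0 K" and C[measurable]: "C \<in> sets borel"
  shows "(\<integral>\<^sup>+\<omega>. weight C (K \<omega>) y \<partial>M) = (\<integral>\<^sup>+\<omega>. (\<integral>\<^sup>+x. indicator C x * ennreal (g x y) \<partial>P (X0 \<omega>)) \<partial>M)"
    and "(\<integral>\<^sup>+\<omega>. (\<integral>\<^sup>+x. indicator C x * ennreal (g x y) \<partial>P (X0 \<omega>)) \<partial>M) \<le> weight UNIV (distr M borel X0) y"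
proof -
  have m[measurable]: "(\<lambda>x0. \<integral>\<^sup>+x. indicator C x * ennreal (g x y) \<partial>P x0) \<in> borel_measurable borel" if [measurable]: "C \<in> sets borel" for C
    by (rule obs_weight_measurable) measurable
  have MA: "subalgebra M A" by (rule subalgebra_past[OF A])
  have sp: "space M \<in> sets A" using MA sets.top[of A] by (simp add: subalgebra_def)
  have "(\<integral>\<^sup>+\<omega>. indicator (space M) \<omega> * (\<integral>\<^sup>+x. indicator C x * ennreal (g x y) \<partial>P (X0 \<omega>)) \<partial>M)
    = (\<integral>\<^sup>+\<omega>. indicator (space M) \<omega> * weight C (K \<omega>) y \<partial>M)"
    unfolding weight_def by (rule regular_cond_distr_integral[OF MA X0 K sp m]) measurable
  then show "(\<integral>\<^sup>+\<omega>. weight C (K \<omega>) y \<partial>M) = (\<integral>\<^sup>+\<omega>. (\<integral>\<^sup>+x. indicator C x * ennreal (g x y) \<partial>P (X0 \<omega>)) \<partial>M)"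
    by (simp cong: nn_integral_cong)
  have "(\<integral>\<^sup>+\<omega>. (\<integral>\<^sup>+x. indicator C x * ennreal (g x y) \<partial>P (X0 \<omega>)) \<partial>M) \<le> (\<integral>\<^sup>+\<omega>. (\<integral>\<^sup>+x. indicator UNIV x * ennreal (g x y) \<partial>P (X0 \<omega>)) \<partial>M)"
    by (intro nn_integral_mono) (auto simp: indicator_def)
  also have "\<dots> = weight UNIV (distr M borel X0) y"
    unfolding weight_def using m[of UNIV] by (subst nn_integral_distr) auto
  finally show "(\<integral>\<^sup>+\<omega>. (\<integral>\<^sup>+x. indicator C x * ennreal (g x y) \<partial>P (X0 \<omega>)) \<partial>M) \<le> weight UNIV (distr M borel X0) y" .
qed

section \<open>Bayes' formula along a decreasing sequence of sigma-algebras\<close>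

context
  fixes A :: "nat \<Rightarrow> 'w measure" and A' :: "'w measure" and L :: "nat \<Rightarrow> 'w \<Rightarrow> 'e measure" and K :: "'w \<Rightarrow> 'e measure"
  assumes A: "\<And>n. subalgebra G0 (A n)" and mono: "\<And>m n. m \<le> n \<Longrightarrow> subalgebra (A m) (A n)"
    and Ainf: "space A' = space M" "sets A' = (\<Inter>n. sets (A n))"
    and L: "\<And>n. regular_cond_distr M (A n) X0 (L n)" and K: "regular_cond_distr M A' X0 K"
begin

lemma intersection_subalgebra: "subalgebra (A n) A'" "subalgebra G0 A'"
  using A[of n] Ainf G0 by (auto simp: subalgebra_def)

lemma discrepancy_le:
  assumes C: "C \<in> sets borel"
  shows "(\<integral>\<^sup>+\<omega>. discrepancy C (L n \<omega>) (K \<omega>) y \<partial>M) \<le> 2 * weight UNIV (distr M borel X0) y"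
proof -
  note Lm = regular_cond_distr_measurable(2)[OF subalgebra_past[OF A] L]
  note Km = regular_cond_distr_measurable(2)[OF subalgebra_past[OF intersection_subalgebra(2)] K]
  have [measurable]: "(\<lambda>\<omega>. weight C (L n \<omega>) y) \<in> borel_measurable M" "(\<lambda>\<omega>. weight C (K \<omega>) y) \<in> borel_measurable M"
    using C Lm Km by (auto intro!: weight_measurable)
  have le: "discrepancy C \<mu> \<nu> y \<le> weight C \<mu> y + weight C \<nu> y" for \<mu> \<nu>
  proof (cases "weight C \<mu> y" "weight C \<nu> y" rule: ennreal2_cases)
    case (real_real r q)
    then show ?thesis by (auto simp: discrepancy_def ennreal_plus[symmetric] simp del: ennreal_plus intro!: ennreal_leI)
  qed (simp_all add: discrepancy_def)
  have "(\<integral>\<^sup>+\<omega>. discrepancy C (L n \<omega>) (K \<omega>) y \<partial>M) \<le> (\<integral>\<^sup>+\<omega>. weight C (L n \<omega>) y + weight C (K \<omega>) y \<partial>M)"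
    by (intro nn_integral_mono le)
  also have "\<dots> = (\<integral>\<^sup>+\<omega>. weight C (L n \<omega>) y \<partial>M) + (\<integral>\<^sup>+\<omega>. weight C (K \<omega>) y \<partial>M)"
    by (rule nn_integral_add) measurable
  also have "\<dots> \<le> weight UNIV (distr M borel X0) y + weight UNIV (distr M borel X0) y"
    using expected_weight[OF A L C] expected_weight[OF intersection_subalgebra(2) K C] by (intro add_mono) auto
  finally show ?thesis by (simp add: mult_2)
qed

text \<open>For fixed \<open>y\<close> the weight of \<open>L n \<omega>\<close> is the conditional
  expectation given \<open>A n\<close> of one function \<open>h\<close> of \<open>X0\<close>, so
  this is reverse martingale convergence. Finiteness of the unconditional density at
  \<open>y\<close> makes \<open>h (X0 \<omega>)\<close> integrable.\<close>

lemma discrepancy_tendsto: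
  assumes C: "C \<in> sets borel" and fin: "weight UNIV (distr M borel X0) y < \<infinity>"
  shows "(\<lambda>n. \<integral>\<^sup>+\<omega>. discrepancy C (L n \<omega>) (K \<omega>) y \<partial>M) \<longlonglongrightarrow> 0"
proof -
  define h where "h x0 = (\<integral>\<^sup>+x. indicator C x * ennreal (g x y) \<partial>P x0)" for x0
  have hm: "h \<in> borel_measurable borel" unfolding h_def by (rule obs_weight_measurable[OF C]) measurable
  have hfin: "(\<integral>\<^sup>+\<omega>. h (X0 \<omega>) \<partial>M) < \<infinity>"
    unfolding h_def using expected_weight(2)[OF A L C] fin by (rule le_less_trans)
  note MA = subalgebra_past[OF A] and MAinf = subalgebra_past[OF intersection_subalgebra(2)]
  define H where "H \<omega> = enn2real (h (X0 \<omega>))" for \<omega>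
  have iH: "integrable M H" unfolding H_def by (rule regular_cond_distr_cond_exp(2)[OF MA X0 L hm hfin])
  have "(\<lambda>n. expectation (\<lambda>\<omega>. \<bar>real_cond_exp M (A n) H \<omega> - real_cond_exp M A' H \<omega>\<bar>)) \<longlonglongrightarrow> 0"
    by (rule cond_exp_decreasing[OF MA mono Ainf iH])
  then have "(\<lambda>n. ennreal (expectation (\<lambda>\<omega>. \<bar>real_cond_exp M (A n) H \<omega> - real_cond_exp M A' H \<omega>\<bar>))) \<longlonglongrightarrow> ennreal 0"
    by (intro tendsto_intros)
  moreover have "ennreal (expectation (\<lambda>\<omega>. \<bar>real_cond_exp M (A n) H \<omega> - real_cond_exp M A' H \<omega>\<bar>))
      = (\<integral>\<^sup>+\<omega>. discrepancy C (L n \<omega>) (K \<omega>) y \<partial>M)" for n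
  proof -
    have "ennreal (expectation (\<lambda>\<omega>. \<bar>real_cond_exp M (A n) H \<omega> - real_cond_exp M A' H \<omega>\<bar>))
      = (\<integral>\<^sup>+\<omega>. ennreal \<bar>real_cond_exp M (A n) H \<omega> - real_cond_exp M A' H \<omega>\<bar> \<partial>M)"
      using cond_exp_integrable[OF MA iH] cond_exp_integrable[OF MAinf iH] by (subst nn_integral_eq_integral) auto
    also have "\<dots> = (\<integral>\<^sup>+\<omega>. discrepancy C (L n \<omega>) (K \<omega>) y \<partial>M)"
    proof (rule nn_integral_cong_AE)
      show "AE \<omega> in M. ennreal \<bar>real_cond_exp M (A n) H \<omega> - real_cond_exp M A' H \<omega>\<bar> = discrepancy C (L n \<omega>) (K \<omega>) y"
        using regular_cond_distr_cond_exp(3)[OF MA X0 L hm hfin, of n] regular_cond_distr_cond_exp(3)[OF MAinf X0 K hm hfin]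
        by eventually_elim (simp add: discrepancy_def weight_def h_def H_def[abs_def])
    qed
    finally show ?thesis .
  qed
  ultimately show ?thesis by simp
qed

text \<open>The observation is replaced by an integral over \<open>y\<close> with density
  \<open>weight UNIV (L n \<omega>)\<close>. This density times the difference of the updates is
  bounded by discrepancies, whose means tend to 0 for almost every \<open>y\<close> under an
  integrable majorant. The limit is thus taken in the formula, without comparing the sigma-algebras
  after the observation has been adjoined.\<close>

lemma update_tendsto:
  assumes C: "C \<in> sets borel"
  shows "(\<lambda>n. \<integral>\<^sup>+\<omega>. ennreal \<bar>measure (update (L n \<omega>) (Y1 \<omega>)) C - measure (update (K \<omega>) (Y1 \<omega>)) C\<bar> \<partial>M) \<longlonglongrightarrow> 0"
proof -
  note MA = subalgebra_past[OF A] and MAinf = subalgebra_past[OF intersection_subalgebra(2)]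
  note Lm = regular_cond_distr_measurable[OF MA L] and Km = regular_cond_distr_measurable[OF MAinf K]
  interpret S: pair_sigma_finite M \<phi> by unfold_locales
  let ?w = "\<lambda>y. weight UNIV (distr M borel X0) y"
  have dm: "(\<lambda>z. discrepancy D (L n (fst z)) (K (fst z)) (snd z)) \<in> borel_measurable (M \<Otimes>\<^sub>M \<phi>)" if "D \<in> sets borel" for D n
    by (rule discrepancy_measurable[OF that measurable_compose[OF measurable_fst Lm(2)] measurable_compose[OF measurable_fst Km(2)]])
      measurable
  have im: "(\<lambda>y. \<integral>\<^sup>+\<omega>. discrepancy D (L n \<omega>) (K \<omega>) y \<partial>M) \<in> borel_measurable \<phi>" if "D \<in> sets borel" for D n
    using measurable_compose[OF measurable_pair_swap' dm[OF that, of n]]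
    by (intro borel_measurable_nn_integral) (simp add: split_beta')
  have wm[measurable]: "?w \<in> borel_measurable \<phi>"
    by (rule weight_measurable) (use initial_law_in_prob_algebra in auto)
  have lim: "(\<lambda>n. \<integral>\<^sup>+y. (\<integral>\<^sup>+\<omega>. discrepancy D (L n \<omega>) (K \<omega>) y \<partial>M) \<partial>\<phi>) \<longlonglongrightarrow> (\<integral>\<^sup>+y. 0 \<partial>\<phi>)" if D: "D \<in> sets borel" for D
  proof (rule nn_integral_dominated_convergence)
    show "AE y in \<phi>. (\<integral>\<^sup>+\<omega>. discrepancy D (L n \<omega>) (K \<omega>) y \<partial>M) \<le> 2 * ?w y" for n
      by (intro AE_I2 discrepancy_le[OF D])
    have "(\<integral>\<^sup>+y. 2 * ?w y \<partial>\<phi>) = 2 * (\<integral>\<^sup>+y. ?w y \<partial>\<phi>)" by (rule nn_integral_cmult) measurable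
    then show "(\<integral>\<^sup>+y. 2 * ?w y \<partial>\<phi>) < \<infinity>" using weight_total[OF initial_law_in_prob_algebra] by (simp add: ennreal_mult_less_top)
    show "AE y in \<phi>. (\<lambda>n. \<integral>\<^sup>+\<omega>. discrepancy D (L n \<omega>) (K \<omega>) y \<partial>M) \<longlonglongrightarrow> 0"
      using weight_finite[OF initial_law_in_prob_algebra] by eventually_elim (rule discrepancy_tendsto[OF D])
    show "(\<lambda>y. \<integral>\<^sup>+\<omega>. discrepancy D (L n \<omega>) (K \<omega>) y \<partial>M) \<in> borel_measurable \<phi>" for n
      by (rule im[OF D])
  qed measurable
  have bound: "(\<integral>\<^sup>+\<omega>. ennreal \<bar>measure (update (L n \<omega>) (Y1 \<omega>)) C - measure (update (K \<omega>) (Y1 \<omega>)) C\<bar> \<partial>M)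
     \<le> (\<integral>\<^sup>+y. (\<integral>\<^sup>+\<omega>. discrepancy C (L n \<omega>) (K \<omega>) y \<partial>M) \<partial>\<phi>) + (\<integral>\<^sup>+y. (\<integral>\<^sup>+\<omega>. discrepancy UNIV (L n \<omega>) (K \<omega>) y \<partial>M) \<partial>\<phi>)" for n
  proof -
    define F where "F = (\<lambda>z. ennreal \<bar>measure (update (L n (fst z)) (snd z)) C - measure (update (K (fst z)) (snd z)) C\<bar>)"
    \<comment> \<open>\<open>K\<close> is measurable for the intersection and hence for
      \<open>A n\<close>, so the conditional density of the observation given \<open>A n\<close>
      applies to an integrand that contains both \<open>L n\<close> and \<open>K\<close>.\<close>
    have KA: "K \<in> A n \<rightarrow>\<^sub>M prob_algebra borel" by (rule measurable_from_subalg[OF intersection_subalgebra(1) Km(1)])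
    have [measurable]: "(\<lambda>z. update (L n (fst z)) (snd z)) \<in> A n \<Otimes>\<^sub>M borel \<rightarrow>\<^sub>M prob_algebra borel"
      "(\<lambda>z. update (K (fst z)) (snd z)) \<in> A n \<Otimes>\<^sub>M borel \<rightarrow>\<^sub>M prob_algebra borel"
      by (rule update_measurable[OF measurable_compose[OF measurable_fst Lm(1)] measurable_snd],
          rule update_measurable[OF measurable_compose[OF measurable_fst KA] measurable_snd])
    have F: "F \<in> borel_measurable (A n \<Otimes>\<^sub>M borel)" unfolding F_def using C by measurable
    have "(\<integral>\<^sup>+\<omega>. F (\<omega>, Y1 \<omega>) \<partial>M) = (\<integral>\<^sup>+\<omega>. (\<integral>\<^sup>+y. weight UNIV (L n \<omega>) y * F (\<omega>, y) \<partial>\<phi>) \<partial>M)"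
      by (rule observation_nn_integral[OF A L F])
    also have "\<dots> \<le> (\<integral>\<^sup>+\<omega>. (\<integral>\<^sup>+y. discrepancy C (L n \<omega>) (K \<omega>) y + discrepancy UNIV (L n \<omega>) (K \<omega>) y \<partial>\<phi>) \<partial>M)"
    proof (rule nn_integral_mono)
      fix \<omega> assume "\<omega> \<in> space M"
      then have k: "L n \<omega> \<in> space (prob_algebra borel)" "K \<omega> \<in> space (prob_algebra borel)"
        using kernel_space[OF A L] kernel_space[OF intersection_subalgebra(2) K] by auto
      show "(\<integral>\<^sup>+y. weight UNIV (L n \<omega>) y * F (\<omega>, y) \<partial>\<phi>) \<le> (\<integral>\<^sup>+y. discrepancy C (L n \<omega>) (K \<omega>) y + discrepancy UNIV (L n \<omega>) (K \<omega>) y \<partial>\<phi>)"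
        by (rule nn_integral_mono_AE, use weight_finite[OF k(1)] weight_finite[OF k(2)] in eventually_elim)
          (simp add: F_def update_discrepancy[OF k C])
    qed
    also have "\<dots> = (\<integral>\<^sup>+y. (\<integral>\<^sup>+\<omega>. discrepancy C (L n \<omega>) (K \<omega>) y + discrepancy UNIV (L n \<omega>) (K \<omega>) y \<partial>M) \<partial>\<phi>)"
      using dm[OF C, of n] dm[of UNIV n] by (intro S.Fubini'[symmetric]) (simp add: split_beta')
    also have "\<dots> = (\<integral>\<^sup>+y. (\<integral>\<^sup>+\<omega>. discrepancy C (L n \<omega>) (K \<omega>) y \<partial>M) + (\<integral>\<^sup>+\<omega>. discrepancy UNIV (L n \<omega>) (K \<omega>) y \<partial>M) \<partial>\<phi>)"
      using C Lm(2) Km(2) by (intro nn_integral_cong nn_integral_add discrepancy_measurable) auto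
    also have "\<dots> = (\<integral>\<^sup>+y. (\<integral>\<^sup>+\<omega>. discrepancy C (L n \<omega>) (K \<omega>) y \<partial>M) \<partial>\<phi>) + (\<integral>\<^sup>+y. (\<integral>\<^sup>+\<omega>. discrepancy UNIV (L n \<omega>) (K \<omega>) y \<partial>M) \<partial>\<phi>)"
      using C by (intro nn_integral_add im) auto
    finally show ?thesis by (simp add: F_def)
  qed
  show ?thesis
  proof (rule tendsto_sandwich[OF _ _ tendsto_const])
    show "\<forall>\<^sub>F n in sequentially. (\<integral>\<^sup>+\<omega>. ennreal \<bar>measure (update (L n \<omega>) (Y1 \<omega>)) C - measure (update (K \<omega>) (Y1 \<omega>)) C\<bar> \<partial>M)
     \<le> (\<integral>\<^sup>+y. (\<integral>\<^sup>+\<omega>. discrepancy C (L n \<omega>) (K \<omega>) y \<partial>M) \<partial>\<phi>) + (\<integral>\<^sup>+y. (\<integral>\<^sup>+\<omega>. discrepancy UNIV (L n \<omega>) (K \<omega>) y \<partial>M) \<partial>\<phi>)"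
      by (intro always_eventually allI bound)
    show "(\<lambda>n. (\<integral>\<^sup>+y. (\<integral>\<^sup>+\<omega>. discrepancy C (L n \<omega>) (K \<omega>) y \<partial>M) \<partial>\<phi>) + (\<integral>\<^sup>+y. (\<integral>\<^sup>+\<omega>. discrepancy UNIV (L n \<omega>) (K \<omega>) y \<partial>M) \<partial>\<phi>)) \<longlonglongrightarrow> 0"
      using tendsto_add[OF lim[OF C] lim[of UNIV]] by simp
  qed simp
qed

end

end

text \<open>A countable generating algebra reduces the null sets, one for each Borel set
  \<open>C\<close>, to countably many.\<close>

lemma AE_kernel_eqI:
  fixes K L :: "'w \<Rightarrow> 'e::second_countable_topology measure"
  assumes K: "K \<in> M \<rightarrow>\<^sub>M prob_algebra borel" and L: "L \<in> M \<rightarrow>\<^sub>M prob_algebra borel"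
    and eq: "\<And>C. C \<in> sets borel \<Longrightarrow> AE \<omega> in M. measure (K \<omega>) C = measure (L \<omega>) C"
  shows "AE \<omega> in M. K \<omega> = L \<omega>"
proof -
  obtain \<A> :: "'e set set" where A: "countable \<A>" "\<A> \<subseteq> sets borel" "algebra UNIV \<A>"
    and gen: "sigma_sets UNIV \<A> = sets borel"
    by (rule countable_generating_algebra)
  interpret A: algebra UNIV \<A> by (rule A(3))
  have "AE \<omega> in M. \<forall>C\<in>\<A>. measure (K \<omega>) C = measure (L \<omega>) C"
    using A eq by (subst AE_ball_countable) auto
  then show ?thesis
  proof (rule AE_mp, intro AE_I2 impI)
    fix \<omega> assume "\<omega> \<in> space M" and eq: "\<forall>C\<in>\<A>. measure (K \<omega>) C = measure (L \<omega>) C"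
    then have "K \<omega> \<in> space (prob_algebra borel)" "L \<omega> \<in> space (prob_algebra borel)"
      using K L by (auto dest: measurable_space)
    then have *: "prob_space (K \<omega>)" "prob_space (L \<omega>)" "sets (K \<omega>) = sets borel" "sets (L \<omega>) = sets borel"
      by (auto simp: space_prob_algebra)
    interpret k: prob_space "K \<omega>" by (rule *)
    interpret l: prob_space "L \<omega>" by (rule *)
    show "K \<omega> = L \<omega>"
    proof (rule measure_eqI_generator_eq[where E=\<A> and \<Omega>=UNIV and A="\<lambda>_. UNIV"])
      show "Int_stable \<A>" by (rule Int_stableI) (rule A.Int)
    qed (use gen * eq A.top in \<open>auto simp: k.emeasure_eq_measure l.emeasure_eq_measure\<close>)
  qed
qed

section \<open>The filter recursion for an intersection of sigma-algebras\<close>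

context filter_step
begin

text \<open>\<open>A1'\<close> intersects after the observation has been adjoined and may exceed the
  join of \<open>A'\<close> with \<open>Y1\<close>. Still the conditional law of \<open>X1\<close>
  given \<open>A1'\<close> is the update of \<open>K\<close>: the conditional expectations given
  \<open>A1 n\<close> converge to the one given \<open>A1'\<close> by reverse martingale
  convergence, and to the update of \<open>K\<close> by the limit in Bayes' formula.\<close>

theorem filter_law_step:
  fixes A A1 :: "nat \<Rightarrow> 'w measure"
  assumes A: "\<And>n. subalgebra G0 (A n)" and mono: "\<And>m n. m \<le> n \<Longrightarrow> subalgebra (A m) (A n)"
    and A': "space A' = space M" "sets A' = (\<Inter>n. sets (A n))" and K: "regular_cond_distr M A' X0 K"
    and A1: "\<And>n. space (A1 n) = space M"
      "\<And>n. sets (A1 n) = sigma_sets (space M) {B \<inter> (Y1 -` D \<inter> space M) |B D. B \<in> sets (A n) \<and> D \<in> sets borel}"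
    and A1': "space A1' = space M" "sets A1' = (\<Inter>n. sets (A1 n))" and K1: "regular_cond_distr M A1' X1 K1"
  shows "distr M (prob_algebra borel) K1 = distr M (prob_algebra borel) K \<bind> filter_kernel P g \<phi>"
proof -
  have "\<exists>L. regular_cond_distr M (A n) X0 L" for n
    by (rule regular_cond_distr_exists[OF subalgebra_past[OF A] X0])
  then obtain L where L: "\<And>n. regular_cond_distr M (A n) X0 (L n)" by metis
  have GA': "subalgebra G0 A'" by (rule intersection_subalgebra[OF A mono A' L K])
  have MA1: "subalgebra M (A1 n)" for n
  proof -
    have "{B \<inter> (Y1 -` D \<inter> space M) |B D. B \<in> sets (A n) \<and> D \<in> sets borel} \<subseteq> sets M"
      using subalgebra_past[OF A, of n] by (auto simp: subalgebra_def intro!: sets.Int measurable_sets[OF Y1])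
    then show ?thesis unfolding subalgebra_def A1 by (simp add: sets.sigma_sets_subset)
  qed
  have mono1: "subalgebra (A1 m) (A1 n)" if "m \<le> n" for m n
    using mono[OF that] unfolding subalgebra_def A1 by (intro conjI sigma_sets_mono') auto
  have MA1': "subalgebra M A1'" using MA1[of 0] A1' unfolding subalgebra_def by auto
  note Km = regular_cond_distr_measurable(2)[OF subalgebra_past[OF GA'] K]
  note K1m = regular_cond_distr_measurable(2)[OF MA1' K1]
  note Lm = regular_cond_distr_measurable(2)[OF subalgebra_past[OF A] L]
  have um[measurable]: "(\<lambda>\<omega>. update (K \<omega>) (Y1 \<omega>)) \<in> M \<rightarrow>\<^sub>M prob_algebra borel" by (rule update_measurable[OF Km Y1])
  have uLm[measurable]: "(\<lambda>\<omega>. update (L n \<omega>) (Y1 \<omega>)) \<in> M \<rightarrow>\<^sub>M prob_algebra borel" for n by (rule update_measurable[OF Lm Y1])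
  have "AE \<omega> in M. K1 \<omega> = update (K \<omega>) (Y1 \<omega>)"
  proof (rule AE_kernel_eqI[OF K1m um])
    fix C :: "'e set" assume C[measurable]: "C \<in> sets borel"
    define V :: "'w \<Rightarrow> real" where "V \<omega> = indicator C (X1 \<omega>)" for \<omega>
    have iV: "integrable M V" unfolding V_def by (intro integrable_const_bound[of _ 1]) auto
    define U where "U \<omega> = measure (update (K \<omega>) (Y1 \<omega>)) C" for \<omega>
    define UL where "UL n \<omega> = measure (update (L n \<omega>) (Y1 \<omega>)) C" for n \<omega>
    have pu: "prob_space (update \<mu> y)" if "\<mu> \<in> space (prob_algebra borel)" for \<mu> y
      using update_in_prob_algebra[OF that] by (simp add: space_prob_algebra)
    have bU: "AE \<omega> in M. norm (U \<omega>) \<le> 1" "AE \<omega> in M. norm (UL n \<omega>) \<le> 1" for n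
      unfolding U_def UL_def
      using pu kernel_space[OF GA' K] kernel_space[OF A L] by (auto intro!: AE_I2 prob_space.prob_le_1)
    have [measurable]: "U \<in> borel_measurable M" "UL n \<in> borel_measurable M" for n
      unfolding U_def UL_def by measurable
    have iU: "integrable M U" "integrable M (UL n)" for n
      by (rule integrable_const_bound[OF bU(1)], simp, rule integrable_const_bound[OF bU(2)], simp)
    have ULn: "AE \<omega> in M. real_cond_exp M (A1 n) V \<omega> = UL n \<omega>" for n
      unfolding V_def UL_def by (rule update_is_cond_exp[OF A L A1 C])
    let ?W = "real_cond_exp M A1' V"
    have iW: "integrable M ?W" by (rule cond_exp_integrable[OF MA1' iV])
    have lim1: "(\<lambda>n. expectation (\<lambda>\<omega>. \<bar>real_cond_exp M (A1 n) V \<omega> - ?W \<omega>\<bar>)) \<longlonglongrightarrow> 0"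
      by (rule cond_exp_decreasing[OF MA1 mono1 A1' iV])
    have lim2: "(\<lambda>n. expectation (\<lambda>\<omega>. \<bar>UL n \<omega> - U \<omega>\<bar>)) \<longlonglongrightarrow> 0"
    proof -
      have "(\<integral>\<^sup>+\<omega>. ennreal \<bar>UL n \<omega> - U \<omega>\<bar> \<partial>M) = ennreal (expectation (\<lambda>\<omega>. \<bar>UL n \<omega> - U \<omega>\<bar>))" for n
        using iU by (intro nn_integral_eq_integral) auto
      then have "(\<lambda>n. ennreal (expectation (\<lambda>\<omega>. \<bar>UL n \<omega> - U \<omega>\<bar>))) \<longlonglongrightarrow> ennreal 0"
        using update_tendsto[OF A mono A' L K C] by (simp add: UL_def U_def)
      then show ?thesis by (subst (asm) tendsto_ennreal_iff) auto
    qed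
    \<comment> \<open>Triangle inequality through a common middle term, as the conditional
      expectation given \<open>A1 n\<close> is almost surely \<open>UL n\<close>.\<close>
    have "expectation (\<lambda>\<omega>. \<bar>?W \<omega> - U \<omega>\<bar>) \<le> expectation (\<lambda>\<omega>. \<bar>real_cond_exp M (A1 n) V \<omega> - ?W \<omega>\<bar>) + expectation (\<lambda>\<omega>. \<bar>UL n \<omega> - U \<omega>\<bar>)" for n
    proof -
      have "expectation (\<lambda>\<omega>. \<bar>?W \<omega> - U \<omega>\<bar>) \<le> expectation (\<lambda>\<omega>. \<bar>real_cond_exp M (A1 n) V \<omega> - ?W \<omega>\<bar> + \<bar>UL n \<omega> - U \<omega>\<bar>)"
      proof (rule integral_mono_AE)
        show "AE \<omega> in M. \<bar>?W \<omega> - U \<omega>\<bar> \<le> \<bar>real_cond_exp M (A1 n) V \<omega> - ?W \<omega>\<bar> + \<bar>UL n \<omega> - U \<omega>\<bar>"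
          using ULn[of n] by eventually_elim simp
      qed (use iU iW cond_exp_integrable[OF MA1 iV] in auto)
      also have "\<dots> = expectation (\<lambda>\<omega>. \<bar>real_cond_exp M (A1 n) V \<omega> - ?W \<omega>\<bar>) + expectation (\<lambda>\<omega>. \<bar>UL n \<omega> - U \<omega>\<bar>)"
        using iU iW cond_exp_integrable[OF MA1 iV] by (intro Bochner_Integration.integral_add) auto
      finally show ?thesis .
    qed
    then have "expectation (\<lambda>\<omega>. \<bar>?W \<omega> - U \<omega>\<bar>) \<le> 0 + 0"
      by (intro LIMSEQ_le_const[OF tendsto_add[OF lim1 lim2]]) auto
    then have "expectation (\<lambda>\<omega>. \<bar>?W \<omega> - U \<omega>\<bar>) = 0" by (simp add: integral_nonneg_AE order_antisym)
    then have "AE \<omega> in M. \<bar>?W \<omega> - U \<omega>\<bar> = 0"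
      using iU(1) iW by (subst (asm) integral_nonneg_eq_0_iff_AE) auto
    moreover have "AE \<omega> in M. ?W \<omega> = measure (K1 \<omega>) C"
      using K1 C unfolding regular_cond_distr_def V_def by blast
    ultimately show "AE \<omega> in M. measure (K1 \<omega>) C = measure (update (K \<omega>) (Y1 \<omega>)) C"
      by eventually_elim (simp add: U_def)
  qed
  then have "distr M (prob_algebra borel) K1 = distr M (prob_algebra borel) (\<lambda>\<omega>. update (K \<omega>) (Y1 \<omega>))"
    using K1m by (intro distr_cong_AE) auto
  also have "\<dots> = distr M (prob_algebra borel) K \<bind> filter_kernel P g \<phi>"
    by (rule update_law[OF GA' K])
  finally show ?thesis .
qed

end

section \<open>Sigma-algebras on path space\<close>

definition history_gens :: "int set \<Rightarrow> int set \<Rightarrow> (int \<Rightarrow> 'e::topological_space \<times> 'f::topological_space) set set"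
  where "history_gens I J = {(\<lambda>z. fst (z i)) -` A |i A. i \<in> I \<and> A \<in> sets borel}
    \<union> {(\<lambda>z. snd (z j)) -` B |j B. j \<in> J \<and> B \<in> sets borel}"

text \<open>Separate index sets let the signal be known with a delay, or not at all when
  \<open>I\<close> is empty, while the observations are complete.\<close>

definition history :: "int set \<Rightarrow> int set \<Rightarrow> (int \<Rightarrow> 'e::topological_space \<times> 'f::topological_space) measure"
  where "history I J = sigma UNIV (history_gens I J)"

definition shift_by :: "int \<Rightarrow> (int \<Rightarrow> 's) \<Rightarrow> int \<Rightarrow> 's"
  where "shift_by k z = (\<lambda>i. z (i + k))"

lemma space_history[simp]: "space (history I J) = UNIV"
  by (simp add: history_def space_measure_of_conv)

lemma sets_history: "sets (history I J) = sigma_sets UNIV (history_gens I J)"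
  by (simp add: history_def sets_measure_of)

lemma history_mono: "I \<subseteq> I' \<Longrightarrow> J \<subseteq> J' \<Longrightarrow> subalgebra (history I' J') (history I J)"
  unfolding subalgebra_def sets_history
  by (intro conjI sigma_sets_mono') (auto simp: history_gens_def)

lemma measurable_history_fst: "i \<in> I \<Longrightarrow> (\<lambda>z. fst (z i)) \<in> borel_measurable (history I J)"
  by (rule measurableI) (auto simp: sets_history history_gens_def intro!: sigma_sets.Basic)

lemma measurable_history_snd: "j \<in> J \<Longrightarrow> (\<lambda>z. snd (z j)) \<in> borel_measurable (history I J)"
  by (rule measurableI) (auto simp: sets_history history_gens_def intro!: sigma_sets.Basic)

lemma measurable_into_history:
  fixes T :: "'w \<Rightarrow> int \<Rightarrow> 'e::topological_space \<times> 'f::topological_space"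
  assumes "\<And>i. i \<in> I \<Longrightarrow> (\<lambda>\<omega>. fst (T \<omega> i)) \<in> borel_measurable N"
    and "\<And>j. j \<in> J \<Longrightarrow> (\<lambda>\<omega>. snd (T \<omega> j)) \<in> borel_measurable N"
  shows "T \<in> N \<rightarrow>\<^sub>M history I J"
  unfolding history_def
proof (rule measurable_measure_of)
  fix Z :: "(int \<Rightarrow> 'e \<times> 'f) set" assume "Z \<in> history_gens I J"
  then consider i A where "i \<in> I" "A \<in> sets borel" "Z = (\<lambda>z. fst (z i)) -` A"
    | j B where "j \<in> J" "B \<in> sets borel" "Z = (\<lambda>z. snd (z j)) -` B"
    unfolding history_gens_def by blast
  then show "T -` Z \<inter> space N \<in> sets N"
  proof cases
    case 1
    have "T -` Z \<inter> space N = (\<lambda>\<omega>. fst (T \<omega> i)) -` A \<inter> space N" unfolding 1 by auto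
    then show ?thesis using measurable_sets[OF assms(1)[OF 1(1)] 1(2)] by simp
  next
    case 2
    have "T -` Z \<inter> space N = (\<lambda>\<omega>. snd (T \<omega> j)) -` B \<inter> space N" unfolding 2 by auto
    then show ?thesis using measurable_sets[OF assms(2)[OF 2(1)] 2(2)] by simp
  qed
qed auto

text \<open>Preimages commute with the generation of sigma-algebras, and the shift carries a
  generator at time \<open>i\<close> to one at time \<open>i + k\<close>.\<close>

lemma shift_history:
  "sets (history ((\<lambda>i. i + k) ` I) ((\<lambda>i. i + k) ` J) :: (int \<Rightarrow> 'e::topological_space \<times> 'f::topological_space) measure)
    = (\<lambda>A. shift_by k -` A) ` sets (history I J)"
proof -
  let ?g = "history_gens I J :: (int \<Rightarrow> 'e \<times> 'f) set set"
  have "(\<lambda>A. shift_by k -` A) ` sigma_sets UNIV ?g = sigma_sets UNIV ((\<lambda>A. shift_by k -` A) ` ?g)"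
    using sigma_sets_vimage_commute[of "shift_by k :: (int \<Rightarrow> 'e \<times> 'f) \<Rightarrow> _" UNIV UNIV ?g]
    by (simp add: image_def Setcompr_eq_image)
  also have "(\<lambda>A. shift_by k -` A) ` ?g = history_gens ((\<lambda>i. i + k) ` I) ((\<lambda>i. i + k) ` J)"
  proof -
    have 1: "shift_by k -` ((\<lambda>z. fst (z i)) -` A) = (\<lambda>z. fst (z (i + k))) -` A"
      and 2: "shift_by k -` ((\<lambda>z. snd (z i)) -` B) = (\<lambda>z. snd (z (i + k))) -` B"
      for i and A :: "'e set" and B :: "'f set"
      by (auto simp: shift_by_def)
    show ?thesis
    proof (intro equalityI subsetI)
      fix Z assume "Z \<in> (\<lambda>A. shift_by k -` A) ` ?g"
      then obtain W where W: "W \<in> ?g" and Z: "Z = shift_by k -` W" by (rule imageE)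
      from W consider i A where "i \<in> I" "A \<in> sets borel" "W = (\<lambda>z. fst (z i)) -` A"
        | j B where "j \<in> J" "B \<in> sets borel" "W = (\<lambda>z. snd (z j)) -` B"
        unfolding history_gens_def by blast
      then show "Z \<in> history_gens ((\<lambda>i. i + k) ` I) ((\<lambda>i. i + k) ` J)"
      proof cases
        case a: 1
        then have "i + k \<in> (\<lambda>i. i + k) ` I" by simp
        with a(2) show ?thesis unfolding Z a(3) 1 history_gens_def by blast
      next
        case a: 2
        then have "j + k \<in> (\<lambda>i. i + k) ` J" by simp
        with a(2) show ?thesis unfolding Z a(3) 2 history_gens_def by blast
      qed
    next
      fix Z :: "(int \<Rightarrow> 'e \<times> 'f) set" assume "Z \<in> history_gens ((\<lambda>i. i + k) ` I) ((\<lambda>i. i + k) ` J)"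
      then consider i A where "i \<in> I" "A \<in> sets borel" "Z = (\<lambda>z. fst (z (i + k))) -` A"
        | j B where "j \<in> J" "B \<in> sets borel" "Z = (\<lambda>z. snd (z (j + k))) -` B"
        unfolding history_gens_def by blast
      then show "Z \<in> (\<lambda>A. shift_by k -` A) ` ?g"
      proof cases
        case a: 1
        then have "(\<lambda>z. fst (z i)) -` A \<in> ?g" unfolding history_gens_def by blast
        then show ?thesis unfolding a(3) 1[of i A, symmetric] by (rule imageI)
      next
        case a: 2
        then have "(\<lambda>z. snd (z j)) -` B \<in> ?g" unfolding history_gens_def by blast
        then show ?thesis unfolding a(3) 2[of j B, symmetric] by (rule imageI)
      qed
    qed
  qed
  finally show ?thesis unfolding sets_history by simp
qed

text \<open>Brings an adjoined observation into the pi-system form in which Bayes' formula is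
  proved.\<close>

lemma history_insert_observation:
  "sets (history I (insert j J) :: (int \<Rightarrow> 'e::topological_space \<times> 'f::topological_space) measure)
    = sigma_sets UNIV {B \<inter> ((\<lambda>z. snd (z j)) -` D \<inter> UNIV) |B D. B \<in> sets (history I J) \<and> D \<in> sets borel}"
    (is "_ = sigma_sets UNIV ?E")
proof
  have EI: "B \<inter> (\<lambda>z. snd (z j)) -` D \<in> ?E" if "B \<in> sets (history I J)" "D \<in> sets borel" for B D
    using that by auto
  show "sets (history I (insert j J)) \<subseteq> sigma_sets UNIV ?E"
    unfolding sets_history
  proof (rule sigma_sets_mono, rule subsetI)
    fix Z :: "(int \<Rightarrow> 'e \<times> 'f) set" assume "Z \<in> history_gens I (insert j J)"
    then consider "Z \<in> history_gens I J" | D where "D \<in> sets borel" "Z = (\<lambda>z. snd (z j)) -` D"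
      unfolding history_gens_def by blast
    then show "Z \<in> sigma_sets UNIV {B \<inter> ((\<lambda>z. snd (z j)) -` D \<inter> UNIV) |B D. B \<in> sigma_sets UNIV (history_gens I J) \<and> D \<in> sets borel}"
    proof cases
      case 1
      then have "Z \<in> sets (history I J)" unfolding sets_history by (rule sigma_sets.Basic)
      from EI[OF this, of UNIV] have "Z \<in> ?E" by simp
      then show ?thesis unfolding sets_history by (rule sigma_sets.Basic)
    next
      case 2
      have "UNIV \<in> sets (history I J :: (int \<Rightarrow> 'e \<times> 'f) measure)" using sets.top[of "history I J"] by simp
      from EI[OF this 2(1)] have "Z \<in> ?E" unfolding 2(2) by simp
      then show ?thesis unfolding sets_history by (rule sigma_sets.Basic)
    qed
  qed
  have "?E \<subseteq> sets (history I (insert j J))"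
  proof
    fix Z assume "Z \<in> ?E"
    then obtain B D where Z: "Z = B \<inter> (\<lambda>z. snd (z j)) -` D" "B \<in> sets (history I J)" "D \<in> sets borel" by auto
    have "B \<in> sets (history I (insert j J))"
      using Z(2) history_mono[of I I J "insert j J"] by (auto simp: subalgebra_def)
    moreover have "(\<lambda>z. snd (z j)) -` D \<in> sets (history I (insert j J) :: (int \<Rightarrow> 'e \<times> 'f) measure)"
      using measurable_sets[OF measurable_history_snd[of j "insert j J" I] Z(3)] by simp
    ultimately show "Z \<in> sets (history I (insert j J))" unfolding Z(1) by (rule sets.Int)
  qed
  then show "sigma_sets UNIV ?E \<subseteq> sets (history I (insert j J))"
    using sets.sigma_sets_subset[of ?E "history I (insert j J)"] by simp
qed

lemma history_observations_union:
  assumes "(\<Union>n. J n) = J'"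
  shows "sets (history I J' :: (int \<Rightarrow> 'e::topological_space \<times> 'f::topological_space) measure)
    = sigma_sets UNIV (\<Union>n. sets (history I (J n)))" (is "_ = sigma_sets UNIV ?E")
proof
  show "sets (history I J') \<subseteq> sigma_sets UNIV ?E"
    unfolding sets_history
  proof (rule sigma_sets_mono, rule subsetI)
    fix Z :: "(int \<Rightarrow> 'e \<times> 'f) set" assume "Z \<in> history_gens I J'"
    then have "\<exists>n. Z \<in> history_gens I (J n)"
      using assms unfolding history_gens_def by blast
    then show "Z \<in> sigma_sets UNIV (\<Union>n. sigma_sets UNIV (history_gens I (J n)))"
      by (auto intro!: sigma_sets.Basic)
  qed
  have "?E \<subseteq> sets (history I J')"
    using history_mono[of I I "J n" J' for n] assms by (fastforce simp: subalgebra_def)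
  then show "sigma_sets UNIV ?E \<subseteq> sets (history I J')"
    using sets.sigma_sets_subset[of ?E "history I J'"] by simp
qed

section \<open>The stationary model on path space\<close>

lemma (in prob_space) regular_cond_distr_cond_exp_bounded:
  fixes V :: "'a \<Rightarrow> 'e::topological_space"
  assumes G: "subalgebra M G" and V[measurable]: "V \<in> borel_measurable M" and K: "regular_cond_distr M G V K"
    and f[measurable]: "f \<in> borel_measurable borel" and b: "\<And>x. \<bar>f x\<bar> \<le> C"
  shows "AE \<omega> in M. real_cond_exp M G (\<lambda>\<omega>. f (V \<omega>)) \<omega> = (\<integral>x. f x \<partial>K \<omega>)"
proof -
  interpret finite_measure_subalgebra M G by (rule finite_measure_subalgebraI[OF G])
  note Km = regular_cond_distr_measurable(2)[OF G K]
  \<comment> \<open>Adding the bound \<open>C\<close> makes the function nonnegative, so the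
    extended nonnegative version applies; the constant is removed at the end.\<close>
  define h where "h x = ennreal (f x + C)" for x
  have h[measurable]: "h \<in> borel_measurable borel" unfolding h_def by measurable
  have fC: "0 \<le> f x + C" for x using b[of x] by (simp add: abs_le_iff)
  have i1: "integrable M (\<lambda>\<omega>. f (V \<omega>))" using b by (intro integrable_const_bound[of _ C]) auto
  have "(\<integral>\<^sup>+\<omega>. h (V \<omega>) \<partial>M) = ennreal (\<integral>\<omega>. f (V \<omega>) + C \<partial>M)"
    unfolding h_def using i1 fC by (intro nn_integral_eq_integral) auto
  then have "(\<integral>\<^sup>+\<omega>. h (V \<omega>) \<partial>M) < \<infinity>" by simp
  from regular_cond_distr_cond_exp(3)[OF G V K h this]
  have "AE \<omega> in M. real_cond_exp M G (\<lambda>\<omega>. f (V \<omega>) + C) \<omega> = enn2real (\<integral>\<^sup>+x. h x \<partial>K \<omega>)"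
    using fC by (simp add: h_def)
  moreover have "AE \<omega> in M. real_cond_exp M G (\<lambda>\<omega>. f (V \<omega>) + C) \<omega> = real_cond_exp M G (\<lambda>\<omega>. f (V \<omega>)) \<omega> + real_cond_exp M G (\<lambda>\<omega>. C) \<omega>"
    by (rule real_cond_exp_add[OF i1]) simp
  moreover have "AE \<omega> in M. real_cond_exp M G (\<lambda>\<omega>. C) \<omega> = C" by (rule real_cond_exp_F_meas) auto
  moreover have "AE \<omega> in M. enn2real (\<integral>\<^sup>+x. h x \<partial>K \<omega>) = (\<integral>x. f x \<partial>K \<omega>) + C"
  proof (rule AE_I2)
    fix \<omega> assume that: "\<omega> \<in> space M"
    have s: "sets (K \<omega>) = sets borel" and "prob_space (K \<omega>)"
      using measurable_space[OF Km that] by (auto simp: space_prob_algebra)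
    then interpret k: prob_space "K \<omega>" by simp
    have fm: "f \<in> borel_measurable (K \<omega>)" using f by (simp add: measurable_cong_sets[OF s refl])
    have i: "integrable (K \<omega>) f" by (rule k.integrable_const_bound[of _ C]) (use b fm in auto)
    have "(\<integral>\<^sup>+x. h x \<partial>K \<omega>) = ennreal (\<integral>x. f x + C \<partial>K \<omega>)"
      unfolding h_def using i fC by (intro nn_integral_eq_integral) auto
    moreover have "0 \<le> (\<integral>x. f x + C \<partial>K \<omega>)" using fC by (intro integral_nonneg_AE) auto
    ultimately show "enn2real (\<integral>\<^sup>+x. h x \<partial>K \<omega>) = (\<integral>x. f x \<partial>K \<omega>) + C" using i by (simp add: k.prob_space)
  qed
  ultimately show ?thesis by eventually_elim simp
qed

text \<open>An intersection of sigma-algebras already is one; \<open>sigma\<close> merely packages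
  it as a \<open>measure\<close> to which conditional expectations can refer.\<close>

lemma sets_inter_sigma:
  fixes A :: "nat \<Rightarrow> 'a measure"
  assumes "\<And>n. space (A n) = S"
  shows "sets (sigma S (\<Inter>n. sets (A n))) = (\<Inter>n. sets (A n))"
proof -
  have "(\<Inter>n. sets (A n)) \<subseteq> sets (A 0)" by blast
  also have "\<dots> \<subseteq> Pow S" using sets.space_closed[of "A 0"] assms[of 0] by simp
  finally have "(\<Inter>n. sets (A n)) \<subseteq> Pow S" .
  moreover have "sigma_sets S (\<Inter>n. sets (A n)) = (\<Inter>n. sets (A n))"
  proof
    show "sigma_sets S (\<Inter>n. sets (A n)) \<subseteq> (\<Inter>n. sets (A n))"
      using sets.sigma_sets_subset[of "\<Inter>n. sets (A n)" "A m" for m] assms by (intro INT_greatest) auto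
  qed auto
  ultimately show ?thesis by (simp add: sets_measure_of)
qed

text \<open>The law of the pair process on two-sided paths, where the time shift is an actual
  measure-preserving map. The Markov property is recorded for the step from time 0 to time 1, whose
  effect is compared with that of the shift.\<close>

locale stationary_filter_model = prob_space Q
  for Q :: "(int \<Rightarrow> 'e::polish_space \<times> 'f::polish_space) measure" +
  fixes P :: "'e \<Rightarrow> 'e measure" and g :: "'e \<Rightarrow> 'f \<Rightarrow> real" and \<phi> :: "'f measure"
  assumes sets_Q[measurable_cong]: "sets Q = sets (PiM UNIV (\<lambda>_. borel))"
    and shift_Q: "distr Q Q shift = Q"
    and kernel: "P \<in> borel \<rightarrow>\<^sub>M prob_algebra borel"
    and ref_sets: "sets \<phi> = sets borel" and ref_sigma_finite: "sigma_finite_measure \<phi>"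
    and density_measurable: "(\<lambda>(x, y). g x y) \<in> borel_measurable borel"
    and density_norm: "\<And>x. (\<integral>\<^sup>+y. ennreal (g x y) \<partial>\<phi>) = 1"
    and markov_step: "\<And>B C D. B \<in> sets (history {..0} {..0}) \<Longrightarrow> C \<in> sets borel \<Longrightarrow> D \<in> sets borel \<Longrightarrow>
      (\<integral>\<^sup>+z. indicator B z * indicator C (fst (z 1)) * indicator D (snd (z 1)) \<partial>Q)
      = (\<integral>\<^sup>+z. indicator B z * (\<integral>\<^sup>+x. indicator C x * (\<integral>\<^sup>+y. indicator D y * ennreal (g x y) \<partial>\<phi>) \<partial>P (fst (z 0))) \<partial>Q)"
    and unique: "uniquely_ergodic (prob_algebra borel) (filter_kernel P g \<phi>)"
begin

section \<open>Shift invariance and invariant laws of conditional distributions\<close>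

lemma space_Q: "space Q = UNIV"
  using sets_eq_imp_space_eq[OF sets_Q] by (simp add: space_PiM)

lemma coordinate_measurable[measurable]: "(\<lambda>z. z i) \<in> Q \<rightarrow>\<^sub>M borel"
  using measurable_component_singleton[of i UNIV "\<lambda>_. borel"] measurable_cong_sets[OF sets_Q refl] by blast

lemma fst_measurable[measurable]: "(\<lambda>z. fst (z i)) \<in> borel_measurable Q"
  and snd_measurable[measurable]: "(\<lambda>z. snd (z i)) \<in> borel_measurable Q"
  using coordinate_measurable[of i] by (auto simp: borel_prod[symmetric])

lemma history_subalgebra: "subalgebra Q (history I J)"
proof -
  have "(\<lambda>z. z) \<in> Q \<rightarrow>\<^sub>M history I J" by (rule measurable_into_history) measurable
  then have "Z \<in> sets Q" if "Z \<in> sets (history I J)" for Z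
    using measurable_sets[of "\<lambda>z. z" Q "history I J" Z] that space_Q by simp
  then show ?thesis by (auto simp: subalgebra_def space_Q)
qed

sublocale filter_step Q "history {..0} {..0}" "\<lambda>z. fst (z 0)" "\<lambda>z. fst (z 1)" "\<lambda>z. snd (z 1)" P g \<phi>
proof unfold_locales
  show "subalgebra Q (history {..0} {..0})" by (rule history_subalgebra)
  show "P \<in> borel \<rightarrow>\<^sub>M prob_algebra borel" by (rule kernel)
  show "sets \<phi> = sets borel" by (rule ref_sets)
  show "\<exists>A. countable A \<and> A \<subseteq> sets \<phi> \<and> \<Union> A = space \<phi> \<and> (\<forall>a\<in>A. emeasure \<phi> a \<noteq> \<infinity>)"
    using ref_sigma_finite by (rule sigma_finite_measure.sigma_finite_countable)
  show "(\<lambda>(x, y). g x y) \<in> borel_measurable borel" by (rule density_measurable)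
  show "(\<integral>\<^sup>+y. ennreal (g x y) \<partial>\<phi>) = 1" for x by (rule density_norm)
qed (rule markov_step fst_measurable snd_measurable; assumption?)+

lemma shift_eq: "shift = (shift_by 1 :: (int \<Rightarrow> 'e \<times> 'f) \<Rightarrow> _)"
  by (simp add: fun_eq_iff shift_def shift_by_def)

lemma shift_comp_shift_by: "shift \<circ> shift_by (int k) = (shift_by (int (Suc k)) :: (int \<Rightarrow> 'e \<times> 'f) \<Rightarrow> _)"
proof (intro ext)
  fix z :: "int \<Rightarrow> 'e \<times> 'f" and i
  have "i + 1 + int k = i + int (Suc k)" by simp
  then show "(shift \<circ> shift_by (int k)) z i = shift_by (int (Suc k)) z i"
    unfolding comp_def shift_def shift_by_def by (rule arg_cong)
qed

lemma shift_by_0: "shift_by (int 0) = (\<lambda>z. z)"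
  unfolding shift_by_def of_nat_0 add_0_right ..

lemma shift_pow: "(shift ^^ k) = (shift_by (int k) :: (int \<Rightarrow> 'e \<times> 'f) \<Rightarrow> _)"
proof (induction k)
  case (Suc k)
  then show ?case unfolding funpow.simps(2) by (simp only: shift_comp_shift_by)
qed (simp only: funpow.simps(1) shift_by_0 id_def)

lemma shift_by_measurable[measurable]: "shift_by k \<in> Q \<rightarrow>\<^sub>M Q"
proof -
  have "shift_by k \<in> Q \<rightarrow>\<^sub>M PiM UNIV (\<lambda>_. borel)"
    unfolding shift_by_def[abs_def] by (rule measurable_PiM_single') (auto simp: space_Q)
  then show ?thesis using measurable_cong_sets[OF refl sets_Q] by blast
qed

lemma shift_by_Q: "distr Q Q (shift_by (int k)) = Q"
proof (induction k)
  case 0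
  show ?case unfolding shift_by_0 by (rule distr_id)
next
  case (Suc k)
  have [measurable]: "shift \<in> Q \<rightarrow>\<^sub>M Q" unfolding shift_eq by measurable
  have "distr Q Q (shift_by (int (Suc k))) = distr (distr Q Q (shift_by (int k))) Q shift"
    unfolding shift_comp_shift_by[symmetric] by (rule distr_distr[symmetric]) measurable
  then show ?case unfolding Suc shift_Q .
qed

lemma cond_exp_shift:
  assumes V: "integrable Q V"
    and I': "I' = (\<lambda>i. i + int k) ` I" and J': "J' = (\<lambda>i. i + int k) ` J"
  shows "AE z in Q. real_cond_exp Q (history I' J') (\<lambda>z. V (shift_by (int k) z)) z
    = real_cond_exp Q (history I J) V (shift_by (int k) z)"
proof (rule real_cond_exp_distr[OF prob_space_axioms shift_by_measurable shift_by_Q history_subalgebra _ _ V])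
  show "sets (history I' J') = (\<lambda>A. shift_by (int k) -` A \<inter> space Q) ` sets (history I J)"
    unfolding I' J' space_Q Int_UNIV_right by (rule shift_history)
qed (simp add: space_Q)

text \<open>\<open>K\<close> composed with the shift is the conditional distribution of the state at
  time 1 given the shifted information, and it has the same law as \<open>K\<close>. By
  \<open>inter\<close> this information is also obtained by adjoining the observation at time 1 and
  intersecting, so the filter recursion expresses the same law as one step of the filter
  kernel.\<close>

lemma invariant_filter_law:
  fixes I :: "nat \<Rightarrow> int set"
  assumes I: "\<And>n. I n \<subseteq> {..0}" "\<And>m n. m \<le> n \<Longrightarrow> I n \<subseteq> I m"
    and inter: "(\<Inter>n. sets (history (I n) {..1} :: (int \<Rightarrow> 'e \<times> 'f) measure)) = (\<Inter>n. sets (history ((\<lambda>i. i + 1) ` I n) {..1}))"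
    and A': "space A' = UNIV" "sets A' = (\<Inter>n. sets (history (I n) {..0}))"
    and K: "regular_cond_distr Q A' (\<lambda>z. fst (z 0)) K"
  shows "invariant_prob (prob_algebra borel) (filter_kernel P g \<phi>) (distr Q (prob_algebra borel) K)"
proof -
  define A1 where "A1 n = (history (I n) {..1} :: (int \<Rightarrow> 'e \<times> 'f) measure)" for n
  define A1' where "A1' = sigma UNIV (\<Inter>n. sets (A1 n))"
  have A1': "space A1' = space Q" "sets A1' = (\<Inter>n. sets (A1 n))"
    unfolding A1'_def using sets_inter_sigma[of A1 UNIV] by (simp_all add: A1_def space_Q space_measure_of_conv del: sets_measure_of_conv)
  have QA': "subalgebra Q A'" using A' history_subalgebra[of "I 0" "{..0}"] by (auto simp: subalgebra_def space_Q)
  note Km[measurable] = regular_cond_distr_measurable(2)[OF QA' K]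
  have shift_m[measurable]: "shift \<in> Q \<rightarrow>\<^sub>M Q" unfolding shift_eq by measurable
  \<comment> \<open>Taking preimages under the shift is injective because the shift is onto. This
    lets the image commute with the intersection below.\<close>
  have inj: "inj (\<lambda>B. shift -` B :: (int \<Rightarrow> 'e \<times> 'f) set)"
  proof (rule injI)
    fix B B' :: "(int \<Rightarrow> 'e \<times> 'f) set" assume eq: "shift -` B = shift -` B'"
    have s: "shift (shift_by (-1) z) = z" for z :: "int \<Rightarrow> 'e \<times> 'f" by (simp add: shift_def shift_by_def fun_eq_iff)
    show "B = B'"
    proof (rule set_eqI)
      fix z
      have "z \<in> B \<longleftrightarrow> shift_by (-1) z \<in> shift -` B" by (simp add: s)
      also have "\<dots> \<longleftrightarrow> z \<in> B'" unfolding eq by (simp add: s)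
      finally show "z \<in> B \<longleftrightarrow> z \<in> B'" .
    qed
  qed
  have im: "(\<lambda>i. i + 1) ` {..0} = {..1 :: int}"
    by (auto simp: image_iff intro!: bexI[of _ "_ - 1"])
  have A1'_im: "sets A1' = (\<lambda>B. shift -` B \<inter> space Q) ` sets A'"
  proof -
    have "sets A1' = (\<Inter>n. (\<lambda>B. shift -` B) ` sets (history (I n) {..0}))"
    proof -
      have "sets (history ((\<lambda>i. i + 1) ` I n) {..1} :: (int \<Rightarrow> 'e \<times> 'f) measure) = (\<lambda>B. shift -` B) ` sets (history (I n) {..0})" for n
        unfolding im[symmetric] shift_eq by (rule shift_history)
      then show ?thesis unfolding A1'(2) A1_def inter by simp
    qed
    also have "\<dots> = (\<lambda>B. shift -` B) ` (\<Inter>n. sets (history (I n) {..0}))"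
      by (rule image_INT[of _ UNIV UNIV _ 0, symmetric]) (use inj in auto)
    finally show ?thesis by (simp add: A' space_Q)
  qed
  define K1 where "K1 z = K (shift z)" for z
  have QA1': "subalgebra Q A1'" using A1' history_subalgebra[of "I 0" "{..1}"] by (auto simp: A1_def subalgebra_def space_Q)
  have K1: "regular_cond_distr Q A1' (\<lambda>z. fst (z 1)) K1"
    unfolding regular_cond_distr_def
  proof (intro conjI ballI)
    have "shift \<in> A1' \<rightarrow>\<^sub>M A'"
      by (rule measurableI) (auto simp: A1'_im A1'(1) A'(1) space_Q)
    then show "K1 \<in> A1' \<rightarrow>\<^sub>M prob_algebra borel"
      unfolding K1_def by (rule measurable_compose) (rule regular_cond_distr_measurable(1)[OF QA' K])
    fix C :: "'e set" assume C[measurable]: "C \<in> sets borel"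
    have "AE z in Q. real_cond_exp Q A1' (\<lambda>z. indicator C (fst (shift z 0))) z
        = real_cond_exp Q A' (\<lambda>z. indicator C (fst (z 0))) (shift z)"
    proof (rule real_cond_exp_distr[OF prob_space_axioms shift_m shift_Q QA' A1'(1) A1'_im])
      show "integrable Q (\<lambda>z. indicator C (fst (z 0)) :: real)" by (intro integrable_const_bound[of _ 1]) auto
    qed
    moreover have "AE z in Q. real_cond_exp Q A' (\<lambda>z. indicator C (fst (z 0))) (shift z) = measure (K (shift z)) C"
    proof -
      have "AE z in distr Q Q shift. real_cond_exp Q A' (\<lambda>z. indicator C (fst (z 0))) z = measure (K z) C"
        unfolding shift_Q using K C unfolding regular_cond_distr_def by blast
      then show ?thesis by (subst (asm) AE_distr_iff) measurable
    qed
    ultimately show "AE z in Q. real_cond_exp Q A1' (\<lambda>z. indicator C (fst (z 1))) z = measure (K1 z) C"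
      by eventually_elim (simp add: K1_def shift_def)
  qed
  have step: "distr Q (prob_algebra borel) K1 = distr Q (prob_algebra borel) K \<bind> filter_kernel P g \<phi>"
  proof (rule filter_law_step[where A="\<lambda>n. history (I n) {..0}" and ?A1.0=A1, OF _ _ _ _ K _ _ A1' K1])
    show "subalgebra (history {..0} {..0}) (history (I n) {..0})" for n
      by (rule history_mono[OF I(1)]) simp
    show "subalgebra (history (I m) {..0}) (history (I n) {..0})" if "m \<le> n" for m n
      by (rule history_mono[OF I(2)[OF that]]) simp
    have "{..1 :: int} = insert 1 {..0}" by auto
    then show "sets (A1 n) = sigma_sets (space Q) {B \<inter> ((\<lambda>z. snd (z 1)) -` D \<inter> space Q) |B D. B \<in> sets (history (I n) {..0}) \<and> D \<in> sets borel}" for n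
      using history_insert_observation[of "I n" 1 "{..0}"] by (simp add: A1_def space_Q)
  qed (use A' in \<open>auto simp: A1_def space_Q\<close>)
  have "distr Q (prob_algebra borel) K1 = distr (distr Q Q shift) (prob_algebra borel) K"
    unfolding K1_def[abs_def] by (subst distr_distr) (auto simp: comp_def)
  then have "distr Q (prob_algebra borel) K = distr Q (prob_algebra borel) K \<bind> filter_kernel P g \<phi>"
    using step shift_Q by simp
  then show ?thesis
    using prob_space_distr[OF Km] by (simp add: invariant_prob_def space_prob_algebra)
qed

section \<open>Signal, smoothed and filtered estimates\<close>

context
  fixes f :: "'e \<Rightarrow> real" and C :: real
  assumes f_meas[measurable]: "f \<in> borel_measurable borel" and f_bound: "\<And>x. \<bar>f x\<bar> \<le> C"
begin

definition signal :: "nat \<Rightarrow> (int \<Rightarrow> 'e \<times> 'f) \<Rightarrow> real"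
  where "signal k z = f (fst (z (int k)))"

lemma signal_measurable[measurable]: "signal k \<in> borel_measurable Q"
  unfolding signal_def by measurable

lemma signal_bound: "\<bar>signal k z\<bar> \<le> C"
  by (simp add: signal_def f_bound)

lemma bound_nonneg: "0 \<le> C"
  using f_bound[of undefined] by simp

lemma signal_integrable: "integrable Q (signal k)"
  using signal_bound by (intro integrable_const_bound[of _ C]) auto

lemma signal_shift: "signal 0 (shift_by (int k) z) = signal k z"
  by (simp add: signal_def shift_by_def)

text \<open>The second moments can be compared because each is the integral of one functional, the
  squared mean of \<open>f\<close> under a measure, against the law of the respective conditional
  distribution. Uniqueness makes these two laws equal.\<close>

lemma remote_past_cond_exp:
  defines "A \<equiv> sigma UNIV (\<Inter>n. sets (history {..- int n} {..0} :: (int \<Rightarrow> 'e \<times> 'f) measure))"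
  shows "AE z in Q. real_cond_exp Q A (signal 0) z = real_cond_exp Q (history {} {..0}) (signal 0) z"
proof -
  have A: "space A = UNIV" "sets A = (\<Inter>n. sets (history {..- int n} {..0}))"
    unfolding A_def using sets_inter_sigma[of "\<lambda>n. history {..- int n} {..0} :: (int \<Rightarrow> 'e \<times> 'f) measure" UNIV]
    by (simp_all add: space_measure_of_conv del: sets_measure_of_conv)
  have "sets A \<subseteq> sets (history {..- int 0} {..0})" unfolding A by (rule INF_lower) simp
  then have QA: "subalgebra Q A"
    using A(1) history_subalgebra[of "{..- int 0}" "{..0}"] unfolding subalgebra_def space_Q by blast
  have AY: "subalgebra A (history {} {..0})"
    using history_mono[of "{}" "{..- int n}" "{..0}" "{..0}" for n] A by (auto simp: subalgebra_def)
  note QY = history_subalgebra[of "{}" "{..0}"]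
  obtain K where K: "regular_cond_distr Q A (\<lambda>z. fst (z 0)) K"
    using regular_cond_distr_exists[OF QA fst_measurable] by blast
  obtain L where L: "regular_cond_distr Q (history {} {..0}) (\<lambda>z. fst (z 0)) L"
    using regular_cond_distr_exists[OF QY fst_measurable] by blast
  note Km[measurable] = regular_cond_distr_measurable(2)[OF QA K]
  note Lm[measurable] = regular_cond_distr_measurable(2)[OF QY L]
  have invK: "invariant_prob (prob_algebra borel) (filter_kernel P g \<phi>) (distr Q (prob_algebra borel) K)"
  proof (rule invariant_filter_law[where I="\<lambda>n. {..- int n}", OF _ _ _ A K])
    let ?H = "\<lambda>m. sets (history {..m} {..1} :: (int \<Rightarrow> 'e \<times> 'f) measure)"
    have im: "(\<lambda>i. i + 1) ` {..- int n} = {..1 - int n}" for n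
      by (auto simp: image_iff intro!: bexI[of _ "_ - 1"])
    have mono: "?H m \<subseteq> ?H m'" if "m \<le> m'" for m m'
      using history_mono[of "{..m}" "{..m'}" "{..1}" "{..1}"] that by (auto simp: subalgebra_def)
    \<comment> \<open>A decreasing intersection does not change when its index moves by one. This is
      what makes the remote past invariant under the shift.\<close>
    have "(\<Inter>n. ?H (- int n)) = (\<Inter>n. ?H (1 - int n))"
    proof
      show "(\<Inter>n. ?H (- int n)) \<subseteq> (\<Inter>n. ?H (1 - int n))"
      proof (rule INT_greatest)
        fix n
        have "(\<Inter>n. ?H (- int n)) \<subseteq> ?H (- int n)" by blast
        also have "\<dots> \<subseteq> ?H (1 - int n)" by (rule mono) simp
        finally show "(\<Inter>n. ?H (- int n)) \<subseteq> ?H (1 - int n)" .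
      qed
      show "(\<Inter>n. ?H (1 - int n)) \<subseteq> (\<Inter>n. ?H (- int n))"
      proof (rule INT_greatest)
        fix n
        have "(\<Inter>n. ?H (1 - int n)) \<subseteq> ?H (1 - int (Suc n))" by blast
        then show "(\<Inter>n. ?H (1 - int n)) \<subseteq> ?H (- int n)" by simp
      qed
    qed
    then show "(\<Inter>n. ?H (- int n)) = (\<Inter>n. sets (history ((\<lambda>i. i + 1) ` {..- int n}) {..1} :: (int \<Rightarrow> 'e \<times> 'f) measure))"
      unfolding im .
  qed auto
  \<comment> \<open>With no signal coordinates the condition on the shifted index sets is
    trivial.\<close>
  have invL: "invariant_prob (prob_algebra borel) (filter_kernel P g \<phi>) (distr Q (prob_algebra borel) L)"
    by (rule invariant_filter_law[where I="\<lambda>_. {}", OF _ _ _ _ _ L]) auto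
  have law: "distr Q (prob_algebra borel) K = distr Q (prob_algebra borel) L"
    using unique invK invL unfolding uniquely_ergodic_def by blast
  have sig: "signal 0 = (\<lambda>z. f (fst (z 0)))" by (auto simp: signal_def)
  have EK: "AE z in Q. real_cond_exp Q A (signal 0) z = (\<integral>x. f x \<partial>K z)"
    unfolding sig by (rule regular_cond_distr_cond_exp_bounded[OF QA fst_measurable K f_meas f_bound])
  have EL: "AE z in Q. real_cond_exp Q (history {} {..0}) (signal 0) z = (\<integral>x. f x \<partial>L z)"
    unfolding sig by (rule regular_cond_distr_cond_exp_bounded[OF QY fst_measurable L f_meas f_bound])
  have sq[measurable]: "(\<lambda>\<mu>. (\<integral>x. f x \<partial>\<mu>)\<^sup>2) \<in> borel_measurable (prob_algebra borel)"
  proof -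
    have "(\<lambda>\<mu>. \<integral>x. f x \<partial>\<mu>) \<in> borel_measurable (subprob_algebra borel)" by measurable
    then have "(\<lambda>\<mu>. \<integral>x. f x \<partial>\<mu>) \<in> borel_measurable (prob_algebra borel)"
      unfolding prob_algebra_def by (rule measurable_restrict_space1)
    then show ?thesis by measurable
  qed
  have "expectation (\<lambda>z. (real_cond_exp Q A (signal 0) z)\<^sup>2) = expectation (\<lambda>z. (\<integral>x. f x \<partial>K z)\<^sup>2)"
  proof (rule integral_cong_AE)
    show "(\<lambda>z. (\<integral>x. f x \<partial>K z)\<^sup>2) \<in> borel_measurable Q" by (rule measurable_compose[OF Km sq])
    show "AE z in Q. (real_cond_exp Q A (signal 0) z)\<^sup>2 = (\<integral>x. f x \<partial>K z)\<^sup>2" using EK by eventually_elim simp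
  qed measurable
  also have "\<dots> = (\<integral>\<mu>. (\<integral>x. f x \<partial>\<mu>)\<^sup>2 \<partial>distr Q (prob_algebra borel) K)"
    by (rule integral_distr[OF Km sq, symmetric])
  also have "\<dots> = expectation (\<lambda>z. (\<integral>x. f x \<partial>L z)\<^sup>2)"
    unfolding law by (rule integral_distr[OF Lm sq])
  also have "\<dots> = expectation (\<lambda>z. (real_cond_exp Q (history {} {..0}) (signal 0) z)\<^sup>2)"
  proof (rule integral_cong_AE)
    show "(\<lambda>z. (\<integral>x. f x \<partial>L z)\<^sup>2) \<in> borel_measurable Q" by (rule measurable_compose[OF Lm sq])
    show "AE z in Q. (\<integral>x. f x \<partial>L z)\<^sup>2 = (real_cond_exp Q (history {} {..0}) (signal 0) z)\<^sup>2" using EL by eventually_elim simp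
  qed measurable
  finally have 0: "expectation (\<lambda>z. (real_cond_exp Q A (signal 0) z - real_cond_exp Q (history {} {..0}) (signal 0) z)\<^sup>2) = 0"
    using cond_exp_diff_square[OF QA AY signal_measurable signal_bound, of 0] by simp
  have b: "AE z in Q. \<bar>real_cond_exp Q A (signal 0) z\<bar> \<le> C" "AE z in Q. \<bar>real_cond_exp Q (history {} {..0}) (signal 0) z\<bar> \<le> C"
    by (rule cond_exp_bounded[OF _ signal_measurable signal_bound], fact)+
  have "AE z in Q. norm ((real_cond_exp Q A (signal 0) z - real_cond_exp Q (history {} {..0}) (signal 0) z)\<^sup>2) \<le> (2 * C)\<^sup>2"
    using b
  proof eventually_elim
    case (elim z)
    then have "\<bar>real_cond_exp Q A (signal 0) z - real_cond_exp Q (history {} {..0}) (signal 0) z\<bar> \<le> \<bar>2 * C\<bar>" by linarith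
    then show ?case by (simp add: abs_le_square_iff)
  qed
  then have "integrable Q (\<lambda>z. (real_cond_exp Q A (signal 0) z - real_cond_exp Q (history {} {..0}) (signal 0) z)\<^sup>2)"
    by (rule integrable_const_bound) measurable
  with 0 have "AE z in Q. (real_cond_exp Q A (signal 0) z - real_cond_exp Q (history {} {..0}) (signal 0) z)\<^sup>2 = 0"
    by (subst (asm) integral_nonneg_eq_0_iff_AE) auto
  then show ?thesis by eventually_elim simp
qed

text \<open>The observation window reaches back to minus infinity, so \<open>smoothed j\<close> is
  stationary in \<open>k\<close>, whereas \<open>filtered\<close> starts its window at time 0 and
  need not be. \<open>smoothed 0 k\<close> is the signal itself, and each increase of
  \<open>j\<close> gives up one more time step of it.\<close>

definition smoothed :: "nat \<Rightarrow> nat \<Rightarrow> (int \<Rightarrow> 'e \<times> 'f) \<Rightarrow> real"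
  where "smoothed j k = real_cond_exp Q (history {..int k - int j} {..int k}) (signal k)"

definition filtered :: "nat \<Rightarrow> (int \<Rightarrow> 'e \<times> 'f) \<Rightarrow> real"
  where "filtered k = real_cond_exp Q (history {} {0..int k}) (signal k)"

lemma smoothed_bound: "AE z in Q. \<bar>smoothed j k z\<bar> \<le> C"
  unfolding smoothed_def by (rule cond_exp_bounded[OF history_subalgebra signal_measurable signal_bound])

lemma filtered_bound: "AE z in Q. \<bar>filtered k z\<bar> \<le> C"
  unfolding filtered_def by (rule cond_exp_bounded[OF history_subalgebra signal_measurable signal_bound])

lemma smoothed_measurable[measurable]: "smoothed j k \<in> borel_measurable Q"
  and filtered_measurable[measurable]: "filtered k \<in> borel_measurable Q"
  unfolding smoothed_def filtered_def by measurable

lemma smoothed_0: "AE z in Q. smoothed 0 k z = signal k z"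
proof -
  interpret finite_measure_subalgebra Q "history {..int k} {..int k}" by (rule finite_measure_subalgebraI[OF history_subalgebra])
  have "signal k \<in> borel_measurable (history {..int k} {..int k})"
    unfolding signal_def by (rule measurable_compose[OF measurable_history_fst f_meas]) simp
  from real_cond_exp_F_meas[OF signal_integrable this] show ?thesis by (simp add: smoothed_def)
qed

lemma image_add_int: "(\<lambda>i. i + k) ` {..a} = {..k + a :: int}" "(\<lambda>i. i + k) ` {b..a} = {k + b..k + a :: int}"
  by (auto simp: image_iff intro!: bexI[of _ "_ - k"])

lemma smoothed_shift: "AE z in Q. smoothed j k z = real_cond_exp Q (history {..- int j} {..0}) (signal 0) (shift_by (int k) z)"
  using cond_exp_shift[OF signal_integrable, of "{..int k - int j}" k "{..- int j}" "{..int k}" "{..0}" 0]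
  by (simp add: image_add_int signal_shift smoothed_def)

text \<open>Seen from time 0, the window of the filter is \<open>{- int k..0}\<close> and grows with
  \<open>k\<close>; the sigma-algebra behind \<open>smoothed j k\<close> becomes one that does not
  depend on \<open>k\<close>.\<close>

lemma filtered_shift: "AE z in Q. filtered k z = real_cond_exp Q (history {} {- int k..0}) (signal 0) (shift_by (int k) z)"
  using cond_exp_shift[OF signal_integrable, of "{}" k "{}" "{0..int k}" "{- int k..0}" 0]
  by (simp add: image_add_int signal_shift filtered_def)

section \<open>Averages of innovations weighted by functions of the observations\<close>

context
  fixes h :: "nat \<Rightarrow> (int \<Rightarrow> 'e \<times> 'f) \<Rightarrow> real" and c :: real
  assumes h_adapted: "\<And>k. h k \<in> borel_measurable (history {} {0..int k})"
    and h_bound: "\<And>k z. \<bar>h k z\<bar> \<le> c"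
begin

lemma h_measurable[measurable]: "h k \<in> borel_measurable Q"
  by (rule measurable_from_subalg[OF history_subalgebra h_adapted])

lemma h_bound_nonneg: "0 \<le> c"
  using h_bound[of 0 undefined] by simp

definition increment :: "nat \<Rightarrow> nat \<Rightarrow> (int \<Rightarrow> 'e \<times> 'f) \<Rightarrow> real"
  where "increment j k z = h k z * (smoothed j k z - smoothed (Suc j) k z)"

lemma increment_measurable[measurable]: "increment j k \<in> borel_measurable Q"
  unfolding increment_def by measurable

lemma increment_bound: "AE z in Q. \<bar>increment j k z\<bar> \<le> c * (2 * C)"
  using smoothed_bound[of j k] smoothed_bound[of "Suc j" k]
proof eventually_elim
  case (elim z)
  then have "\<bar>smoothed j k z - smoothed (Suc j) k z\<bar> \<le> 2 * C" by linarith
  then show ?case unfolding increment_def abs_mult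
    by (intro mult_mono h_bound) (auto simp: h_bound_nonneg)
qed

text \<open>For fixed \<open>j\<close> the increments are martingale differences for the filtration generated by
  the signal up to time \<open>k - j\<close> and the observations up to time \<open>k\<close>: conditioning on the signal
  with delay is what makes them orthogonal, although the innovations themselves are not.\<close>

lemma increments_uncorrelated:
  assumes kl: "k < l"
  shows "expectation (\<lambda>z. increment j k z * increment j l z) = 0"
proof -
  define w where "w z = increment j k z * h l z" for z
  \<comment> \<open>The off-by-one that yields orthogonality: as \<open>k < l\<close>, even the
    coarser conditioning at time \<open>l\<close>, with delay \<open>Suc j\<close>, contains the
    signal up to time \<open>k - j\<close>. Hence \<open>w\<close> can be moved under both
    conditional expectations.\<close>
  have meas: "w \<in> borel_measurable (history {..int l - int i} {..int l})" if i: "i \<in> {j, Suc j}" for i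
  proof -
    let ?F = "history {..int l - int i} {..int l} :: (int \<Rightarrow> 'e \<times> 'f) measure"
    have "h k \<in> borel_measurable ?F" "h l \<in> borel_measurable ?F"
      using kl by (auto intro!: measurable_from_subalg[OF history_mono h_adapted])
    moreover have "smoothed j k \<in> borel_measurable ?F" "smoothed (Suc j) k \<in> borel_measurable ?F"
      unfolding smoothed_def using kl i
      by (auto intro!: measurable_from_subalg[OF history_mono borel_measurable_cond_exp])
    ultimately show ?thesis unfolding w_def increment_def by measurable
  qed
  have wm[measurable]: "w \<in> borel_measurable Q" unfolding w_def by measurable
  have "AE z in Q. norm (w z * signal l z) \<le> c * (2 * C) * c * C"
    using increment_bound[of j k]
    by eventually_elim (auto simp: w_def abs_mult bound_nonneg h_bound_nonneg intro!: mult_mono h_bound signal_bound)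
  then have iw: "integrable Q (\<lambda>z. w z * signal l z)" by (rule integrable_const_bound) measurable
  have E: "integrable Q (\<lambda>z. w z * smoothed i l z)" "expectation (\<lambda>z. w z * smoothed i l z) = expectation (\<lambda>z. w z * signal l z)"
    if "i \<in> {j, Suc j}" for i
  proof -
    interpret F: finite_measure_subalgebra Q "history {..int l - int i} {..int l}"
      by (rule finite_measure_subalgebraI[OF history_subalgebra])
    show "integrable Q (\<lambda>z. w z * smoothed i l z)" "expectation (\<lambda>z. w z * smoothed i l z) = expectation (\<lambda>z. w z * signal l z)"
      unfolding smoothed_def by (rule F.real_cond_exp_intg[OF iw meas[OF that] signal_measurable])+
  qed
  have "expectation (\<lambda>z. increment j k z * increment j l z) = expectation (\<lambda>z. w z * smoothed j l z - w z * smoothed (Suc j) l z)"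
    by (intro Bochner_Integration.integral_cong) (auto simp: w_def increment_def[of j l] algebra_simps)
  also have "\<dots> = 0" using E[of j] E[of "Suc j"] by simp
  finally show ?thesis .
qed

text \<open>Telescoping over the delay writes each term as \<open>n\<close> increments plus
  \<open>h k\<close> times \<open>smoothed n k - filtered k\<close>. For fixed \<open>n\<close> the
  increments average out and the rest is dominated by orbit averages of \<open>S n\<close>;
  \<open>n\<close> is sent to infinity last.\<close>

theorem innovation_averages:
  "AE z in Q. (\<lambda>N. (\<Sum>k<N. h k z * (signal k z - filtered k z)) / real N) \<longlonglongrightarrow> 0"
proof -
  define L where "L n = real_cond_exp Q (history {..- int n} {..0}) (signal 0)" for n
  define M where "M n = real_cond_exp Q (history {} {- int n..0}) (signal 0)" for n
  define LY where "LY = real_cond_exp Q (history {} {..0}) (signal 0)"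
  have int: "integrable Q (L n)" "integrable Q LY" for n
    unfolding L_def LY_def by (rule cond_exp_integrable[OF history_subalgebra signal_integrable])+
  have [measurable]: "L n \<in> borel_measurable Q" "M n \<in> borel_measurable Q" "LY \<in> borel_measurable Q" for n
    unfolding L_def LY_def M_def by measurable
  have limL: "(\<lambda>n. expectation (\<lambda>z. \<bar>L n z - LY z\<bar>)) \<longlonglongrightarrow> 0"
  proof -
    define A where "A = sigma UNIV (\<Inter>n. sets (history {..- int n} {..0} :: (int \<Rightarrow> 'e \<times> 'f) measure))"
    have A: "space A = space Q" "sets A = (\<Inter>n. sets (history {..- int n} {..0}))"
      unfolding A_def using sets_inter_sigma[of "\<lambda>n. history {..- int n} {..0} :: (int \<Rightarrow> 'e \<times> 'f) measure" UNIV]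
      by (simp_all add: space_Q space_measure_of_conv del: sets_measure_of_conv)
    have "(\<lambda>n. expectation (\<lambda>z. \<bar>L n z - real_cond_exp Q A (signal 0) z\<bar>)) \<longlonglongrightarrow> 0"
      unfolding L_def by (rule cond_exp_decreasing[OF history_subalgebra _ A signal_integrable]) (simp add: history_mono)
    moreover have "expectation (\<lambda>z. \<bar>L n z - real_cond_exp Q A (signal 0) z\<bar>) = expectation (\<lambda>z. \<bar>L n z - LY z\<bar>)" for n
      using remote_past_cond_exp unfolding A_def LY_def by (intro expectation_abs_diff_AE_cong) measurable
    ultimately show ?thesis by simp
  qed
  have union: "sets (history {} {..0} :: (int \<Rightarrow> 'e \<times> 'f) measure) = sigma_sets (space Q) (\<Union>n. sets (history {} {- int n..0}))"
    unfolding space_Q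
  proof (rule history_observations_union)
    show "(\<Union>n. {- int n..0}) = {..0}"
    proof (intro equalityI subsetI)
      fix x :: int assume "x \<in> {..0}"
      then show "x \<in> (\<Union>n. {- int n..0})" by (intro UN_I[of "nat (- x)"]) auto
    qed auto
  qed
  obtain R where R: "\<And>n. integrable Q (R n)" "\<And>n x. 0 \<le> R n x" "(\<lambda>n. expectation (R n)) \<longlonglongrightarrow> 0"
    "\<And>n. AE x in Q. \<forall>k\<ge>n. \<bar>LY x - M k x\<bar> \<le> R n x"
  proof (rule cond_exp_uniform_bound[of "\<lambda>n. history {} {- int n..0}" "history {} {..0}" "signal 0" C, folded LY_def M_def])
    show "subalgebra (history {} {- int n..0}) (history {} {- int m..0})" if "m \<le> n" for m n
      by (rule history_mono) (use that in auto)
  qed (use union signal_bound history_subalgebra in \<open>auto simp: space_Q\<close>)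
  \<comment> \<open>The first summand measures what the delayed signal adds to the infinite
    observation past, the second what observations before the start of the filter add.\<close>
  define S where "S n z = \<bar>L n z - LY z\<bar> + R n z" for n z
  have S: "integrable Q (S n)" "0 \<le> S n z" for n z
    unfolding S_def using int R by auto
  have "expectation (S n) = expectation (\<lambda>z. \<bar>L n z - LY z\<bar>) + expectation (R n)" for n
    unfolding S_def using int R by (intro Bochner_Integration.integral_add) auto
  then have limS: "(\<lambda>n. expectation (S n)) \<longlonglongrightarrow> 0" using tendsto_add[OF limL R(3)] by simp
  \<comment> \<open>\<open>R n\<close> covers only windows that reach back at least \<open>n\<close>
    steps, hence the restriction \<open>n \<le> k\<close>.\<close>
  have rem: "AE z in Q. n \<le> k \<longrightarrow> \<bar>smoothed n k z - filtered k z\<bar> \<le> S n (shift_by (int k) z)" for n k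
  proof -
    have "AE z in distr Q Q (shift_by (int k)). \<forall>k\<ge>n. \<bar>LY z - M k z\<bar> \<le> R n z"
      unfolding shift_by_Q by (rule R)
    then have "AE z in Q. \<forall>j\<ge>n. \<bar>LY (shift_by (int k) z) - M j (shift_by (int k) z)\<bar> \<le> R n (shift_by (int k) z)"
      by (rule AE_distrD[OF shift_by_measurable])
    with smoothed_shift[of n k, folded L_def] filtered_shift[of k, folded M_def] show ?thesis
    proof eventually_elim
      case (elim z)
      show ?case
      proof
        assume "n \<le> k"
        with elim(3) have "\<bar>LY (shift_by (int k) z) - M k (shift_by (int k) z)\<bar> \<le> R n (shift_by (int k) z)" by blast
        then show "\<bar>smoothed n k z - filtered k z\<bar> \<le> S n (shift_by (int k) z)"
          unfolding elim(1,2) S_def by linarith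
      qed
    qed
  qed
  show ?thesis
  \<comment> \<open>The constant has to be positive and \<open>c\<close> may be 0, hence
    \<open>c + 1\<close>.\<close>
  proof (rule tendsto_zero_by_ergodic_averages[where T=shift and R=S and c="c + 1"])
    show "shift \<in> Q \<rightarrow>\<^sub>M Q" unfolding shift_eq by measurable
    fix n
    have avg: "AE z in Q. \<forall>j. (\<lambda>N. (\<Sum>k<N. increment j k z) / real N) \<longlonglongrightarrow> 0"
      unfolding AE_all_countable
      by (intro allI uncorrelated_average_AE[OF increment_measurable increment_bound increments_uncorrelated])
    have all: "AE z in Q. \<forall>k. smoothed 0 k z = signal k z \<and> \<bar>smoothed n k z\<bar> \<le> C \<and> \<bar>filtered k z\<bar> \<le> C
        \<and> (n \<le> k \<longrightarrow> \<bar>smoothed n k z - filtered k z\<bar> \<le> S n (shift_by (int k) z))"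
      using smoothed_0 smoothed_bound filtered_bound rem by (simp add: AE_all_countable)
    show "AE z in Q. \<exists>e. e \<longlonglongrightarrow> 0 \<and> (\<forall>N. \<bar>(\<Sum>k<N. h k z * (signal k z - filtered k z)) / real N\<bar>
        \<le> e N + (c + 1) * ((\<Sum>k<N. S n ((shift ^^ k) z)) / real N))"
      using avg all
    proof eventually_elim
      case (elim z)
      \<comment> \<open>The last summand pays for the indices \<open>k < n\<close>, where only the
        crude bound \<open>c * (2 * C)\<close> is available; there are at most \<open>n\<close> of
        them.\<close>
      define e where "e N = (\<Sum>j<n. \<bar>(\<Sum>k<N. increment j k z) / real N\<bar>) + c * (2 * C) * real n / real N" for N
      have "(\<lambda>N. (\<Sum>j<n. \<bar>(\<Sum>k<N. increment j k z) / real N\<bar>) + c * (2 * C) * real n / real N) \<longlonglongrightarrow> (\<Sum>j<n. \<bar>0\<bar>) + 0"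
        using elim(1) by (intro tendsto_add tendsto_sum tendsto_rabs lim_const_over_n) auto
      then have "e \<longlonglongrightarrow> 0" by (simp add: e_def[abs_def])
      moreover have "\<bar>(\<Sum>k<N. h k z * (signal k z - filtered k z)) / real N\<bar> \<le> e N + (c + 1) * ((\<Sum>k<N. S n ((shift ^^ k) z)) / real N)" for N
      proof -
        have dec: "h k z * (signal k z - filtered k z) = (\<Sum>j<n. increment j k z) + h k z * (smoothed n k z - filtered k z)" for k
        proof -
          have "(\<Sum>j<n. increment j k z) = h k z * (smoothed 0 k z - smoothed n k z)"
            unfolding increment_def sum_distrib_left[symmetric] by (simp add: sum_lessThan_telescope'[of "\<lambda>j. smoothed j k z"])
          then show ?thesis using elim(2) by (simp add: algebra_simps)
        qed
        have le: "\<bar>h k z * (smoothed n k z - filtered k z)\<bar> \<le> c * S n (shift_by (int k) z) + (if k < n then c * (2 * C) else 0)" for k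
        proof (cases "k < n")
          case True
          have "\<bar>smoothed n k z - filtered k z\<bar> \<le> 2 * C" using elim(2)[rule_format, of k] by linarith
          then have "\<bar>h k z * (smoothed n k z - filtered k z)\<bar> \<le> c * (2 * C)"
            unfolding abs_mult by (intro mult_mono h_bound) (auto simp: h_bound_nonneg)
          moreover have "0 \<le> c * S n (shift_by (int k) z)" using S(2) h_bound_nonneg by simp
          ultimately show ?thesis using True by simp
        next
          case False
          then have "\<bar>h k z * (smoothed n k z - filtered k z)\<bar> \<le> c * S n (shift_by (int k) z)"
            unfolding abs_mult using elim(2) by (intro mult_mono h_bound) (auto simp: h_bound_nonneg)
          then show ?thesis using False by simp
        qed
        have cnt: "(\<Sum>k<N. if k < n then c * (2 * C) else 0) \<le> c * (2 * C) * real n"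
        proof -
          have "(\<Sum>k<N. if k < n then c * (2 * C) else 0) = (\<Sum>k\<in>{..<N} \<inter> {..<n}. c * (2 * C))"
            by (subst sum.inter_restrict) auto
          also have "{..<N} \<inter> {..<n} = {..<min N n}" by auto
          also have "(\<Sum>k<min N n. c * (2 * C)) = c * (2 * C) * real (min N n)" by simp
          also have "\<dots> \<le> c * (2 * C) * real n" using h_bound_nonneg bound_nonneg by (intro mult_left_mono) auto
          finally show ?thesis .
        qed
        have "(\<Sum>k<N. h k z * (signal k z - filtered k z))
          = (\<Sum>j<n. \<Sum>k<N. increment j k z) + (\<Sum>k<N. h k z * (smoothed n k z - filtered k z))"
          unfolding dec sum.distrib by (subst sum.swap) simp
        then have "\<bar>\<Sum>k<N. h k z * (signal k z - filtered k z)\<bar>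
          \<le> (\<Sum>j<n. \<bar>\<Sum>k<N. increment j k z\<bar>) + (\<Sum>k<N. \<bar>h k z * (smoothed n k z - filtered k z)\<bar>)"
          by (auto intro!: order_trans[OF abs_triangle_ineq] add_mono sum_abs)
        also have "(\<Sum>k<N. \<bar>h k z * (smoothed n k z - filtered k z)\<bar>)
          \<le> (\<Sum>k<N. c * S n (shift_by (int k) z) + (if k < n then c * (2 * C) else 0))"
          by (intro sum_mono le)
        also have "\<dots> \<le> c * (\<Sum>k<N. S n (shift_by (int k) z)) + c * (2 * C) * real n"
          using cnt by (simp add: sum.distrib sum_distrib_left)
        also have "c * (\<Sum>k<N. S n (shift_by (int k) z)) \<le> (c + 1) * (\<Sum>k<N. S n (shift_by (int k) z))"
          using S(2) by (intro mult_right_mono sum_nonneg) auto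
        finally have "\<bar>\<Sum>k<N. h k z * (signal k z - filtered k z)\<bar> / real N
          \<le> ((\<Sum>j<n. \<bar>\<Sum>k<N. increment j k z\<bar>) + ((c + 1) * (\<Sum>k<N. S n (shift_by (int k) z)) + c * (2 * C) * real n)) / real N"
          by (intro divide_right_mono) auto
        also have "\<dots> = e N + (c + 1) * ((\<Sum>k<N. S n ((shift ^^ k) z)) / real N)"
        proof -
          have "(\<Sum>j<n. \<bar>\<Sum>k<N. increment j k z\<bar>) / real N = (\<Sum>j<n. \<bar>(\<Sum>k<N. increment j k z) / real N\<bar>)"
            unfolding sum_divide_distrib[of _ "{..<n}"] by simp
          then show ?thesis unfolding e_def shift_pow by (simp add: add_divide_distrib)
        qed
        finally show ?thesis by simp
      qed
      ultimately show ?case by blast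
    qed
  qed (use shift_Q S limS h_bound_nonneg in auto)
qed

end
end
end

section \<open>Transfer from path space\<close>

text \<open>\<open>V - p\<close> is orthogonal to \<open>G\<close>-measurable variables, which
  removes the cross term. Competitors bounded by \<open>C\<close> are all that is required, since
  clipping will not increase the loss.\<close>

lemma (in prob_space) cond_exp_mean_square_optimal:
  assumes G: "subalgebra M G" and V[measurable]: "V \<in> borel_measurable M" and VC: "\<And>x. \<bar>V x\<bar> \<le> C"
    and W: "W \<in> borel_measurable G" and WC: "\<And>x. \<bar>W x\<bar> \<le> C"
  shows "(\<integral>\<^sup>+x. ennreal ((V x - real_cond_exp M G V x)\<^sup>2) \<partial>M) \<le> (\<integral>\<^sup>+x. ennreal ((V x - W x)\<^sup>2) \<partial>M)"
proof -
  interpret finite_measure_subalgebra M G by (rule finite_measure_subalgebraI[OF G])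
  define p where "p = real_cond_exp M G V"
  define h where "h x = W x - p x" for x
  have C: "0 \<le> C" using VC[of undefined] by simp
  have WM[measurable]: "W \<in> borel_measurable M" by (rule measurable_from_subalg[OF G W])
  have pG: "p \<in> borel_measurable G" and [measurable]: "p \<in> borel_measurable M" unfolding p_def by auto
  have hG: "h \<in> borel_measurable G" using W pG unfolding h_def by measurable
  have [measurable]: "h \<in> borel_measurable M" unfolding h_def by measurable
  have pC: "AE x in M. \<bar>p x\<bar> \<le> C" unfolding p_def by (rule cond_exp_bounded[OF G V VC])
  have bnd: "integrable M (\<lambda>x. a x * b x)"
    if "a \<in> borel_measurable M" "b \<in> borel_measurable M" "AE x in M. \<bar>a x\<bar> \<le> 2 * C" "AE x in M. \<bar>b x\<bar> \<le> 2 * C" for a b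
  proof (rule integrable_const_bound)
    show "AE x in M. norm (a x * b x) \<le> (2 * C) * (2 * C)"
      using that(3,4)
    proof eventually_elim
      case (elim x)
      then show ?case unfolding real_norm_def abs_mult by (intro mult_mono) (use C in auto)
    qed
  qed (use that in measurable)
  have b: "AE x in M. \<bar>V x\<bar> \<le> 2 * C" "AE x in M. \<bar>p x\<bar> \<le> 2 * C" "AE x in M. \<bar>h x\<bar> \<le> 2 * C"
    "AE x in M. \<bar>V x - W x\<bar> \<le> 2 * C" "AE x in M. \<bar>V x - p x\<bar> \<le> 2 * C"
  proof -
    show "AE x in M. \<bar>V x\<bar> \<le> 2 * C" using VC C by (intro AE_I2) (smt (verit))
    show "AE x in M. \<bar>p x\<bar> \<le> 2 * C" using pC by eventually_elim (use C in linarith)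
    show "AE x in M. \<bar>h x\<bar> \<le> 2 * C" using pC
    proof eventually_elim
      case (elim x) then show ?case using WC[of x] unfolding h_def by linarith
    qed
    show "AE x in M. \<bar>V x - W x\<bar> \<le> 2 * C"
    proof (rule AE_I2)
      show "\<bar>V x - W x\<bar> \<le> 2 * C" for x using VC[of x] WC[of x] by linarith
    qed
    show "AE x in M. \<bar>V x - p x\<bar> \<le> 2 * C" using pC
    proof eventually_elim
      case (elim x) then show ?case using VC[of x] by linarith
    qed
  qed
  have ih: "integrable M (\<lambda>x. h x * V x)" "integrable M (\<lambda>x. h x * p x)" "integrable M (\<lambda>x. h x * h x)"
    "integrable M (\<lambda>x. (V x - W x) * (V x - W x))" "integrable M (\<lambda>x. (V x - p x) * (V x - p x))"
    by (rule bnd; (measurable; fail | rule b))+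
  have orth: "expectation (\<lambda>x. h x * p x) = expectation (\<lambda>x. h x * V x)"
    unfolding p_def by (rule real_cond_exp_intg(2)[OF ih(1) hG V])
  have "expectation (\<lambda>x. (V x - W x) * (V x - W x))
    = expectation (\<lambda>x. (V x - p x) * (V x - p x) + h x * h x - 2 * (h x * V x) + 2 * (h x * p x))"
    by (intro Bochner_Integration.integral_cong) (auto simp: h_def algebra_simps)
  also have "\<dots> = expectation (\<lambda>x. (V x - p x) * (V x - p x)) + expectation (\<lambda>x. h x * h x)"
    using ih orth by simp
  finally have "expectation (\<lambda>x. (V x - p x) * (V x - p x)) \<le> expectation (\<lambda>x. (V x - W x) * (V x - W x))"
    by simp
  then show ?thesis
    unfolding power2_eq_square p_def[symmetric] using ih(4,5)
    by (simp add: nn_integral_eq_integral ennreal_leI)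
qed

section \<open>Sigma-algebras generated by a process and clipped strategies\<close>

lemma process_sigma_space[simp]: "space (process_sigma M I Z) = space M"
  by (simp add: process_sigma_def)

lemma process_sigma_component:
  assumes "i \<in> I"
  shows "Z i \<in> borel_measurable (process_sigma M I Z)"
proof -
  have "(\<lambda>\<omega>. \<lambda>i\<in>I. Z i \<omega>) \<in> process_sigma M I Z \<rightarrow>\<^sub>M PiM I (\<lambda>_. borel)"
    unfolding process_sigma_def by (rule measurable_vimage_algebra1) (auto simp: space_PiM)
  from measurable_compose[OF this measurable_component_singleton[OF assms]] show ?thesis using assms by simp
qed

lemma process_sigma_least:
  assumes sp: "space N = space M" and Z: "\<And>i. i \<in> I \<Longrightarrow> Z i \<in> borel_measurable N"
  shows "subalgebra N (process_sigma M I Z)"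
  unfolding subalgebra_def
proof
  have "(\<lambda>\<omega>. \<lambda>i\<in>I. Z i \<omega>) \<in> N \<rightarrow>\<^sub>M PiM I (\<lambda>_. borel)" by (rule measurable_restrict) (rule Z)
  then show "sets (process_sigma M I Z) \<subseteq> sets N"
    unfolding process_sigma_def by (subst sets_vimage_algebra2) (auto simp: space_PiM sp[symmetric] dest: measurable_sets)
qed (simp add: sp)

text \<open>The projection onto \<open>[- C, C]\<close>. The target has its values there, so
  clipping a competitor only lowers its squared loss; this reduces arbitrary measurable strategies
  to bounded ones.\<close>

definition clip :: "real \<Rightarrow> real \<Rightarrow> real"
  where "clip C x = max (- C) (min C x)"

lemma clip_measurable[measurable]: "clip C \<in> borel_measurable borel"
  unfolding clip_def[abs_def] by measurable

lemma abs_clip: "0 \<le> C \<Longrightarrow> \<bar>clip C x\<bar> \<le> C"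
  by (auto simp: clip_def)

lemma clip_eq: "\<bar>x\<bar> \<le> C \<Longrightarrow> clip C x = x"
  by (auto simp: clip_def)

lemma clip_closer: "\<bar>x\<bar> \<le> C \<Longrightarrow> (x - clip C y)\<^sup>2 \<le> (x - y)\<^sup>2"
  by (subst abs_le_square_iff[symmetric]) (auto simp: clip_def)

section \<open>The hidden Markov model as a law on path space\<close>

context hidden_markov_model
begin

definition path :: "'w \<Rightarrow> int \<Rightarrow> 'e \<times> 'f"
  where "path \<omega> k = (X k \<omega>, Y k \<omega>)"

definition paths :: "(int \<Rightarrow> 'e \<times> 'f) measure"
  where "paths = path_law M (\<lambda>k \<omega>. (X k \<omega>, Y k \<omega>))"

lemma X_meas[measurable]: "X k \<in> borel_measurable M" and Y_meas[measurable]: "Y k \<in> borel_measurable M"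
  by (rule X_measurable Y_measurable)+

lemma pair_measurable[measurable]: "(\<lambda>\<omega>. (X k \<omega>, Y k \<omega>)) \<in> borel_measurable M"
  unfolding borel_prod[symmetric] by measurable

lemma paths_eq: "paths = distr M (PiM UNIV (\<lambda>_. borel)) path"
  by (simp add: paths_def path_law_def path_def[abs_def])

lemma path_measurable_PiM: "path \<in> M \<rightarrow>\<^sub>M PiM UNIV (\<lambda>_. borel)"
  unfolding path_def[abs_def] by (rule measurable_PiM_single') auto

lemma sets_paths[measurable_cong]: "sets paths = sets (PiM UNIV (\<lambda>_. borel))"
  by (simp add: paths_eq)

lemma path_measurable[measurable]: "path \<in> M \<rightarrow>\<^sub>M paths"
  using path_measurable_PiM measurable_cong_sets[OF refl sets_paths] by blast

lemma distr_path: "distr M paths path = paths"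
  using distr_cong[OF refl sets_paths, of M path path] by (simp add: paths_eq)

text \<open>Evaluates the joint transition on rectangles, the form in which the Markov property
  enters on path space.\<close>

lemma hmm_kernel_rectangle:
  assumes C[measurable]: "C \<in> sets borel" and D[measurable]: "D \<in> sets borel"
  shows "(\<integral>\<^sup>+z. indicator (C \<times> D) z \<partial>hmm_kernel P \<Phi> (x, y)) = (\<integral>\<^sup>+x'. indicator C x' * emeasure (\<Phi> x') D \<partial>P x)"
proof -
  have [measurable]: "P \<in> borel \<rightarrow>\<^sub>M subprob_algebra borel" "\<Phi> \<in> borel \<rightarrow>\<^sub>M subprob_algebra borel"
    by (rule measurable_prob_algebraD[OF P_kernel] measurable_prob_algebraD[OF \<Phi>_kernel])+
  have CD[measurable]: "C \<times> D \<in> sets borel" unfolding borel_prod[symmetric] by measurable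
  have Px: "sets (P x) = sets borel" and Pxp: "prob_space (P x)" for x
    using measurable_space[OF P_kernel, of x] by (auto simp: space_prob_algebra)
  have Fx: "sets (\<Phi> x) = sets borel" for x
    using measurable_space[OF \<Phi>_kernel, of x] by (auto simp: space_prob_algebra)
  have ret: "return borel \<in> borel \<Otimes>\<^sub>M borel \<rightarrow>\<^sub>M subprob_algebra (borel :: ('e \<times> 'f) measure)"
    unfolding borel_prod by (rule return_measurable)
  then have ret': "(\<lambda>z. return borel (fst z, snd z)) \<in> borel \<Otimes>\<^sub>M borel \<rightarrow>\<^sub>M subprob_algebra (borel :: ('e \<times> 'f) measure)"
    by simp
  have inner: "(\<lambda>x'. \<Phi> x' \<bind> (\<lambda>y'. return borel (x', y'))) \<in> borel \<rightarrow>\<^sub>M subprob_algebra (borel :: ('e \<times> 'f) measure)"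
    by (rule measurable_bind[OF _ ret']) measurable
  have inner': "(\<lambda>x'. \<Phi> x' \<bind> (\<lambda>y'. return borel (x', y'))) \<in> P x \<rightarrow>\<^sub>M subprob_algebra (borel :: ('e \<times> 'f) measure)"
    using inner measurable_cong_sets[OF Px refl] by blast
  have "(\<integral>\<^sup>+z. indicator (C \<times> D) z \<partial>hmm_kernel P \<Phi> (x, y))
    = (\<integral>\<^sup>+x'. (\<integral>\<^sup>+z. indicator (C \<times> D) z \<partial>(\<Phi> x' \<bind> (\<lambda>y'. return borel (x', y')))) \<partial>P x)"
    unfolding hmm_kernel_def prod.case by (rule nn_integral_bind[OF _ inner']) measurable
  also have "\<dots> = (\<integral>\<^sup>+x'. indicator C x' * emeasure (\<Phi> x') D \<partial>P x)"
  proof (rule nn_integral_cong)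
    fix x'
    have r: "(\<lambda>y'. return borel (x', y')) \<in> \<Phi> x' \<rightarrow>\<^sub>M subprob_algebra (borel :: ('e \<times> 'f) measure)"
      using measurable_compose[OF _ ret, of "\<lambda>y'. (x', y')" "\<Phi> x'"] Fx measurable_cong_sets[OF Fx refl] by simp
    have "(\<integral>\<^sup>+z. indicator (C \<times> D) z \<partial>(\<Phi> x' \<bind> (\<lambda>y'. return borel (x', y')))) = (\<integral>\<^sup>+y'. (\<integral>\<^sup>+z. indicator (C \<times> D) z \<partial>return borel (x', y')) \<partial>\<Phi> x')"
      by (rule nn_integral_bind[OF _ r]) measurable
    also have "\<dots> = (\<integral>\<^sup>+y'. indicator C x' * indicator D y' \<partial>\<Phi> x')"
      by (intro nn_integral_cong, subst nn_integral_return) (auto simp: indicator_def)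
    also have "\<dots> = indicator C x' * emeasure (\<Phi> x') D"
      using Fx[of x'] by (simp add: nn_integral_cmult)
    finally show "(\<integral>\<^sup>+z. indicator (C \<times> D) z \<partial>(\<Phi> x' \<bind> (\<lambda>y'. return borel (x', y')))) = indicator C x' * emeasure (\<Phi> x') D" .
  qed
  finally show ?thesis .
qed

text \<open>Stationarity becomes invariance of the path law under the shift. For the Markov
  property, past events on path space have preimages in the sigma-algebra generated by the pair
  process up to time 0, where the transition law is known.\<close>

lemma stationary_filter_model_paths:
  assumes stat: "stationary M (\<lambda>k \<omega>. (X k \<omega>, Y k \<omega>))"
    and dens: "observation_density \<Phi> g \<phi>"
    and uniq: "uniquely_ergodic (prob_algebra borel) (filter_kernel P g \<phi>)"
  shows "stationary_filter_model paths P g \<phi>"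
proof -
  have \<phi>: "sets \<phi> = sets borel" "sigma_finite_measure \<phi>" and g: "(\<lambda>(x, y). g x y) \<in> borel_measurable borel"
    and \<Phi>: "\<And>x. \<Phi> x = density \<phi> (\<lambda>y. ennreal (g x y))"
    using dens by (auto simp: observation_density_def)
  note \<phi>(1)[measurable_cong]
  have [measurable]: "(\<lambda>(x, y). g x y) \<in> borel_measurable (borel \<Otimes>\<^sub>M borel)" using g by (simp add: borel_prod)
  have gx: "(\<lambda>y. ennreal (g x y)) \<in> borel_measurable \<phi>" for x by measurable
  have em: "emeasure (\<Phi> x) D = (\<integral>\<^sup>+y. indicator D y * ennreal (g x y) \<partial>\<phi>)" if "D \<in> sets borel" for x D
    unfolding \<Phi> using gx that \<phi>(1) by (simp add: emeasure_density mult.commute)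
  have norm: "(\<integral>\<^sup>+y. ennreal (g x y) \<partial>\<phi>) = 1" for x
  proof -
    have "prob_space (\<Phi> x)" "sets (\<Phi> x) = sets borel" using measurable_space[OF \<Phi>_kernel, of x] by (auto simp: space_prob_algebra)
    then have "emeasure (\<Phi> x) UNIV = 1"
      using prob_space.emeasure_space_1[of "\<Phi> x"] sets_eq_imp_space_eq[of "\<Phi> x" borel] by simp
    then show ?thesis using em[of UNIV x] by simp
  qed
  have [measurable]: "shift \<in> paths \<rightarrow>\<^sub>M paths"
  proof -
    have c: "(\<lambda>z. z (k + 1)) \<in> paths \<rightarrow>\<^sub>M borel" for k :: int
      using measurable_component_singleton[of "k + 1" UNIV "\<lambda>_. borel"] measurable_cong_sets[OF sets_paths refl] by blast
    have "shift \<in> paths \<rightarrow>\<^sub>M PiM UNIV (\<lambda>_. borel)"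
      unfolding shift_def[abs_def] by (rule measurable_PiM_single') (use c in auto)
    then show ?thesis using measurable_cong_sets[OF refl sets_paths] by blast
  qed
  have sh: "distr paths paths shift = paths"
  proof -
    have "distr paths paths shift = distr (distr M paths path) paths shift" by (simp add: distr_path)
    also have "\<dots> = distr M paths (\<lambda>\<omega> k. (X (k + 1) \<omega>, Y (k + 1) \<omega>))"
      by (subst distr_distr) (auto simp: comp_def shift_def path_def)
    also have "\<dots> = path_law M (\<lambda>k \<omega>. (X (k + 1) \<omega>, Y (k + 1) \<omega>))"
      unfolding path_law_def by (rule distr_cong) (simp_all add: sets_paths)
    also have "\<dots> = paths" using stat by (simp add: stationary_def paths_def)
    finally show ?thesis .
  qed
  show ?thesis
  proof (intro stationary_filter_model.intro stationary_filter_model_axioms.intro)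
    show "prob_space paths" unfolding paths_eq by (rule prob_space_distr[OF path_measurable_PiM])
    fix B :: "(int \<Rightarrow> 'e \<times> 'f) set" and C :: "'e set" and D :: "'f set"
    assume B: "B \<in> sets (history {..0} {..0})" and C[measurable]: "C \<in> sets borel" and D[measurable]: "D \<in> sets borel"
    define G where "G = process_sigma M {..0} (\<lambda>j \<omega>. (X j \<omega>, Y j \<omega>))"
    have MG: "subalgebra M G" unfolding G_def by (rule process_sigma_least) measurable
    have cG: "(\<lambda>\<omega>. (X j \<omega>, Y j \<omega>)) \<in> borel_measurable G" if "j \<le> 0" for j
      unfolding G_def by (rule process_sigma_component) (use that in auto)
    have "path \<in> G \<rightarrow>\<^sub>M history {..0} {..0}"
    proof (rule measurable_into_history)
      show "(\<lambda>\<omega>. fst (path \<omega> i)) \<in> borel_measurable G" "(\<lambda>\<omega>. snd (path \<omega> i)) \<in> borel_measurable G" if "i \<in> {..0}" for i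
      proof -
        have p: "(\<lambda>\<omega>. (X i \<omega>, Y i \<omega>)) \<in> G \<rightarrow>\<^sub>M borel \<Otimes>\<^sub>M borel" using cG that by (simp add: borel_prod)
        show "(\<lambda>\<omega>. fst (path \<omega> i)) \<in> borel_measurable G" "(\<lambda>\<omega>. snd (path \<omega> i)) \<in> borel_measurable G"
          using measurable_compose[OF p measurable_fst] measurable_compose[OF p measurable_snd] by (simp_all add: path_def)
      qed
    qed
    from measurable_sets[OF this B] have BG: "path -` B \<inter> space M \<in> sets G" by (simp add: G_def)
    have CD[measurable]: "C \<times> D \<in> sets borel" unfolding borel_prod[symmetric] by measurable
    have coord: "(\<lambda>z. fst (z i)) \<in> borel_measurable paths" "(\<lambda>z. snd (z i)) \<in> borel_measurable paths" for i
    proof -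
      have "(\<lambda>z. z i) \<in> paths \<rightarrow>\<^sub>M borel"
        using measurable_component_singleton[of i UNIV "\<lambda>_. borel"] measurable_cong_sets[OF sets_paths refl] by blast
      then show "(\<lambda>z. fst (z i)) \<in> borel_measurable paths" "(\<lambda>z. snd (z i)) \<in> borel_measurable paths"
        by (auto simp: borel_prod[symmetric])
    qed
    note coord[measurable]
    have BQ[measurable]: "B \<in> sets paths"
    proof -
      have "(\<lambda>z. z) \<in> paths \<rightarrow>\<^sub>M history {..0} {..0}" by (rule measurable_into_history) (rule coord)+
      from measurable_sets[OF this B] sets_eq_imp_space_eq[OF sets_paths] show ?thesis by (simp add: space_PiM)
    qed
    note pull = nn_integral_distr[OF path_measurable, unfolded distr_path]
    have [measurable]: "P \<in> borel \<rightarrow>\<^sub>M subprob_algebra borel" by (rule measurable_prob_algebraD[OF P_kernel])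
    have emm: "(\<lambda>x. \<integral>\<^sup>+y. indicator D y * ennreal (g x y) \<partial>\<phi>) \<in> borel_measurable borel"
      using \<phi>(2) by (intro sigma_finite_measure.borel_measurable_nn_integral) (auto simp: split_beta')
    note emm[measurable]
    have "(\<integral>\<^sup>+z. indicator B z * indicator C (fst (z 1)) * indicator D (snd (z 1)) \<partial>paths)
      = (\<integral>\<^sup>+\<omega>. indicator B (path \<omega>) * indicator C (fst (path \<omega> 1)) * indicator D (snd (path \<omega> 1)) \<partial>M)"
      by (rule pull) measurable
    \<comment> \<open>Written with \<open>0 + 1\<close> to match the Markov property instantiated at
      time 0.\<close>
    also have "\<dots> = (\<integral>\<^sup>+\<omega>. indicator (path -` B \<inter> space M) \<omega> * indicator (C \<times> D) (X (0 + 1) \<omega>, Y (0 + 1) \<omega>) \<partial>M)"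
      by (intro nn_integral_cong) (simp add: indicator_def path_def)
    also have "\<dots> = (\<integral>\<^sup>+\<omega>. indicator (path -` B \<inter> space M) \<omega> * (\<integral>\<^sup>+z. indicator (C \<times> D) z \<partial>hmm_kernel P \<Phi> (X 0 \<omega>, Y 0 \<omega>)) \<partial>M)"
      by (rule regular_cond_distr_integral[OF MG _ markov[of 0, folded G_def] BG]) measurable
    also have "\<dots> = (\<integral>\<^sup>+\<omega>. indicator B (path \<omega>) * (\<integral>\<^sup>+x. indicator C x * (\<integral>\<^sup>+y. indicator D y * ennreal (g x y) \<partial>\<phi>) \<partial>P (fst (path \<omega> 0))) \<partial>M)"
      by (intro nn_integral_cong) (simp add: hmm_kernel_rectangle[OF C D] em[OF D] path_def indicator_def[of B] indicator_def[of "path -` B \<inter> space M"])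
    also have "\<dots> = (\<integral>\<^sup>+z. indicator B z * (\<integral>\<^sup>+x. indicator C x * (\<integral>\<^sup>+y. indicator D y * ennreal (g x y) \<partial>\<phi>) \<partial>P (fst (z 0))) \<partial>paths)"
      by (rule pull[symmetric]) measurable
    finally show "(\<integral>\<^sup>+z. indicator B z * indicator C (fst (z 1)) * indicator D (snd (z 1)) \<partial>paths)
      = (\<integral>\<^sup>+z. indicator B z * (\<integral>\<^sup>+x. indicator C x * (\<integral>\<^sup>+y. indicator D y * ennreal (g x y) \<partial>\<phi>) \<partial>P (fst (z 0))) \<partial>paths)" .
  qed (use sets_paths sh P_kernel \<phi> g norm uniq in auto)
qed

text \<open>This supplies the preimage form needed to write conditioning on observations in the
  original space as conditioning on path space composed with \<open>path\<close>.\<close>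

lemma process_sigma_observations:
  "sets (process_sigma M J Y) = (\<lambda>A. path -` A \<inter> space M) ` sets (history {} J)" (is "?L = ?R")
proof
  let ?N = "vimage_algebra (space M) path (history {} J :: (int \<Rightarrow> 'e \<times> 'f) measure)"
  have N: "sets ?N = ?R" by (subst sets_vimage_algebra2) auto
  have "Y j \<in> borel_measurable ?N" if "j \<in> J" for j
  proof -
    have "path \<in> ?N \<rightarrow>\<^sub>M history {} J" by (rule measurable_vimage_algebra1) simp
    from measurable_compose[OF this measurable_history_snd[OF that]] show ?thesis by (simp add: path_def)
  qed
  then have "subalgebra ?N (process_sigma M J Y)" by (intro process_sigma_least) auto
  then show "?L \<subseteq> ?R" unfolding N[symmetric] by (simp add: subalgebra_def)
  have "path \<in> process_sigma M J Y \<rightarrow>\<^sub>M history {} J"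
    by (rule measurable_into_history) (auto simp: path_def intro: process_sigma_component)
  then show "?R \<subseteq> ?L" by (auto dest: measurable_sets)
qed

lemma observations_subalgebra: "subalgebra M (process_sigma M J Y)"
  by (rule process_sigma_least) auto

text \<open>With \<open>s\<close> the signal, \<open>p\<close> the filter and \<open>u\<close> the
  clipped strategy, the difference of the losses is
  \<open>(u - p)\<^sup>2 - 2 * (u - p) * (s - p)\<close>. The square is dropped, and the averages of
  the other term vanish because \<open>u - p\<close> depends on the observations so far.\<close>

lemma filter_pathwise_optimal:
  assumes stat: "stationary M (\<lambda>k \<omega>. (X k \<omega>, Y k \<omega>))"
    and dens: "observation_density \<Phi> g \<phi>"
    and uniq: "uniquely_ergodic (prob_algebra borel) (filter_kernel P g \<phi>)"
    and \<pi>: "nonlinear_filter M X Y \<pi>"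
    and f[measurable]: "f \<in> borel_measurable borel" and fC: "\<And>x. \<bar>f x\<bar> \<le> C"
    and fhat: "\<And>k. fhat k \<in> borel_measurable (PiM {..k} (\<lambda>_. borel))"
  shows "AE \<omega> in M. liminf (\<lambda>N. ereal
         (1 / real N * (\<Sum>k = 1..N. (f (X (int k) \<omega>) - fhat k (\<lambda>i\<in>{..k}. Y (int i) \<omega>))\<^sup>2)
        - 1 / real N * (\<Sum>k = 1..N. (f (X (int k) \<omega>) - (\<integral>x. f x \<partial>\<pi> k \<omega>))\<^sup>2))) \<ge> 0"
proof -
  interpret S: stationary_filter_model paths P g \<phi>
    by (rule stationary_filter_model_paths[OF stat dens uniq])
  have C: "0 \<le> C" using fC[of undefined] by simp
  define q where "q k = S.filtered f k" for k
  define v where "v k z = clip C (fhat k (\<lambda>i\<in>{..k}. snd (z (int i))))" for k and z :: "int \<Rightarrow> 'e \<times> 'f"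
  \<comment> \<open>The filter is clipped too: the multiplier must be bounded everywhere, and a
    conditional expectation is bounded only almost surely.\<close>
  define h where "h k z = v k z - clip C (q k z)" for k z
  have h_adapted: "h k \<in> borel_measurable (history {} {0..int k})" for k
  proof -
    have obs: "(\<lambda>z :: int \<Rightarrow> 'e \<times> 'f. \<lambda>i\<in>{..k}. snd (z (int i))) \<in> history {} {0..int k} \<rightarrow>\<^sub>M PiM {..k} (\<lambda>_. borel)"
      by (rule measurable_restrict) (auto intro: measurable_history_snd)
    have "v k \<in> borel_measurable (history {} {0..int k})"
      unfolding v_def[abs_def] by (rule measurable_compose[OF measurable_compose[OF obs fhat] clip_measurable])
    moreover have "q k \<in> borel_measurable (history {} {0..int k})" unfolding q_def S.filtered_def[OF f fC] by simp
    ultimately show ?thesis unfolding h_def[abs_def] by measurable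
  qed
  have h_bound: "\<bar>h k z\<bar> \<le> 2 * C" for k z
    using abs_clip[OF C, of "q k z"] abs_clip[OF C, of "fhat k (\<lambda>i\<in>{..k}. snd (z (int i)))"] unfolding h_def v_def by linarith
  have "AE z in distr M paths path. (\<lambda>N. (\<Sum>k<N. h k z * (S.signal f k z - q k z)) / real N) \<longlonglongrightarrow> 0"
    unfolding distr_path q_def by (rule S.innovation_averages[OF f fC h_adapted[unfolded q_def] h_bound])
  then have avg: "AE \<omega> in M. (\<lambda>N. (\<Sum>k<N. h k (path \<omega>) * (f (X (int k) \<omega>) - q k (path \<omega>))) / real N) \<longlonglongrightarrow> 0"
    by (rule AE_distrD[OF path_measurable, THEN AE_mp]) (simp add: S.signal_def[OF f fC] path_def)
  have "AE \<omega> in M. (\<integral>x. f x \<partial>\<pi> k \<omega>) = q k (path \<omega>)" for k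
  proof -
    have rcd: "regular_cond_distr M (process_sigma M {0..int k} Y) (X (int k)) (\<pi> k)"
      using \<pi> by (simp add: nonlinear_filter_def)
    have "AE \<omega> in M. real_cond_exp M (process_sigma M {0..int k} Y) (\<lambda>\<omega>. f (X (int k) \<omega>)) \<omega> = (\<integral>x. f x \<partial>\<pi> k \<omega>)"
      by (rule regular_cond_distr_cond_exp_bounded[OF observations_subalgebra X_meas rcd f fC])
    moreover have "AE \<omega> in M. real_cond_exp M (process_sigma M {0..int k} Y) (\<lambda>\<omega>. S.signal f k (path \<omega>)) \<omega>
        = real_cond_exp paths (history {} {0..int k}) (S.signal f k) (path \<omega>)"
      by (rule real_cond_exp_distr[OF prob_space_axioms path_measurable distr_path S.history_subalgebra
            process_sigma_space process_sigma_observations S.signal_integrable[OF f fC]])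
    ultimately show ?thesis
      by eventually_elim (simp add: q_def S.filtered_def[OF f fC] S.signal_def[OF f fC] path_def)
  qed
  moreover have "AE \<omega> in M. \<bar>q k (path \<omega>)\<bar> \<le> C" for k
  proof -
    have "AE z in distr M paths path. \<bar>q k z\<bar> \<le> C" unfolding distr_path q_def by (rule S.filtered_bound[OF f fC])
    then show ?thesis by (rule AE_distrD[OF path_measurable])
  qed
  ultimately have "AE \<omega> in M. \<forall>k. (\<integral>x. f x \<partial>\<pi> k \<omega>) = q k (path \<omega>) \<and> \<bar>q k (path \<omega>)\<bar> \<le> C"
    by (simp add: AE_all_countable)
  with avg show ?thesis
  proof eventually_elim
    case (elim \<omega>)
    define w where "w k = h k (path \<omega>) * (f (X (int k) \<omega>) - q k (path \<omega>))" for k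
    have wb: "\<bar>w k\<bar> \<le> (2 * C) * (2 * C)" for k
    proof -
      have "\<bar>f (X (int k) \<omega>) - q k (path \<omega>)\<bar> \<le> 2 * C"
        using fC[of "X (int k) \<omega>"] elim(2)[rule_format, of k] by linarith
      then show ?thesis unfolding w_def abs_mult using h_bound C by (intro mult_mono) auto
    qed
    \<comment> \<open>The averages above run over 0, ..., \<open>N - 1\<close>, those in the claim
      over 1, ..., \<open>N\<close>. The sums differ by \<open>w N - w 0\<close>, at most twice the
      bound \<open>(2 * C) * (2 * C)\<close>.\<close>
    have lim: "(\<lambda>N. (\<Sum>k = 1..N. w k) / real N) \<longlonglongrightarrow> 0"
    proof -
      have "(\<lambda>N. (w N - w 0) / real N) \<longlonglongrightarrow> 0"
      proof (rule Lim_null_comparison[OF _ lim_const_over_n[of "8 * C * C"]], rule always_eventually, rule allI)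
        fix N
        have "\<bar>w N - w 0\<bar> \<le> 8 * C * C" using wb[of N] wb[of 0] by linarith
        then show "norm ((w N - w 0) / real N) \<le> 8 * C * C / real N" by (simp add: divide_right_mono)
      qed
      moreover have "(\<Sum>k = 1..N. w k) = (\<Sum>k<N. w k) + (w N - w 0)" for N
        by (induction N) auto
      ultimately show ?thesis using tendsto_add[OF elim(1)[folded w_def]] by (simp add: add_divide_distrib)
    qed
    have step: "(f (X (int k) \<omega>) - fhat k (\<lambda>i\<in>{..k}. Y (int i) \<omega>))\<^sup>2 - (f (X (int k) \<omega>) - (\<integral>x. f x \<partial>\<pi> k \<omega>))\<^sup>2 \<ge> - 2 * w k" for k
    proof -
      let ?s = "f (X (int k) \<omega>)" and ?u = "fhat k (\<lambda>i\<in>{..k}. Y (int i) \<omega>)" and ?p = "q k (path \<omega>)"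
      have v: "v k (path \<omega>) = clip C ?u" by (simp add: v_def path_def cong: restrict_cong)
      have hk: "h k (path \<omega>) = clip C ?u - ?p" using elim(2) by (simp add: h_def v clip_eq)
      have "(?s - clip C ?u)\<^sup>2 - (?s - ?p)\<^sup>2 = (h k (path \<omega>))\<^sup>2 - 2 * w k"
        unfolding w_def hk by (simp add: power2_eq_square algebra_simps)
      moreover have "(?s - clip C ?u)\<^sup>2 \<le> (?s - ?u)\<^sup>2" by (rule clip_closer[OF fC])
      moreover have p: "(\<integral>x. f x \<partial>\<pi> k \<omega>) = ?p" using elim(2) by simp
      ultimately show ?thesis unfolding p using zero_le_power2[of "h k (path \<omega>)"] by linarith
    qed
    let ?D = "\<lambda>N. 1 / real N * (\<Sum>k = 1..N. (f (X (int k) \<omega>) - fhat k (\<lambda>i\<in>{..k}. Y (int i) \<omega>))\<^sup>2)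
        - 1 / real N * (\<Sum>k = 1..N. (f (X (int k) \<omega>) - (\<integral>x. f x \<partial>\<pi> k \<omega>))\<^sup>2)"
    have ge: "- 2 * ((\<Sum>k = 1..N. w k) / real N) \<le> ?D N" for N
    proof -
      have "(\<Sum>k = 1..N. - 2 * w k) \<le> (\<Sum>k = 1..N. (f (X (int k) \<omega>) - fhat k (\<lambda>i\<in>{..k}. Y (int i) \<omega>))\<^sup>2 - (f (X (int k) \<omega>) - (\<integral>x. f x \<partial>\<pi> k \<omega>))\<^sup>2)"
        by (intro sum_mono step)
      then have "(\<Sum>k = 1..N. - 2 * w k) / real N \<le> (\<Sum>k = 1..N. (f (X (int k) \<omega>) - fhat k (\<lambda>i\<in>{..k}. Y (int i) \<omega>))\<^sup>2 - (f (X (int k) \<omega>) - (\<integral>x. f x \<partial>\<pi> k \<omega>))\<^sup>2) / real N"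
        by (rule divide_right_mono) simp
      then show ?thesis by (simp only: sum_subtractf sum_distrib_left[symmetric] diff_divide_distrib
            times_divide_eq_left times_divide_eq_right mult_1)
    qed
    have "(\<lambda>N. ereal (- 2 * ((\<Sum>k = 1..N. w k) / real N))) \<longlonglongrightarrow> ereal (- 2 * 0)"
      by (intro tendsto_intros lim)
    from lim_imp_Liminf[OF sequentially_bot this]
    have "0 = liminf (\<lambda>N. ereal (- 2 * ((\<Sum>k = 1..N. w k) / real N)))" by (rule ssubst) simp
    also have "\<dots> \<le> liminf (\<lambda>N. ereal (?D N))"
      by (intro Liminf_mono always_eventually allI) (use ge in simp)
    finally show ?case .
  qed
qed

text \<open>The conditional expectation is compared with the clipped competitor; monotonicity then
  restores the unclipped loss, which may be infinite.\<close>

lemma filter_mean_square_optimal: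
  assumes \<pi>: "nonlinear_filter M X Y \<pi>"
    and f[measurable]: "f \<in> borel_measurable borel" and fC: "\<And>x. \<bar>f x\<bar> \<le> C"
    and u: "u \<in> borel_measurable (PiM {..k} (\<lambda>_. borel))"
  shows "(\<integral>\<^sup>+\<omega>. ennreal ((f (X (int k) \<omega>) - (\<integral>x. f x \<partial>\<pi> k \<omega>))\<^sup>2) \<partial>M)
     \<le> (\<integral>\<^sup>+\<omega>. ennreal ((f (X (int k) \<omega>) - u (\<lambda>i\<in>{..k}. Y (int i) \<omega>))\<^sup>2) \<partial>M)"
proof -
  let ?G = "process_sigma M {0..int k} Y"
  have C: "0 \<le> C" using fC[of undefined] by simp
  have rcd: "regular_cond_distr M ?G (X (int k)) (\<pi> k)" using \<pi> by (simp add: nonlinear_filter_def)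
  have eq: "AE \<omega> in M. real_cond_exp M ?G (\<lambda>\<omega>. f (X (int k) \<omega>)) \<omega> = (\<integral>x. f x \<partial>\<pi> k \<omega>)"
    by (rule regular_cond_distr_cond_exp_bounded[OF observations_subalgebra X_meas rcd f fC])
  have obs: "(\<lambda>\<omega>. \<lambda>i\<in>{..k}. Y (int i) \<omega>) \<in> ?G \<rightarrow>\<^sub>M PiM {..k} (\<lambda>_. borel)"
    by (rule measurable_restrict) (auto intro: process_sigma_component)
  have clipped: "(\<lambda>\<omega>. clip C (u (\<lambda>i\<in>{..k}. Y (int i) \<omega>))) \<in> borel_measurable ?G"
    by (rule measurable_compose[OF measurable_compose[OF obs u] clip_measurable])
  have "(\<integral>\<^sup>+\<omega>. ennreal ((f (X (int k) \<omega>) - (\<integral>x. f x \<partial>\<pi> k \<omega>))\<^sup>2) \<partial>M)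
    = (\<integral>\<^sup>+\<omega>. ennreal ((f (X (int k) \<omega>) - real_cond_exp M ?G (\<lambda>\<omega>. f (X (int k) \<omega>)) \<omega>)\<^sup>2) \<partial>M)"
    by (rule nn_integral_cong_AE, use eq in eventually_elim) simp
  also have "\<dots> \<le> (\<integral>\<^sup>+\<omega>. ennreal ((f (X (int k) \<omega>) - clip C (u (\<lambda>i\<in>{..k}. Y (int i) \<omega>)))\<^sup>2) \<partial>M)"
    by (rule cond_exp_mean_square_optimal[OF observations_subalgebra _ fC clipped abs_clip[OF C]]) measurable
  also have "\<dots> \<le> (\<integral>\<^sup>+\<omega>. ennreal ((f (X (int k) \<omega>) - u (\<lambda>i\<in>{..k}. Y (int i) \<omega>))\<^sup>2) \<partial>M)"
    by (intro nn_integral_mono ennreal_leI clip_closer fC)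
  finally show ?thesis .
qed

end

text \<open>Squared errors are integrated as nonnegative extended reals, so competitors of infinite
  mean-square error are covered, and \<open>\<pi>\<close> may be any version of the filter. The
  liminf is taken in the extended reals, where it always exists.\<close>

theorem corollary3p17:
  fixes M :: "'w measure"
    and X :: "int \<Rightarrow> 'w \<Rightarrow> 'e::polish_space" and Y :: "int \<Rightarrow> 'w \<Rightarrow> 'f::polish_space"
    and P :: "'e \<Rightarrow> 'e measure" and \<Phi> :: "'e \<Rightarrow> 'f measure"
    and g :: "'e \<Rightarrow> 'f \<Rightarrow> real" and \<phi> :: "'f measure"
    and \<pi> :: "nat \<Rightarrow> 'w \<Rightarrow> 'e measure"
  assumes hmm: "hidden_markov_model M X Y P \<Phi>"
    and stationary: "stationary M (\<lambda>k \<omega>. (X k \<omega>, Y k \<omega>))"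
    and ergodic: "ergodic M (\<lambda>k \<omega>. (X k \<omega>, Y k \<omega>))"
    and density: "observation_density \<Phi> g \<phi>"
    and "filter": "nonlinear_filter M X Y \<pi>"
    and unique: "uniquely_ergodic (prob_algebra borel) (filter_kernel P g \<phi>)"
  shows "\<forall>(f :: 'e \<Rightarrow> real) (fhat :: nat \<Rightarrow> (nat \<Rightarrow> 'f) \<Rightarrow> real).
    f \<in> borel_measurable borel \<and> bounded (range f) \<and>
    (\<forall>k. fhat k \<in> borel_measurable (PiM {..k} (\<lambda>_. borel))) \<longrightarrow>
      (\<forall>k. (\<integral>\<^sup>+\<omega>. ennreal ((f (X (int k) \<omega>) - (\<integral>x. f x \<partial>\<pi> k \<omega>))\<^sup>2) \<partial>M)
         \<le> (\<integral>\<^sup>+\<omega>. ennreal ((f (X (int k) \<omega>) - fhat k (\<lambda>i\<in>{..k}. Y (int i) \<omega>))\<^sup>2) \<partial>M)) \<and>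
      (AE \<omega> in M. liminf (\<lambda>N. ereal
         (1 / real N * (\<Sum>k = 1..N. (f (X (int k) \<omega>) - fhat k (\<lambda>i\<in>{..k}. Y (int i) \<omega>))\<^sup>2)
        - 1 / real N * (\<Sum>k = 1..N. (f (X (int k) \<omega>) - (\<integral>x. f x \<partial>\<pi> k \<omega>))\<^sup>2))) \<ge> 0)"
proof (intro allI impI)
  fix f :: "'e \<Rightarrow> real" and fhat :: "nat \<Rightarrow> (nat \<Rightarrow> 'f) \<Rightarrow> real"
  assume *: "f \<in> borel_measurable borel \<and> bounded (range f) \<and> (\<forall>k. fhat k \<in> borel_measurable (PiM {..k} (\<lambda>_. borel)))"
  then obtain C where C: "\<And>x. \<bar>f x\<bar> \<le> C" by (auto simp: bounded_iff)
  interpret hidden_markov_model M X Y P \<Phi> by (rule hmm)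
  from * show "(\<forall>k. (\<integral>\<^sup>+\<omega>. ennreal ((f (X (int k) \<omega>) - (\<integral>x. f x \<partial>\<pi> k \<omega>))\<^sup>2) \<partial>M)
         \<le> (\<integral>\<^sup>+\<omega>. ennreal ((f (X (int k) \<omega>) - fhat k (\<lambda>i\<in>{..k}. Y (int i) \<omega>))\<^sup>2) \<partial>M)) \<and>
      (AE \<omega> in M. liminf (\<lambda>N. ereal
         (1 / real N * (\<Sum>k = 1..N. (f (X (int k) \<omega>) - fhat k (\<lambda>i\<in>{..k}. Y (int i) \<omega>))\<^sup>2)
        - 1 / real N * (\<Sum>k = 1..N. (f (X (int k) \<omega>) - (\<integral>x. f x \<partial>\<pi> k \<omega>))\<^sup>2))) \<ge> 0)"
    by (intro conjI allI filter_mean_square_optimal[OF "filter" _ C]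
        filter_pathwise_optimal[OF stationary density unique "filter" _ C]) auto
qed

end
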